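(* Let $1<p<\infty$, $n\ge3$, let $u$ be $p$-harmonic in $B_R(x_0)\subset\mathbb R^n$, and set $v=u-u(x_0)$, $A=|Du|^{p-2}$. Let $D,H,G,K,N_*,\Theta$ be as in the context. Let $0<r<R$ and assume that $u$ is smooth and $Du\ne0$ in an annulus (centered at $x_0$) containing $\partial B_r(x_0)$. Then $$D'(r)=\frac{n-p}{r}D(r)+pG(r)$$ and $$H'(r)=\frac{n-1}{r}H(r)+2D(r)+K(r).$$ Consequently, at every such radius for which $H(r)>0$, $$N_*'(r)+N_*(r)\Theta(r)=\frac{pr}{H(r)}\int_{\partial B_r(x_0)}A\left(\partial_\nu u-\frac{N_*(r)}{r}v\right)^2\,dS .$$ In particular, $N_*'(r)+N_*(r)\Theta(r)\ge0$.
   Context: A function $u\in W^{1,p}_{\mathrm{loc}}(\Omega)$ is $p$-harmonic in the open set $\Omega\subset\mathbb R^n$ if $\int_\Omega|Du|^{p-2}Du\cdot D\varphi\,dx=0$ for every $\varphi\in C_c^\infty(\Omega)$ (identified with its $C^{1,\alpha}_{\mathrm{loc}}$ representative). $\nu$ is the outward unit normal on $\partial B_r(x_0)$, $\partial_\nu$ the normal derivative, $dS$ surface measure. Define $$D(r)=\int_{B_r(x_0)}|Du|^p\,dx,\quad H(r)=\int_{\partial B_r(x_0)}Av^2\,dS,\quad G(r)=\int_{\partial B_r(x_0)}A(\partial_\nu u)^2\,dS,\quad K(r)=\int_{\partial B_r(x_0)}v^2\,\partial_\nu A\,dS,$$ and, where $H(r)>0$, $$N_*(r)=\frac{rD(r)}{H(r)},\qquad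 \Theta(r)=\frac{K(r)}{H(r)}-\frac{(p-2)(N_*(r)-1)}{r}.$$ *)

theory Defs
  imports "HOL-Analysis.Analysis"
begin

section \<open>Gradients, smooth functions and test functions\<close>

definition grad :: "('a::euclidean_space \<Rightarrow> real) \<Rightarrow> 'a \<Rightarrow> 'a" where
  "grad f x = (THE D. GDERIV f x :> D)"

lemma grad_eqI: "grad f x = D" if "GDERIV f x :> D"
proof -
  have "D' = D" if "GDERIV f x :> D'" for D'
  proof -
    have "(\<lambda>h. inner h D') = (\<lambda>h. inner h D)"
      using that \<open>GDERIV f x :> D\<close> unfolding gderiv_def by (rule has_derivative_unique)
    then show ?thesis by (metis inner_commute vector_eq_rdot)
  qed
  then show ?thesis using that unfolding grad_def by blast
qed

text \<open>The clauses below are only meant for open \<open>S\<close>: derivatives are taken in the ambient space.\<close>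

primrec Ck_on :: "nat \<Rightarrow> 'a::euclidean_space set \<Rightarrow> ('a \<Rightarrow> real) \<Rightarrow> bool" where
  "Ck_on 0 S f \<longleftrightarrow> continuous_on S f"
| "Ck_on (Suc k) S f \<longleftrightarrow>
     (\<forall>x\<in>S. f differentiable (at x)) \<and>
     (\<forall>v. Ck_on k S (\<lambda>x. frechet_derivative f (at x) v))"

definition smooth_on :: "'a::euclidean_space set \<Rightarrow> ('a \<Rightarrow> real) \<Rightarrow> bool" where
  "smooth_on S f \<longleftrightarrow> (\<forall>k. Ck_on k S f)"

definition test_function :: "'a::euclidean_space set \<Rightarrow> ('a \<Rightarrow> real) \<Rightarrow> bool" where
  "test_function \<Omega> \<phi> \<longleftrightarrow>
     smooth_on UNIV \<phi> \<and>
     compact (closure {x. \<phi> x \<noteq> 0}) \<and> closure {x. \<phi> x \<noteq> 0} \<subseteq> \<Omega>"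

section \<open>\<open>p\<close>-harmonic functions\<close>

definition Lp_loc ::
  "real \<Rightarrow> 'a::euclidean_space set \<Rightarrow> ('a \<Rightarrow> 'b::euclidean_space) \<Rightarrow> bool" where
  "Lp_loc p \<Omega> f \<longleftrightarrow>
     set_borel_measurable lebesgue \<Omega> f \<and>
     (\<forall>K. compact K \<and> K \<subseteq> \<Omega> \<longrightarrow> set_integrable lebesgue K (\<lambda>x. norm (f x) powr p))"

definition weak_gradient ::
  "'a::euclidean_space set \<Rightarrow> ('a \<Rightarrow> real) \<Rightarrow> ('a \<Rightarrow> 'a) \<Rightarrow> bool" where
  "weak_gradient \<Omega> u g \<longleftrightarrow>
     (\<forall>\<phi>. test_function \<Omega> \<phi> \<longrightarrow>
       (\<forall>i\<in>Basis. (LINT x:\<Omega>|lebesgue. u x * (grad \<phi> x \<bullet> i))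
                 = - (LINT x:\<Omega>|lebesgue. (g x \<bullet> i) * \<phi> x)))"

text \<open>\<open>u\<close> lies in \<open>W\<^sup>1\<^sup>,\<^sup>p\<^sub>l\<^sub>o\<^sub>c(\<Omega>)\<close> with weak gradient \<open>g\<close>.\<close>

definition W1p_loc_with ::
  "real \<Rightarrow> 'a::euclidean_space set \<Rightarrow> ('a \<Rightarrow> real) \<Rightarrow> ('a \<Rightarrow> 'a) \<Rightarrow> bool" where
  "W1p_loc_with p \<Omega> u g \<longleftrightarrow> Lp_loc p \<Omega> u \<and> Lp_loc p \<Omega> g \<and> weak_gradient \<Omega> u g"

text \<open>Since \<open>0 powr a = 0\<close>, the field \<open>|g|\<^sup>p\<^sup>-\<^sup>2 g\<close> vanishes where \<open>g\<close> does, for every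
  \<open>p > 1\<close>; this is the usual convention also for \<open>p < 2\<close>.\<close>

definition weakly_p_harmonic_on ::
  "real \<Rightarrow> 'a::euclidean_space set \<Rightarrow> ('a \<Rightarrow> real) \<Rightarrow> bool" where
  "weakly_p_harmonic_on p \<Omega> u \<longleftrightarrow>
     (\<exists>g. W1p_loc_with p \<Omega> u g \<and>
       (\<forall>\<phi>. test_function \<Omega> \<phi> \<longrightarrow>
         (LINT x:\<Omega>|lebesgue. norm (g x) powr (p - 2) * (g x \<bullet> grad \<phi> x)) = 0))"

definition C1_Holder_loc :: "'a::euclidean_space set \<Rightarrow> ('a \<Rightarrow> real) \<Rightarrow> bool" where
  "C1_Holder_loc \<Omega> u \<longleftrightarrow>
     (\<forall>x\<in>\<Omega>. u differentiable (at x)) \<and>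
     (\<exists>\<alpha>. 0 < \<alpha> \<and> \<alpha> < 1 \<and>
       (\<forall>K. compact K \<and> K \<subseteq> \<Omega> \<longrightarrow>
         (\<exists>C. \<forall>x\<in>K. \<forall>y\<in>K. norm (grad u x - grad u y) \<le> C * dist x y powr \<alpha>)))"

text \<open>A \<open>p\<close>-harmonic function is identified with its \<open>C\<^sup>1\<^sup>,\<^sup>\<alpha>\<^sub>l\<^sub>o\<^sub>c\<close> representative, so that
  pointwise values and the classical gradient \<open>grad u\<close> (which is the weak gradient almost
  everywhere) make sense.\<close>

definition p_harmonic_on :: "real \<Rightarrow> 'a::euclidean_space set \<Rightarrow> ('a \<Rightarrow> real) \<Rightarrow> bool" where
  "p_harmonic_on p \<Omega> u \<longleftrightarrow> open \<Omega> \<and> weakly_p_harmonic_on p \<Omega> u \<and> C1_Holder_loc \<Omega> u"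

section \<open>Surface measure on spheres\<close>

text \<open>The surface measure of a Borel subset \<open>E\<close> of the unit sphere of \<open>\<real>\<^sup>n\<close> is \<open>n\<close> times the
  Lebesgue measure of the cone \<open>{x. 0 < |x| < 1 \<and> x / |x| \<in> E}\<close> (Stein--Shakarchi, Folland);
  it is transported to \<open>\<partial>B\<^sub>r(x\<^sub>0)\<close> by the similarity \<open>\<omega> \<mapsto> x\<^sub>0 + r \<omega>\<close>, which scales
  it by \<open>r\<^sup>n\<^sup>-\<^sup>1\<close>.  The space of the measure is the sphere itself, so integrands need to be
  measurable on the sphere only.  Meant for \<open>r > 0\<close>.\<close>

definition sphere_measure :: "'a::euclidean_space \<Rightarrow> real \<Rightarrow> 'a measure" where
  "sphere_measure x0 r =
     scale_measure (ennreal (real DIM('a) * r ^ (DIM('a) - 1)))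
       (distr (restrict_space lborel (ball 0 1 - {0})) (restrict_space borel (sphere x0 r))
         (\<lambda>x. x0 + (r / norm x) *\<^sub>R x))"

lemma measurable_sphere_proj:
  fixes x0 :: "'a::euclidean_space"
  assumes "r > 0"
  shows "(\<lambda>x. x0 + (r / norm x) *\<^sub>R x)
    \<in> restrict_space lborel (ball 0 1 - {0}) \<rightarrow>\<^sub>M restrict_space borel (sphere x0 r)"
proof (rule measurable_restrict_space2)
  show "(\<lambda>x. x0 + (r / norm x) *\<^sub>R x) \<in> space (restrict_space lborel (ball 0 1 - {0})) \<rightarrow> sphere x0 r"
    using assms by (auto simp: space_restrict_space dist_norm)
  show "(\<lambda>x. x0 + (r / norm x) *\<^sub>R x) \<in> restrict_space lborel (ball 0 1 - {0}) \<rightarrow>\<^sub>M borel"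
    by (rule measurable_restrict_space1) measurable
qed

lemma emeasure_sphere_measure:
  fixes x0 :: "'a::euclidean_space"
  assumes r: "r > 0" and E: "E \<in> sets borel" "E \<subseteq> sphere x0 r"
  shows "emeasure (sphere_measure x0 r) E =
    ennreal (real DIM('a) * r ^ (DIM('a) - 1)) *
    emeasure lborel {x \<in> ball 0 1 - {0}. x0 + (r / norm x) *\<^sub>R x \<in> E}"
proof -
  have E': "E \<in> sets (restrict_space borel (sphere x0 r))"
    using E by (auto simp: sets_restrict_space)
  have eq: "(\<lambda>x. x0 + (r / norm x) *\<^sub>R x) -` E \<inter> space (restrict_space lborel (ball 0 1 - {0}))
      = {x \<in> ball 0 1 - {0}. x0 + (r / norm x) *\<^sub>R x \<in> E}"
    by (auto simp: space_restrict_space)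
  show ?thesis
    unfolding sphere_measure_def emeasure_scale_measure
      emeasure_distr[OF measurable_sphere_proj[OF r] E'] eq
    by (subst emeasure_restrict_space) auto
qed

definition sphere_normal :: "'a::euclidean_space \<Rightarrow> 'a \<Rightarrow> 'a" where
  "sphere_normal x0 x = (x - x0) /\<^sub>R norm (x - x0)"

definition normal_deriv :: "'a::euclidean_space \<Rightarrow> ('a \<Rightarrow> real) \<Rightarrow> 'a \<Rightarrow> real" where
  "normal_deriv x0 f x = grad f x \<bullet> sphere_normal x0 x"

section \<open>The frequency quantities\<close>

text \<open>Since \<open>0 powr a = 0\<close>, \<open>weightA p u x\<close> is \<open>0\<close> at critical points for every \<open>p\<close>,
  also for \<open>p \<le> 2\<close>. It is used below only on spheres, and these are considered only where
  \<open>grad u x \<noteq> 0\<close>.\<close>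

definition weightA :: "real \<Rightarrow> ('a::euclidean_space \<Rightarrow> real) \<Rightarrow> 'a \<Rightarrow> real" where
  "weightA p u x = norm (grad u x) powr (p - 2)"

definition freqD :: "real \<Rightarrow> ('a::euclidean_space \<Rightarrow> real) \<Rightarrow> 'a \<Rightarrow> real \<Rightarrow> real" where
  "freqD p u x0 r = (LINT x:ball x0 r|lebesgue. norm (grad u x) powr p)"

definition freqH :: "real \<Rightarrow> ('a::euclidean_space \<Rightarrow> real) \<Rightarrow> 'a \<Rightarrow> real \<Rightarrow> real" where
  "freqH p u x0 r = (LINT x|sphere_measure x0 r. weightA p u x * (u x - u x0)\<^sup>2)"

definition freqG :: "real \<Rightarrow> ('a::euclidean_space \<Rightarrow> real) \<Rightarrow> 'a \<Rightarrow> real \<Rightarrow> real" where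
  "freqG p u x0 r = (LINT x|sphere_measure x0 r. weightA p u x * (normal_deriv x0 u x)\<^sup>2)"

definition freqK :: "real \<Rightarrow> ('a::euclidean_space \<Rightarrow> real) \<Rightarrow> 'a \<Rightarrow> real \<Rightarrow> real" where
  "freqK p u x0 r =
     (LINT x|sphere_measure x0 r. (u x - u x0)\<^sup>2 * normal_deriv x0 (weightA p u) x)"

text \<open>The next two are meaningful only where \<open>freqH p u x0 r > 0\<close>.\<close>

definition freqN :: "real \<Rightarrow> ('a::euclidean_space \<Rightarrow> real) \<Rightarrow> 'a \<Rightarrow> real \<Rightarrow> real" where
  "freqN p u x0 r = r * freqD p u x0 r / freqH p u x0 r"

definition freqTheta :: "real \<Rightarrow> ('a::euclidean_space \<Rightarrow> real) \<Rightarrow> 'a \<Rightarrow> real \<Rightarrow> real" where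
  "freqTheta p u x0 r =
     freqK p u x0 r / freqH p u x0 r - (p - 2) * (freqN p u x0 r - 1) / r"

end

theory Submission
  imports Defs
begin

text \<open>The only information about \<open>u\<close> near its critical points is that it is \<open>C\<^sup>1\<close> and
  satisfies the weak equation, so the Rellich--Pohozaev identity cannot be obtained by
  multiplying the equation by \<open>(x - x\<^sub>0) \<bullet> Du\<close> and integrating by parts. It follows instead from
  convexity. Testing the equation with \<open>\<psi>\<close> times a radial cutoff yields the flux identity
  \<open>\<integral>\<^bsub>B\<^sub>r\<^esub> A Du \<bullet> D\<psi> = \<integral>\<^bsub>\<partial>B\<^sub>r\<^esub> A \<partial>\<^sub>\<nu>u \<psi>\<close> for every \<open>C\<^sup>1\<close> function \<open>\<psi>\<close>. For \<open>w(x) = u(x\<^sub>0 + \<lambda>(x - x\<^sub>0))\<close> the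
  inequality \<open>|Dw|\<^sup>p \<ge> |Du|\<^sup>p + p A Du \<bullet> (Dw - Du)\<close> then gives
  \<open>\<lambda>\<^bsup>p-n\<^esup> D(\<lambda>r) \<ge> D(r) + p \<integral>\<^bsub>\<partial>B\<^sub>r\<^esub> A \<partial>\<^sub>\<nu>u (w - u)\<close> for all \<open>\<lambda>\<close> near \<open>1\<close>, with equality at
  \<open>\<lambda> = 1\<close>, so the derivatives of both sides at \<open>\<lambda> = 1\<close> agree: this is the formula for \<open>D'(r)\<close>.
  The flux identity with \<open>\<psi> = v\<close> turns the derivative of \<open>H\<close> into the stated form, and the
  formula for \<open>N\<^sub>*\<close> is algebra.\<close>

section \<open>Smooth bump functions and convolutions\<close>

text \<open>Two obstacles shape the argument. The equation is given for smooth test functions and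
  for a weak gradient known up to null sets, whereas radial cutoffs are merely Lipschitz. Hence the
  weak gradient has to be identified with \<open>grad u\<close>, and the equation extended by
  mollification; this works for every p > 1 because |A Du| = |Du|^(p-1) is locally bounded even
  where A is not. Moreover Du may vanish inside the ball, so nothing may be differentiated twice
  there. The competitor w - u involves first derivatives only, and the convexity inequality holds
  pointwise, also at critical points. On the annulus Du does not vanish, so the boundary integrands
  are continuous and the radial derivatives exist. The cutoff is the quadratic \<rho>^2 - |x - x0|^2
  instead of a thin linear layer: it gives an exact identity for every \<rho>, which can be
  differentiated in \<rho>, and no limit of shrinking layers occurs. A one-sided inequality is
  enough because \<lambda> runs through both sides of 1 and D is already known to be differentiable
  at r: an interior minimum has derivative zero.\<close>

lemma Ck_on_Suc_imp: "Ck_on (Suc k) S f \<Longrightarrow> Ck_on k S f"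
proof (induction k arbitrary: f)
  case 0
  then show ?case
    by (auto intro!: continuous_at_imp_continuous_on differentiable_imp_continuous_within)
next
  case (Suc k)
  then show ?case by (metis Ck_on.simps(2))
qed

lemma Ck_on_const: "Ck_on k UNIV (\<lambda>_::'a::euclidean_space. c)"
  by (induction k arbitrary: c) auto

lemma Ck_on_add:
  "Ck_on k UNIV f \<Longrightarrow> Ck_on k UNIV g \<Longrightarrow> Ck_on k UNIV (\<lambda>x. f x + g x)"
proof (induction k arbitrary: f g)
  case 0
  then show ?case by (auto intro: continuous_intros)
next
  case (Suc k)
  then have "frechet_derivative (\<lambda>x. f x + g x) (at x) =
      (\<lambda>v. frechet_derivative f (at x) v + frechet_derivative g (at x) v)" for x
    by (intro frechet_derivative_at[symmetric] has_derivative_add)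
       (auto simp: frechet_derivative_works)
  with Suc show ?case by auto
qed

lemma Ck_on_mult:
  "Ck_on k UNIV f \<Longrightarrow> Ck_on k UNIV g \<Longrightarrow> Ck_on k UNIV (\<lambda>x. f x * g x)"
proof (induction k arbitrary: f g)
  case 0
  then show ?case by (auto intro: continuous_intros)
next
  case (Suc k)
  then have "frechet_derivative (\<lambda>x. f x * g x) (at x) =
      (\<lambda>v. f x * frechet_derivative g (at x) v + frechet_derivative f (at x) v * g x)" for x
    by (intro frechet_derivative_at[symmetric] has_derivative_mult)
       (auto simp: frechet_derivative_works)
  with Suc.prems Suc.IH Ck_on_Suc_imp[OF Suc.prems(1)] Ck_on_Suc_imp[OF Suc.prems(2)]
  show ?case by (auto intro!: Ck_on_add)
qed

lemma Ck_on_bounded_linear: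
  fixes f :: "'a::euclidean_space \<Rightarrow> real"
  assumes "bounded_linear f"
  shows "Ck_on k UNIV f"
proof (cases k)
  case 0
  then show ?thesis using assms by (auto intro: linear_continuous_on)
next
  case (Suc j)
  have "frechet_derivative f (at x) = f" for x
    using bounded_linear_imp_has_derivative[OF assms] frechet_derivative_at by metis
  then show ?thesis
    using assms Suc by (auto simp: Ck_on_const bounded_linear_imp_differentiable)
qed

lemma Ck_on_const_minus_inner:
  fixes c :: real
  shows "Ck_on k UNIV (\<lambda>x::'a::euclidean_space. c - x \<bullet> x)"
proof (cases k)
  case 0
  then show ?thesis by (auto intro!: continuous_intros)
next
  case (Suc j)
  have *: "((\<lambda>x::'a. c - x \<bullet> x) has_derivative (\<lambda>v. v \<bullet> (-2 *\<^sub>R x))) (at x)" for x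
    by (auto intro!: derivative_eq_intros simp: inner_commute)
  have "Ck_on j UNIV (\<lambda>x::'a. v \<bullet> (-2 *\<^sub>R x))" for v
    by (intro Ck_on_bounded_linear bounded_linear_intros)
  then have "Ck_on j UNIV (\<lambda>x::'a. frechet_derivative (\<lambda>x. c - x \<bullet> x) (at x) v)" for v
    by (subst frechet_derivative_at[OF *, symmetric])
  then show ?thesis
    using * by (auto simp: differentiable_def Suc)
qed

text \<open>The functions \<open>t\<^bsup>-j\<^esup> exp(-1/t)\<close>, extended by \<open>0\<close>, have all their derivatives in their linear span.\<close>

definition flat_exp :: "nat \<Rightarrow> real \<Rightarrow> real" where
  "flat_exp j t = (if t > 0 then (1/t) ^ j * exp (- (1/t)) else 0)"

lemma flat_exp_limit: "((\<lambda>t. flat_exp j t) \<longlongrightarrow> 0) (at 0)"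
proof -
  have "((\<lambda>s::real. s ^ j / exp s) \<longlongrightarrow> 0) at_top" by (rule tendsto_power_div_exp_0)
  then have "((\<lambda>t::real. (inverse t) ^ j / exp (inverse t)) \<longlongrightarrow> 0) (at_right 0)"
    by (rule filterlim_compose) (rule filterlim_inverse_at_top_right)
  then have R: "((\<lambda>t. flat_exp j t) \<longlongrightarrow> 0) (at_right 0)"
    by (rule Lim_transform_eventually)
       (auto simp: eventually_at_filter flat_exp_def exp_minus divide_simps)
  have L: "((\<lambda>t. flat_exp j t) \<longlongrightarrow> 0) (at_left 0)"
    by (rule Lim_transform_eventually[OF tendsto_const])
       (auto simp: eventually_at_filter flat_exp_def)
  show ?thesis using L R filterlim_split_at by blast
qed

lemma DERIV_flat_exp:
  "(flat_exp j has_real_derivative (flat_exp (j+2) t - real j * flat_exp (j+1) t)) (at t)"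
proof -
  consider "t > 0" | "t < 0" | "t = 0" by linarith
  then show ?thesis
  proof cases
    case 1
    have "((\<lambda>t. 1/t) has_real_derivative - ((1/t)^2)) (at t)"
      using 1 by (auto intro!: derivative_eq_intros simp: power2_eq_square)
    note d = this DERIV_power[OF this, of j] DERIV_chain2[OF DERIV_exp DERIV_minus[OF this]]
    \<comment> \<open>The truncated exponent at \<open>j = 0\<close> is harmless: the factor
      \<open>real j\<close> makes both sides vanish.\<close>
    have "real j * (1/t) ^ (j - Suc 0) * (1/t)^2 = real j * (1/t) ^ (j+1)"
      by (cases j) (auto simp: power2_eq_square)
    then have "((\<lambda>t. (1/t) ^ j * exp (- (1/t))) has_real_derivative
        (flat_exp (j+2) t - real j * flat_exp (j+1) t)) (at t)"
      using 1 by (intro DERIV_cong[OF DERIV_mult[OF d(2,3)]])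
        (auto simp: flat_exp_def algebra_simps power2_eq_square)
    then show ?thesis
      by (rule has_field_derivative_transform_within_open[of _ _ _ "{0<..}"])
         (use 1 in \<open>auto simp: flat_exp_def\<close>)
  next
    case 2
    have "((\<lambda>t. 0::real) has_real_derivative (flat_exp (j+2) t - real j * flat_exp (j+1) t)) (at t)"
      using 2 by (auto simp: flat_exp_def)
    then show ?thesis
      by (rule has_field_derivative_transform_within_open[of _ _ _ "{..<0}"])
         (use 2 in \<open>auto simp: flat_exp_def\<close>)
  next
    case 3
    \<comment> \<open>The difference quotient of \<open>flat_exp j\<close> at 0 is
      \<open>flat_exp (Suc j)\<close> itself, so its limit is already known.\<close>
    have "((\<lambda>h. flat_exp (Suc j) h) \<longlongrightarrow> 0) (at 0)" by (rule flat_exp_limit)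
    then have "((\<lambda>h. (flat_exp j (0+h) - flat_exp j 0)/h) \<longlongrightarrow> 0) (at 0)"
      by (rule Lim_transform_eventually)
         (auto simp: eventually_at_filter flat_exp_def divide_simps)
    then have "(flat_exp j has_real_derivative 0) (at 0)" unfolding DERIV_def .
    then show ?thesis using 3 by (simp add: flat_exp_def)
  qed
qed

text \<open>The chain rule turns index j into j+1 and j+2, multiplied by derivatives of q; so the
  induction on k keeps j arbitrary and closes by the product rule.\<close>

lemma Ck_on_flat_exp_comp:
  assumes "\<And>k. Ck_on k UNIV q"
  shows "Ck_on k UNIV (\<lambda>x. flat_exp j (q x))"
proof (induction k arbitrary: j)
  case 0
  have "continuous_on UNIV (flat_exp j)"
    by (rule DERIV_continuous_on) (rule has_field_derivative_at_within[OF DERIV_flat_exp])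
  from continuous_on_compose2[OF this, of UNIV q] assms[of 0] show ?case by simp
next
  case (Suc k)
  have *: "((\<lambda>x. flat_exp j (q x)) has_derivative
      (\<lambda>v. (flat_exp (j+2) (q x) - real j * flat_exp (j+1) (q x)) * frechet_derivative q (at x) v)) (at x)" for x
  proof -
    have "(q has_derivative frechet_derivative q (at x)) (at x)"
      using assms[of "Suc 0"] by (simp add: frechet_derivative_works)
    moreover have "(flat_exp j has_derivative (*) (flat_exp (j+2) (q x) - real j * flat_exp (j+1) (q x))) (at (q x))"
      using DERIV_flat_exp[of j "q x"] by (simp only: has_field_derivative_def)
    ultimately show ?thesis
      by (rule has_derivative_compose)
  qed
  have "Ck_on k UNIV (\<lambda>x. (flat_exp (j+2) (q x) + (- real j) * flat_exp (j+1) (q x)) * frechet_derivative q (at x) v)" for v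
    using assms[of "Suc k"] by (intro Ck_on_mult Ck_on_add Ck_on_const Suc) auto
  then show ?case
    by (simp add: frechet_derivative_at[OF *, symmetric]) (use * in \<open>unfold differentiable_def, blast\<close>)
qed

text \<open>All derivatives fall on the kernel, so \<psi> may be merely continuous; each directional
  derivative is again an integral of this form, which is why the induction varies \<rho>.
  Integrating over a fixed box permits Leibniz' rule on a compact domain, and a box containing the
  support of \<psi> gives the full convolution.\<close>

lemma Ck_on_convolution:
  fixes \<rho> \<psi> :: "'a::euclidean_space \<Rightarrow> real"
  assumes "\<And>k. Ck_on k UNIV \<rho>" and cont: "continuous_on UNIV \<psi>"
  shows "Ck_on k UNIV (\<lambda>x. integral (cbox a b) (\<lambda>y. \<psi> y * \<rho> (x - y)))"
  using assms(1)
proof (induction k arbitrary: \<rho>)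
  case 0
  have c\<rho>: "continuous_on UNIV \<rho>" using 0[of 0] by simp
  have "continuous_on (UNIV \<times> cbox a b) (\<lambda>(x,y). \<psi> y * \<rho> (x - y))"
    unfolding split_beta
    by (intro continuous_intros continuous_on_compose2[OF cont] continuous_on_compose2[OF c\<rho>]) auto
  then show ?case by (auto intro: integral_continuous_on_param)
next
  case (Suc k)
  have c\<rho>: "continuous_on UNIV \<rho>" using Suc.prems[of 0] by simp
  \<comment> \<open>Leibniz' rule asks for a derivative that is continuous in operator norm; in
    finite dimension continuity of the directional derivatives yields this.\<close>
  define D where "D x = Blinfun (frechet_derivative \<rho> (at x))" for x
  have der: "(\<rho> has_derivative frechet_derivative \<rho> (at x)) (at x)" for x
    using Suc.prems[of "Suc 0"] by (simp add: frechet_derivative_works)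
  have D: "blinfun_apply (D x) = frechet_derivative \<rho> (at x)" for x
    unfolding D_def using der by (intro bounded_linear_Blinfun_apply) (rule has_derivative_bounded_linear)
  have cD: "continuous_on UNIV D"
    using Suc.prems[of "Suc 0"] by (intro continuous_on_blinfun_componentwise) (simp add: D)
  let ?D = "\<lambda>x y. \<psi> y *\<^sub>R D (x - y)"
  let ?I = "\<lambda>x. integral (cbox a b) (\<lambda>y. \<psi> y * \<rho> (x - y))"
  have c2: "continuous_on (UNIV \<times> cbox a b) (\<lambda>(x,y). ?D x y)"
    unfolding split_beta
    by (intro continuous_intros continuous_on_compose2[OF cont] continuous_on_compose2[OF cD]) auto
  have *: "(?I has_derivative blinfun_apply (integral (cbox a b) (?D x))) (at x)" for x
  proof (rule leibniz_rule[where U=UNIV])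
    show "((\<lambda>x. \<psi> y * \<rho> (x - y)) has_derivative blinfun_apply (?D x y)) (at x)" for x y
    proof -
      have "((\<lambda>x. \<rho> (x - y)) has_derivative frechet_derivative \<rho> (at (x - y))) (at x)"
        using has_derivative_compose[OF has_derivative_diff[OF has_derivative_ident has_derivative_const[of y]] der]
        by simp
      from has_derivative_mult_right[OF this, of "\<psi> y"] show ?thesis
        by (rule has_derivative_eq_rhs) (simp add: D scaleR_blinfun.rep_eq fun_eq_iff)
    qed
    show "(\<lambda>y. \<psi> y * \<rho> (x - y)) integrable_on cbox a b" for x
      by (intro integrable_continuous continuous_intros continuous_on_compose2[OF cont] continuous_on_compose2[OF c\<rho>]) auto
    show "continuous_on (UNIV \<times> cbox a b) (\<lambda>(x,y). ?D x y)" by (rule c2)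
  qed auto
  have "blinfun_apply (integral (cbox a b) (?D x)) v
      = integral (cbox a b) (\<lambda>y. \<psi> y * frechet_derivative \<rho> (at (x - y)) v)" for x v
  proof -
    have "?D x integrable_on cbox a b"
      by (intro integrable_continuous continuous_intros continuous_on_compose2[OF cont] continuous_on_compose2[OF cD]) auto
    from blinfun_apply_integral[OF this, of v] show ?thesis by (simp add: D scaleR_blinfun.rep_eq)
  qed
  moreover have "Ck_on k UNIV (\<lambda>x. integral (cbox a b) (\<lambda>y. \<psi> y * frechet_derivative \<rho> (at (x - y)) v))" for v
    by (rule Suc.IH[of "\<lambda>z. frechet_derivative \<rho> (at z) v"]) (use Suc.prems[of "Suc k" for k] in auto)
  ultimately show ?case
    by (simp add: frechet_derivative_at[OF *, symmetric]) (use * in \<open>unfold differentiable_def, blast\<close>)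
qed

section \<open>Affine change of variables and mollification\<close>

lemma lborel_integral_affine:
  fixes f :: "'a::euclidean_space \<Rightarrow> real"
  assumes [measurable]: "f \<in> borel_measurable borel" and c: "c \<noteq> 0"
  shows "(LINT x|lborel. f x) = \<bar>c\<bar> ^ DIM('a) * (LINT x|lborel. f (t + c *\<^sub>R x))"
proof -
  have "(LINT x|lborel. f x) =
      (LINT x|density (distr lborel borel (\<lambda>x. t + c *\<^sub>R x)) (\<lambda>_. ennreal (\<bar>c\<bar> ^ DIM('a))). f x)"
    using lborel_affine[OF c, of t] by simp
  also have "\<dots> = (LINT x|distr lborel borel (\<lambda>x. t + c *\<^sub>R x). \<bar>c\<bar> ^ DIM('a) *\<^sub>R f x)"
    by (subst integral_density) auto
  also have "\<dots> = (LINT x|lborel. \<bar>c\<bar> ^ DIM('a) *\<^sub>R f (t + c *\<^sub>R x))"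
    by (subst integral_distr) auto
  finally show ?thesis by simp
qed

lemma integrable_continuous_compact_support:
  fixes f :: "'a::euclidean_space \<Rightarrow> real"
  assumes "continuous_on UNIV f" "\<And>x. x \<notin> cball x0 s \<Longrightarrow> f x = 0"
  shows "integrable lborel f"
proof -
  have "integrable lborel (\<lambda>x. indicator (cball x0 s) x *\<^sub>R f x)"
    by (rule borel_integrable_compact) (auto intro: continuous_on_subset[OF assms(1)])
  also have "(\<lambda>x. indicator (cball x0 s) x *\<^sub>R f x) = f"
    using assms(2) by (auto simp: indicator_def fun_eq_iff)
  finally show ?thesis .
qed

text \<open>The kernel is hidden behind the one property used later: \<phi> averages the translates
  \<psi>(x - z) over |z| \<le> \<epsilon> with nonnegative weights of total mass one. Any bound on
  \<psi>(x - z) - c, or on differences of translates, therefore passes to \<phi>. The first form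
  gives uniform convergence and support control, the second gives bounds and limits for
  gradients.\<close>

lemma mollify:
  fixes \<psi> :: "'a::euclidean_space \<Rightarrow> real"
  assumes cont: "continuous_on UNIV \<psi>" and supp: "\<And>x. x \<notin> cball x0 s \<Longrightarrow> \<psi> x = 0"
    and e: "\<epsilon> > 0"
  obtains \<phi> where "smooth_on UNIV \<phi>"
    "\<And>x c B. (\<And>z. z \<in> cball 0 \<epsilon> \<Longrightarrow> \<bar>\<psi> (x - z) - c\<bar> \<le> B) \<Longrightarrow> \<bar>\<phi> x - c\<bar> \<le> B"
    "\<And>x y c B. (\<And>z. z \<in> cball 0 \<epsilon> \<Longrightarrow> \<bar>\<psi> (x - z) - \<psi> (y - z) - c\<bar> \<le> B) \<Longrightarrow>
       \<bar>\<phi> x - \<phi> y - c\<bar> \<le> B"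
proof -
  \<comment> \<open>The standard bump exp(-1/(\<epsilon>^2 - |x|^2)), zero for |x| \<ge> \<epsilon>;
    it is normalised to \<rho> below.\<close>
  define k where "k x = flat_exp 0 (\<epsilon>\<^sup>2 - x \<bullet> x)" for x :: 'a
  have kC: "Ck_on j UNIV k" for j
    unfolding k_def by (intro Ck_on_flat_exp_comp Ck_on_const_minus_inner)
  have kcont: "continuous_on UNIV k" using kC[of 0] by simp
  have lt: "x \<bullet> x < \<epsilon>\<^sup>2 \<longleftrightarrow> norm x < \<epsilon>" for x :: 'a
    unfolding power2_norm_eq_inner[symmetric] using e by (auto intro: power_less_imp_less_base power_strict_mono)
  have k0: "k x \<ge> 0" for x by (simp add: k_def flat_exp_def)
  have kpos: "k x > 0 \<longleftrightarrow> norm x < \<epsilon>" for x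
    using lt[of x] by (auto simp: k_def flat_exp_def)
  have kz: "k x = 0" if "x \<notin> cball 0 \<epsilon>" for x
    using kpos[of x] k0[of x] that by (auto simp: dist_norm)
  have kint: "integrable lborel k"
    by (rule integrable_continuous_compact_support[OF kcont kz])
  define c where "c = (LINT x|lborel. k x)"
  have cpos: "c > 0"
  proof -
    have "c \<noteq> 0"
    proof
      assume "c = 0"
      then have "AE x in lborel. k x = 0"
        using integral_nonneg_eq_0_iff_AE[OF kint] k0 c_def by auto
      then have "AE x::'a in lborel. x \<notin> ball 0 \<epsilon>"
        by (rule eventually_mono) (use kpos in \<open>force simp: dist_norm\<close>)
      then have "ball (0::'a) \<epsilon> \<in> null_sets lborel"
        by (simp add: AE_iff_null_sets)
      then have "negligible (ball (0::'a) \<epsilon>)"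
        by (simp add: negligible_iff_null_sets null_sets_completionI)
      then show False using open_not_negligible[of "ball (0::'a) \<epsilon>"] e by auto
    qed
    moreover have "c \<ge> 0" unfolding c_def using k0 by simp
    ultimately show ?thesis by simp
  qed
  define \<rho> where "\<rho> x = k x * inverse c" for x
  have \<rho>C: "Ck_on j UNIV \<rho>" for j
    unfolding \<rho>_def by (intro Ck_on_mult kC Ck_on_const)
  have \<rho>cont: "continuous_on UNIV \<rho>" using \<rho>C[of 0] by simp
  have \<rho>0: "\<rho> x \<ge> 0" for x using k0 cpos by (simp add: \<rho>_def)
  have \<rho>z: "\<rho> x = 0" if "x \<notin> cball 0 \<epsilon>" for x using kz[OF that] by (simp add: \<rho>_def)
  have \<rho>int: "integrable lborel \<rho>" unfolding \<rho>_def using kint by simp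
  have \<rho>1: "(LINT x|lborel. \<rho> x) = 1" unfolding \<rho>_def using cpos by (simp add: c_def[symmetric])
  obtain a b where ab: "cball x0 s \<subseteq> cbox a b"
    using bounded_subset_cbox_symmetric bounded_cball by (metis bounded_cball bounded_subset_cbox_symmetric)
  define \<phi> where "\<phi> x = integral (cbox a b) (\<lambda>y. \<psi> y * \<rho> (x - y))" for x
  have "smooth_on UNIV \<phi>"
    unfolding \<phi>_def smooth_on_def using Ck_on_convolution[OF \<rho>C cont] by blast
  have i1: "integrable lborel (\<lambda>z. \<psi> (x - z) * \<rho> z)" for x
    by (rule integrable_continuous_compact_support[where ?x0.0=0 and s=\<epsilon>])
       (auto intro!: continuous_intros continuous_on_compose2[OF cont] \<rho>cont simp: \<rho>z)
  have \<phi>: "\<phi> x = (LINT z|lborel. \<psi> (x - z) * \<rho> z)" for x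
  proof -
    have c1: "continuous_on UNIV (\<lambda>y. \<psi> y * \<rho> (x - y))"
      by (auto intro!: continuous_intros continuous_on_compose2[OF \<rho>cont] cont)
    have "set_integrable lborel (cbox a b) (\<lambda>y. \<psi> y * \<rho> (x - y))"
      unfolding set_integrable_def
      by (rule borel_integrable_compact) (auto intro: continuous_on_subset[OF c1])
    from set_borel_integral_eq_integral(2)[OF this]
    have "\<phi> x = (LINT y:cbox a b|lborel. \<psi> y * \<rho> (x - y))" by (simp add: \<phi>_def)
    also have "\<dots> = (LINT y|lborel. \<psi> y * \<rho> (x - y))"
      unfolding set_lebesgue_integral_def
      using supp ab by (intro Bochner_Integration.integral_cong) (force simp: indicator_def)+
    also have "\<dots> = (LINT z|lborel. \<psi> (x - z) * \<rho> z)"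
      using lborel_integral_affine[of "\<lambda>y. \<psi> y * \<rho> (x - y)" "-1" x] borel_measurable_continuous_onI[OF c1]
      by simp
    finally show ?thesis .
  qed
  have avg: "\<bar>(LINT z|lborel. g z * \<rho> z)\<bar> \<le> B"
    if g: "\<And>z. z \<in> cball 0 \<epsilon> \<Longrightarrow> \<bar>g z\<bar> \<le> B" and gi: "integrable lborel (\<lambda>z. g z * \<rho> z)" for g :: "'a \<Rightarrow> real" and B
  proof -
    have "\<bar>(LINT z|lborel. g z * \<rho> z)\<bar> \<le> (LINT z|lborel. \<bar>g z * \<rho> z\<bar>)" by (rule integral_abs_bound)
    also have "\<dots> \<le> (LINT z|lborel. B * \<rho> z)"
    proof (rule integral_mono)
      show "\<bar>g z * \<rho> z\<bar> \<le> B * \<rho> z" for z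
        using g[of z] \<rho>0[of z] \<rho>z[of z] by (cases "z \<in> cball 0 \<epsilon>") (auto simp: abs_mult intro: mult_right_mono)
    qed (use gi \<rho>int in auto)
    also have "\<dots> = B" by (simp add: \<rho>1)
    finally show ?thesis .
  qed
  show ?thesis
  proof (rule that)
    show "smooth_on UNIV \<phi>" by fact
    fix x c B assume "\<And>z. z \<in> cball 0 \<epsilon> \<Longrightarrow> \<bar>\<psi> (x - z) - c\<bar> \<le> B"
    moreover have "\<phi> x - c = (LINT z|lborel. (\<psi> (x - z) - c) * \<rho> z)"
      using i1 \<rho>int by (simp add: left_diff_distrib \<phi> \<rho>1)
    moreover have "integrable lborel (\<lambda>z. (\<psi> (x - z) - c) * \<rho> z)"
      using i1 \<rho>int by (simp add: left_diff_distrib)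
    ultimately show "\<bar>\<phi> x - c\<bar> \<le> B" using avg[of "\<lambda>z. \<psi> (x - z) - c" B] by simp
  next
    fix x y c B assume "\<And>z. z \<in> cball 0 \<epsilon> \<Longrightarrow> \<bar>\<psi> (x - z) - \<psi> (y - z) - c\<bar> \<le> B"
    moreover have "\<phi> x - \<phi> y - c = (LINT z|lborel. (\<psi> (x - z) - \<psi> (y - z) - c) * \<rho> z)"
      using i1 \<rho>int by (simp add: left_diff_distrib \<phi> \<rho>1)
    moreover have "integrable lborel (\<lambda>z. (\<psi> (x - z) - \<psi> (y - z) - c) * \<rho> z)"
      using i1 \<rho>int by (simp add: left_diff_distrib)
    ultimately show "\<bar>\<phi> x - \<phi> y - c\<bar> \<le> B"
      using avg[of "\<lambda>z. \<psi> (x - z) - \<psi> (y - z) - c" B] by simp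
  qed
qed

lemma test_function_ballI:
  assumes "smooth_on UNIV \<phi>" "\<And>x. x \<notin> cball x0 s \<Longrightarrow> \<phi> x = 0" "s < R"
  shows "test_function (ball x0 R) \<phi>"
proof -
  have "closure {x. \<phi> x \<noteq> 0} \<subseteq> cball x0 s"
    by (rule closure_minimal) (use assms(2) in \<open>force+\<close>)
  moreover from this have "compact (closure {x. \<phi> x \<noteq> 0})"
    by (meson bounded_cball bounded_subset closed_closure compact_eq_bounded_closed)
  moreover have "cball x0 s \<subseteq> ball x0 R" using assms(3) by auto
  ultimately show ?thesis using assms(1) unfolding test_function_def by blast
qed

section \<open>Gradients of \<open>C\<^sup>1\<close> functions\<close>

lemma gderiv_grad:
  fixes f :: "'a::euclidean_space \<Rightarrow> real"
  assumes "f differentiable (at x)"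
  shows "GDERIV f x :> grad f x" "frechet_derivative f (at x) v = v \<bullet> grad f x"
proof -
  let ?f' = "frechet_derivative f (at x)"
  define D where "D = (\<Sum>i\<in>Basis. ?f' i *\<^sub>R i)"
  have f': "(f has_derivative ?f') (at x)"
    using assms by (simp add: frechet_derivative_works)
  then have lin: "linear ?f'" by (rule has_derivative_linear)
  have eq: "?f' v = v \<bullet> D" for v
  proof -
    have "?f' v = ?f' (\<Sum>i\<in>Basis. (v \<bullet> i) *\<^sub>R i)" by (simp add: euclidean_representation)
    also have "\<dots> = (\<Sum>i\<in>Basis. (v \<bullet> i) * ?f' i)"
      by (simp add: linear_sum[OF lin] linear_cmul[OF lin])
    also have "\<dots> = v \<bullet> D" by (simp add: D_def inner_sum_right mult.commute)
    finally show ?thesis .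
  qed
  then have "?f' = (\<lambda>h. h \<bullet> D)" by auto
  with f' have "GDERIV f x :> D" by (simp add: gderiv_def)
  then show "GDERIV f x :> grad f x" "?f' v = v \<bullet> grad f x"
    using eq by (simp_all add: grad_eqI)
qed

lemma gderiv_differentiable: "GDERIV f x :> D \<Longrightarrow> f differentiable (at x)"
  unfolding gderiv_def differentiable_def by blast

lemma gderiv_continuous:
  assumes "\<And>x. x \<in> S \<Longrightarrow> GDERIV f x :> D x"
  shows "continuous_on S f"
proof (intro continuous_at_imp_continuous_on ballI)
  fix x assume "x \<in> S"
  from gderiv_differentiable[OF assms[OF this]] show "isCont f x"
    by (rule differentiable_imp_continuous_within)
qed

lemma gderiv_local_eq:
  assumes "GDERIV f x :> D" "open U" "x \<in> U" "\<And>y. y \<in> U \<Longrightarrow> f y = g y"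
  shows "GDERIV g x :> D"
  using assms unfolding gderiv_def by (rule has_derivative_transform_within_open)

lemma Ck_on_1_grad:
  fixes f :: "'a::euclidean_space \<Rightarrow> real"
  assumes "Ck_on (Suc 0) S f"
  shows "\<And>x. x \<in> S \<Longrightarrow> GDERIV f x :> grad f x" "continuous_on S (grad f)"
proof -
  show d: "GDERIV f x :> grad f x" if "x \<in> S" for x
    using gderiv_grad(1)[of f x] assms that by auto
  have "continuous_on S (\<lambda>x. \<Sum>i\<in>Basis. frechet_derivative f (at x) i *\<^sub>R i)"
    using assms by (intro continuous_intros) auto
  also have "?this \<longleftrightarrow> continuous_on S (grad f)"
  proof (rule continuous_on_cong)
    fix x assume "x \<in> S"
    then have "f differentiable (at x)" using assms by auto
    then show "(\<Sum>i\<in>Basis. frechet_derivative f (at x) i *\<^sub>R i) = grad f x"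
      using gderiv_grad(2)[of f x] by (simp add: inner_commute[of _ "grad f x"] euclidean_representation)
  qed simp
  finally show "continuous_on S (grad f)" .
qed

text \<open>The mean value inequality applied to f(x) - c \<bullet> x. With \<open>c = 0\<close> it
  is a Lipschitz bound; with c the gradient at a point it measures how far f is from affine,
  uniformly in pairs of points.\<close>

lemma gderiv_bound:
  fixes f :: "'a::euclidean_space \<Rightarrow> real"
  assumes "convex S" "\<And>x. x \<in> S \<Longrightarrow> GDERIV f x :> D x" "\<And>x. x \<in> S \<Longrightarrow> norm (D x - c) \<le> K"
    "x \<in> S" "y \<in> S"
  shows "\<bar>f x - f y - c \<bullet> (x - y)\<bar> \<le> K * norm (x - y)"
proof -
  have "norm ((f x - c \<bullet> x) - (f y - c \<bullet> y)) \<le> K * norm (x - y)"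
  proof (rule differentiable_bound[OF assms(1)])
    fix z assume z: "z \<in> S"
    show "((\<lambda>x. f x - c \<bullet> x) has_derivative (\<lambda>h. h \<bullet> (D z - c))) (at z within S)"
      using assms(2)[OF z, unfolded gderiv_def, THEN has_derivative_at_withinI]
        bounded_linear_imp_has_derivative[OF bounded_linear_inner_right[of c]]
      by (rule has_derivative_eq_rhs[OF has_derivative_diff])
         (simp add: inner_diff_right inner_commute fun_eq_iff)
    show "onorm (\<lambda>h. h \<bullet> (D z - c)) \<le> K"
    proof (rule onorm_bound)
      show "K \<ge> 0" using assms(3)[OF z] norm_ge_zero order_trans by blast
      show "norm (h \<bullet> (D z - c)) \<le> K * norm h" for h
      proof -
        have "\<bar>h \<bullet> (D z - c)\<bar> \<le> norm h * norm (D z - c)" by (rule Cauchy_Schwarz_ineq2)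
        also have "\<dots> \<le> norm h * K" by (intro mult_left_mono assms(3) z norm_ge_zero)
        finally show ?thesis by (simp add: mult.commute)
      qed
    qed
  qed (use assms in auto)
  then show ?thesis by (simp add: inner_diff_right algebra_simps)
qed

text \<open>Difference quotients of a compactly supported function have integral zero by translation
  invariance, and the Lipschitz bound lets them converge dominatedly to the directional derivative.
  Measurability of G comes from the same limit, so G is not assumed continuous.\<close>

lemma integral_gradient_zero:
  fixes w :: "'a::euclidean_space \<Rightarrow> real"
  assumes der: "\<And>x. GDERIV w x :> G x" and K: "\<And>x. norm (G x) \<le> K"
    and supp: "\<And>x. x \<notin> cball x0 s \<Longrightarrow> w x = 0"
  shows "(LINT x|lborel. G x \<bullet> i) = 0"
proof -
  have cont: "continuous_on UNIV w" using der by (rule gderiv_continuous)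
  have lip: "\<bar>w x - w y\<bar> \<le> K * norm (x - y)" for x y
    using gderiv_bound[of UNIV w G 0 K x y] der K by simp
  have K0: "K \<ge> 0" using K[of 0] norm_ge_zero order_trans by blast
  define t where "t k = 1 / real (Suc k)" for k
  have t: "t k > 0" "t k \<le> 1" for k by (auto simp: t_def)
  have t0: "t \<longlonglongrightarrow> 0" unfolding t_def by (rule LIMSEQ_Suc[OF lim_1_over_n])
  define f where "f k x = (w (x + t k *\<^sub>R i) - w x) / t k" for k x
  have fcont: "continuous_on UNIV (f k)" for k
    unfolding f_def using t(1)[of k] by (auto intro!: continuous_intros continuous_on_compose2[OF cont])
  have [measurable]: "f k \<in> borel_measurable borel" for k
    using fcont by (rule borel_measurable_continuous_onI)
  have lim: "(\<lambda>k. f k x) \<longlonglongrightarrow> G x \<bullet> i" for x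
  proof -
    have "((\<lambda>s. w (x + s *\<^sub>R i)) has_derivative (\<lambda>s. (s *\<^sub>R i) \<bullet> G x)) (at 0)"
      using der[of x] unfolding gderiv_def
      by (intro has_derivative_compose[of "\<lambda>s. x + s *\<^sub>R i" _ 0 UNIV w]) (auto intro!: derivative_eq_intros)
    then have "((\<lambda>s. w (x + s *\<^sub>R i)) has_real_derivative (G x \<bullet> i)) (at 0)"
      by (simp add: has_field_derivative_def inner_commute mult.commute[of _ "G x \<bullet> i"] fun_eq_iff)
         (simp add: mult_commute_abs)
    then have "((\<lambda>h. (w (x + h *\<^sub>R i) - w x) / h) \<longlongrightarrow> G x \<bullet> i) (at 0)"
      by (simp add: DERIV_def)
    moreover have "filterlim t (at 0) sequentially"
      using t0 t(1) by (auto simp: filterlim_at less_imp_neq[symmetric] intro!: always_eventually)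
    ultimately show ?thesis unfolding f_def by (rule filterlim_compose)
  qed
  have Gm: "(\<lambda>x. G x \<bullet> i) \<in> borel_measurable lborel"
    by (rule borel_measurable_LIMSEQ_real[of _ f]) (use lim in auto)
  have wi: "integrable lborel w" using integrable_continuous_compact_support[OF cont supp] .
  have f0: "(LINT x|lborel. f k x) = 0" for k
  proof -
    have m: "w \<in> borel_measurable borel" using cont by (rule borel_measurable_continuous_onI)
    have i2: "integrable lborel (\<lambda>x. w (t k *\<^sub>R i + x))"
    proof (rule integrable_continuous_compact_support[where ?x0.0="x0 - t k *\<^sub>R i" and s=s])
      fix x assume "x \<notin> cball (x0 - t k *\<^sub>R i) s"
      then show "w (t k *\<^sub>R i + x) = 0"
        by (intro supp) (simp add: dist_norm algebra_simps)
    qed (auto intro!: continuous_intros continuous_on_compose2[OF cont])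
    have "(LINT x|lborel. w x) = (LINT x|lborel. w (t k *\<^sub>R i + x))"
      using lborel_integral_affine[OF m, of 1 "t k *\<^sub>R i"] by simp
    then show ?thesis
      unfolding f_def using wi i2 by (simp add: add.commute)
  qed
  have "(\<lambda>k. LINT x|lborel. f k x) \<longlonglongrightarrow> (LINT x|lborel. G x \<bullet> i)"
  proof (rule integral_dominated_convergence[where w="\<lambda>x. indicator (cball x0 (s + norm i)) x * (K * norm i)"])
    show "integrable lborel (\<lambda>x. indicator (cball x0 (s + norm i)) x * (K * norm i))"
      by (auto intro!: integrable_mult_left emeasure_compact_finite)
    show "AE x in lborel. norm (f k x) \<le> indicator (cball x0 (s + norm i)) x * (K * norm i)" for k
    proof (rule AE_I2)
      fix x
      show "norm (f k x) \<le> indicator (cball x0 (s + norm i)) x * (K * norm i)"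
      proof (cases "x \<in> cball x0 (s + norm i)")
        case True
        then show ?thesis using lip[of "x + t k *\<^sub>R i" x] t(1)[of k] by (simp add: f_def field_simps)
      next
        case False
        \<comment> \<open>Since \<open>t k \<le> 1\<close>, all translates have their supports in
          the one ball enlarged by \<open>norm i\<close>.\<close>
        have n: "norm (t k *\<^sub>R i) \<le> norm i" using t[of k] by (simp add: mult_left_le_one_le)
        have "dist x0 (x + t k *\<^sub>R i) > s"
          using False n norm_triangle_ineq2[of "x - x0" "- t k *\<^sub>R i"]
          by (auto simp: dist_norm norm_minus_commute algebra_simps)
        moreover have "dist x0 x > s" using False norm_ge_zero[of i] unfolding mem_cball by linarith
        ultimately show ?thesis using supp K0 by (simp add: f_def)
      qed
    qed
  qed (use Gm lim in auto)
  then show ?thesis unfolding f0 LIMSEQ_const_iff by simp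
qed

section \<open>The fundamental lemma of the calculus of variations\<close>

lemma borel_measurable_lebesgue_continuous:
  fixes f :: "'a::euclidean_space \<Rightarrow> real"
  shows "continuous_on UNIV f \<Longrightarrow> f \<in> borel_measurable lebesgue"
  by (intro measurable_completion) (simp add: borel_measurable_continuous_onI)

lemma bounded_continuous_compact_support:
  fixes f :: "'a::euclidean_space \<Rightarrow> 'b::real_normed_vector"
  assumes "continuous_on UNIV f" "\<And>x. x \<notin> cball x0 s \<Longrightarrow> f x = 0"
  obtains M where "M \<ge> 0" "\<And>x. norm (f x) \<le> M"
proof -
  have "compact (f ` cball x0 s)"
    by (intro compact_continuous_image continuous_on_subset[OF assms(1)]) auto
  then obtain M where M: "M > 0" "\<And>y. y \<in> f ` cball x0 s \<Longrightarrow> norm y \<le> M"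
    using compact_imp_bounded[of "f ` cball x0 s"] unfolding bounded_pos by blast
  have "norm (f x) \<le> M" for x
    using M assms(2)[of x] by (cases "x \<in> cball x0 s") auto
  with M(1) show ?thesis by (intro that[of M]) simp_all
qed

lemma test_function_ballD:
  fixes x0 :: "'a::euclidean_space"
  assumes "test_function (ball x0 R) \<phi>"
  obtains s where "s < R" "\<And>x. x \<notin> cball x0 s \<Longrightarrow> \<phi> x = 0"
proof -
  let ?K = "closure {x. \<phi> x \<noteq> 0}"
  have K: "compact ?K" "?K \<subseteq> ball x0 R" using assms by (auto simp: test_function_def)
  have nz: "\<phi> x \<noteq> 0 \<Longrightarrow> x \<in> ?K" for x
    by (rule subsetD[OF closure_subset]) simp
  show ?thesis
  proof (cases "?K = {}")
    case True
    then have "\<phi> x = 0" for x using nz[of x] by blast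
    then show ?thesis by (intro that[of "R - 1"]) simp_all
  next
    case False
    obtain y where y: "y \<in> ?K" "\<And>x. x \<in> ?K \<Longrightarrow> dist x0 x \<le> dist x0 y"
      using continuous_attains_sup[OF K(1) False, of "dist x0"]
        continuous_on_dist[OF continuous_on_const continuous_on_id, of ?K x0] by blast
    show ?thesis
    proof (rule that[of "dist x0 y"])
      show "dist x0 y < R" using y(1) K(2) by auto
      show "\<phi> x = 0" if "x \<notin> cball x0 (dist x0 y)" for x
        using that y(2)[of x] nz[of x] by auto
    qed
  qed
qed

lemma mollify_sequence:
  fixes \<psi> :: "'a::euclidean_space \<Rightarrow> real"
  assumes cont: "continuous_on UNIV \<psi>" and supp: "\<And>x. x \<notin> cball x0 s \<Longrightarrow> \<psi> x = 0"
    and s: "s < s'" "s' < R"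
  obtains \<phi> \<epsilon> where "\<And>k::nat. test_function (ball x0 R) (\<phi> k)"
    "\<And>k. \<epsilon> k > 0" "\<epsilon> \<longlonglongrightarrow> 0"
    "\<And>k x. x \<notin> cball x0 s' \<Longrightarrow> \<phi> k x = 0"
    "\<And>k x c B. (\<And>z. z \<in> cball 0 (\<epsilon> k) \<Longrightarrow> \<bar>\<psi> (x - z) - c\<bar> \<le> B) \<Longrightarrow> \<bar>\<phi> k x - c\<bar> \<le> B"
    "\<And>k x y c B. (\<And>z. z \<in> cball 0 (\<epsilon> k) \<Longrightarrow> \<bar>\<psi> (x - z) - \<psi> (y - z) - c\<bar> \<le> B) \<Longrightarrow>
       \<bar>\<phi> k x - \<phi> k y - c\<bar> \<le> B"
proof -
  \<comment> \<open>Radii at most s' - s keep all supports inside \<open>cball x0 s'\<close>,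
    independently of k.\<close>
  define \<epsilon> where "\<epsilon> k = (s' - s) * (1 / real (Suc k))" for k
  have e0: "\<epsilon> k > 0" for k using s by (simp add: \<epsilon>_def)
  have "(\<lambda>k. (s' - s) * (1 / real (Suc k))) \<longlonglongrightarrow> (s' - s) * 0"
    by (intro tendsto_intros LIMSEQ_Suc[OF lim_1_over_n])
  then have elim: "\<epsilon> \<longlonglongrightarrow> 0" by (simp add: \<epsilon>_def[abs_def])
  have ele: "\<epsilon> k \<le> s' - s" for k using s by (simp add: \<epsilon>_def divide_simps)
  have "\<exists>\<phi>. smooth_on UNIV \<phi> \<and>
    (\<forall>x c B. (\<forall>z. z \<in> cball 0 (\<epsilon> k) \<longrightarrow> \<bar>\<psi> (x - z) - c\<bar> \<le> B) \<longrightarrow> \<bar>\<phi> x - c\<bar> \<le> B) \<and>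
    (\<forall>x y c B. (\<forall>z. z \<in> cball 0 (\<epsilon> k) \<longrightarrow> \<bar>\<psi> (x - z) - \<psi> (y - z) - c\<bar> \<le> B) \<longrightarrow>
       \<bar>\<phi> x - \<phi> y - c\<bar> \<le> B)" for k
    by (rule mollify[OF cont supp e0[of k]]) (assumption, blast)
  then obtain \<phi> where \<phi>: "\<And>k. smooth_on UNIV (\<phi> k)"
    "\<And>k x c B. (\<And>z. z \<in> cball 0 (\<epsilon> k) \<Longrightarrow> \<bar>\<psi> (x - z) - c\<bar> \<le> B) \<Longrightarrow> \<bar>\<phi> k x - c\<bar> \<le> B"
    "\<And>k x y c B. (\<And>z. z \<in> cball 0 (\<epsilon> k) \<Longrightarrow> \<bar>\<psi> (x - z) - \<psi> (y - z) - c\<bar> \<le> B) \<Longrightarrow>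
       \<bar>\<phi> k x - \<phi> k y - c\<bar> \<le> B"
    by metis
  have z: "\<phi> k x = 0" if x: "x \<notin> cball x0 s'" for k x
  proof -
    \<comment> \<open>Vanishing is the averaging property with \<open>c = 0\<close> and
      \<open>B = 0\<close>.\<close>
    have "\<bar>\<phi> k x - 0\<bar> \<le> 0"
    proof (rule \<phi>(2))
      fix z :: 'a assume "z \<in> cball 0 (\<epsilon> k)"
      then have "norm z \<le> s' - s" using ele[of k] by (simp add: dist_norm)
      then have "x - z \<notin> cball x0 s"
        using x norm_triangle_ineq[of "x - z - x0" z] by (auto simp: dist_norm norm_minus_commute algebra_simps)
      then show "\<bar>\<psi> (x - z) - 0\<bar> \<le> 0" using supp by simp
    qed
    then show ?thesis by simp
  qed
  have "test_function (ball x0 R) (\<phi> k)" for k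
    by (rule test_function_ballI[OF \<phi>(1) z s(2)])
  show ?thesis
    by (rule that[of \<phi> \<epsilon>]) (fact \<open>\<And>k. test_function (ball x0 R) (\<phi> k)\<close> e0 elim z \<phi>)+
qed

text \<open>Mollifications of \<psi> converge pointwise, share the bound of \<psi>, and live in a
  common ball on which h is integrable; the midpoint radius s' provides that ball.\<close>

lemma integral_continuous_test_zero:
  fixes h \<psi> :: "'a::euclidean_space \<Rightarrow> real"
  assumes h: "\<And>s. s < R \<Longrightarrow> set_integrable lebesgue (cball x0 s) h"
    and T: "\<And>\<phi>. test_function (ball x0 R) \<phi> \<Longrightarrow> (LINT x:ball x0 R|lebesgue. h x * \<phi> x) = 0"
    and cont: "continuous_on UNIV \<psi>" and supp: "\<And>x. x \<notin> cball x0 s \<Longrightarrow> \<psi> x = 0" and s: "s < R"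
  shows "(LINT x:ball x0 R|lebesgue. h x * \<psi> x) = 0"
proof -
  define s' where "s' = (s + R) / 2"
  have s': "s < s'" "s' < R" using s by (auto simp: s'_def)
  obtain \<phi> \<epsilon> where \<phi>: "\<And>k::nat. test_function (ball x0 R) (\<phi> k)"
    "\<And>k. \<epsilon> k > 0" "\<epsilon> \<longlonglongrightarrow> 0"
    "\<And>k x. x \<notin> cball x0 s' \<Longrightarrow> \<phi> k x = 0"
    "\<And>k x c B. (\<And>z. z \<in> cball 0 (\<epsilon> k) \<Longrightarrow> \<bar>\<psi> (x - z) - c\<bar> \<le> B) \<Longrightarrow> \<bar>\<phi> k x - c\<bar> \<le> B"
    using mollify_sequence[OF cont supp s'] by metis
  obtain M where M: "M \<ge> 0" "\<And>x. norm (\<psi> x) \<le> M"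
    using bounded_continuous_compact_support[OF cont supp] by metis
  have \<phi>M: "\<bar>\<phi> k x\<bar> \<le> M" for k x
    using \<phi>(5)[of k x 0 M] M(2) by simp
  have lim: "(\<lambda>k. \<phi> k x) \<longlonglongrightarrow> \<psi> x" for x
  proof (rule LIMSEQ_I)
    fix e :: real assume "e > 0"
    from cont have "isCont \<psi> x" by (simp add: continuous_on_eq_continuous_at)
    then obtain d where d: "d > 0" "\<And>y. dist y x < d \<Longrightarrow> dist (\<psi> y) (\<psi> x) < e/2"
      using \<open>e > 0\<close> unfolding continuous_at_eps_delta by (metis half_gt_zero)
    have "eventually (\<lambda>k. \<epsilon> k < d) sequentially" using \<phi>(3) d(1) by (rule order_tendstoD)
    then obtain N where N: "\<And>k. k \<ge> N \<Longrightarrow> \<epsilon> k < d" by (auto simp: eventually_sequentially)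
    have "norm (\<phi> k x - \<psi> x) < e" if "k \<ge> N" for k
    proof -
      have "\<bar>\<phi> k x - \<psi> x\<bar> \<le> e/2"
        using d(2)[of "x - z" for z] N[OF that]
        by (intro \<phi>(5)) (force simp: dist_norm intro: less_imp_le)
      then show ?thesis using \<open>e > 0\<close> by simp
    qed
    then show "\<exists>N. \<forall>k\<ge>N. norm (\<phi> k x - \<psi> x) < e" by blast
  qed
  have hi: "integrable lebesgue (\<lambda>x. indicator (cball x0 s') x * h x)"
    using h[OF s'(2)] by (simp add: set_integrable_def)
  have eq: "indicator (ball x0 R) x *\<^sub>R (h x * f x) = (indicator (cball x0 s') x * h x) * f x"
    if "\<And>x. x \<notin> cball x0 s' \<Longrightarrow> f x = 0" for f and x
    using that[of x] s' by (auto simp: indicator_def)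
  have m: "\<phi> k \<in> borel_measurable lebesgue" for k
  proof -
    have "Ck_on 0 UNIV (\<phi> k)" using \<phi>(1)[of k] unfolding test_function_def smooth_on_def by blast
    then show ?thesis by (intro borel_measurable_lebesgue_continuous) simp
  qed
  have "(\<lambda>k. LINT x:ball x0 R|lebesgue. h x * \<phi> k x) \<longlonglongrightarrow> (LINT x:ball x0 R|lebesgue. h x * \<psi> x)"
    unfolding set_lebesgue_integral_def
  proof (rule integral_dominated_convergence[where w="\<lambda>x. \<bar>indicator (cball x0 s') x * h x\<bar> * M"])
    have "\<psi> x = 0" if "x \<notin> cball x0 s'" for x using that s' by (intro supp) auto
    then show "(\<lambda>x. indicator (ball x0 R) x *\<^sub>R (h x * \<psi> x)) \<in> borel_measurable lebesgue"
      by (subst eq) (auto intro!: borel_measurable_times[OF borel_measurable_integrable[OF hi]]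
        borel_measurable_lebesgue_continuous[OF cont])
    show "(\<lambda>x. indicator (ball x0 R) x *\<^sub>R (h x * \<phi> k x)) \<in> borel_measurable lebesgue" for k
      by (subst eq[OF \<phi>(4)]) (auto intro!: borel_measurable_times[OF borel_measurable_integrable[OF hi] m])
    show "AE x in lebesgue. norm (indicator (ball x0 R) x *\<^sub>R (h x * \<phi> k x))
        \<le> \<bar>indicator (cball x0 s') x * h x\<bar> * M" for k
      using \<phi>(4)[of _ k] \<phi>M[of k] M(1) by (subst eq) (auto simp: abs_mult intro!: AE_I2 mult_left_mono)
  qed (use hi lim in \<open>auto intro!: tendsto_intros\<close>)
  then show ?thesis by (simp add: T[OF \<phi>(1)] LIMSEQ_const_iff)
qed

text \<open>The indicator of a closed set is the pointwise limit of continuous tents built from the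
  distance to the set.\<close>

lemma integral_closed_zero:
  fixes h :: "'a::euclidean_space \<Rightarrow> real"
  assumes h: "\<And>s. s < R \<Longrightarrow> set_integrable lebesgue (cball x0 s) h"
    and T: "\<And>\<phi>. test_function (ball x0 R) \<phi> \<Longrightarrow> (LINT x:ball x0 R|lebesgue. h x * \<phi> x) = 0"
    and C: "closed C" "C \<subseteq> cball x0 s" and s: "s < R"
  shows "(LINT x:C|lebesgue. h x) = 0"
proof (cases "C = {}")
  \<comment> \<open>The distance to the empty set is 0 by convention, so the tents below would be
    identically 1; that case is settled separately at the end.\<close>
  case False
  define \<delta> where "\<delta> = (R - s) / 2"
  have \<delta>: "\<delta> > 0" "s + \<delta> < R" using s by (auto simp: \<delta>_def field_simps)
  \<comment> \<open>With \<open>Suc k\<close> instead of k already the first tent vanishes at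
    distance \<delta> from C, so all of them are supported in
    \<open>cball x0 (s + \<delta>)\<close>.\<close>
  define \<psi> where "\<psi> k x = max 0 (1 - real (Suc k) / \<delta> * infdist x C)" for k x
  have c: "continuous_on UNIV (\<psi> k)" for k
    unfolding \<psi>_def by (intro continuous_intros)
  have z: "\<psi> k x = 0" if "x \<notin> cball x0 (s + \<delta>)" for k x
  proof -
    have "\<delta> \<le> infdist x C"
      unfolding infdist_notempty[OF False]
    proof (rule cINF_greatest[OF False])
      fix y assume "y \<in> C"
      then have "dist x0 y \<le> s" using C by auto
      with that show "\<delta> \<le> dist x y" using dist_triangle[of x0 x y] by (simp add: dist_commute)
    qed
    also have "\<dots> \<le> real (Suc k) * infdist x C"
      using infdist_nonneg[of x C] by (simp add: algebra_simps)
    finally show ?thesis using \<delta> by (simp add: \<psi>_def field_simps)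
  qed
  have lim: "(\<lambda>k. \<psi> k x) \<longlonglongrightarrow> indicator C x" for x
  proof (cases "x \<in> C")
    case True
    then show ?thesis by (simp add: \<psi>_def)
  next
    case False
    then have "infdist x C > 0"
      using C \<open>C \<noteq> {}\<close> by (simp add: in_closed_iff_infdist_zero infdist_nonneg less_le)
    then obtain N :: nat where N: "real N > \<delta> / infdist x C" using reals_Archimedean2 by blast
    have "\<psi> k x = 0" if "k \<ge> N" for k
    proof -
      have "real k > \<delta> / infdist x C" using N that by simp
      then have "\<delta> < real (Suc k) * infdist x C"
        using \<open>infdist x C > 0\<close> by (simp add: field_simps)
      then show ?thesis using \<delta> by (simp add: \<psi>_def field_simps)
    qed
    then have "eventually (\<lambda>k. \<psi> k x = indicator C x) sequentially"
      using False by (auto simp: eventually_sequentially)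
    then show ?thesis by (rule tendsto_eventually)
  qed
  have hi: "integrable lebesgue (\<lambda>x. indicator (cball x0 (s + \<delta>)) x * h x)"
    using h[OF \<delta>(2)] by (simp add: set_integrable_def)
  have eq: "indicator (ball x0 R) x *\<^sub>R (h x * \<psi> k x) = (indicator (cball x0 (s + \<delta>)) x * h x) * \<psi> k x" for x k
    using z[of x k] \<delta> by (auto simp: indicator_def)
  have eqC: "indicator C x *\<^sub>R h x = (indicator (cball x0 (s + \<delta>)) x * h x) * indicator C x" for x
    using C \<delta> by (auto simp: indicator_def)
  have m: "(indicator C :: 'a \<Rightarrow> real) \<in> borel_measurable lebesgue"
    using C by (intro measurable_completion) (auto intro: borel_closed)
  have "(\<lambda>k. LINT x:ball x0 R|lebesgue. h x * \<psi> k x) \<longlonglongrightarrow> (LINT x:C|lebesgue. h x)"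
    unfolding set_lebesgue_integral_def eq eqC
  proof (rule integral_dominated_convergence[where w="\<lambda>x. \<bar>indicator (cball x0 (s + \<delta>)) x * h x\<bar>"])
    show "AE x in lebesgue. norm (indicator (cball x0 (s + \<delta>)) x * h x * \<psi> k x)
        \<le> \<bar>indicator (cball x0 (s + \<delta>)) x * h x\<bar>" for k
    proof (rule AE_I2)
      fix x
      have "0 \<le> \<psi> k x" "\<psi> k x \<le> 1" using \<delta> infdist_nonneg[of x C] by (auto simp: \<psi>_def)
      then show "norm (indicator (cball x0 (s + \<delta>)) x * h x * \<psi> k x) \<le> \<bar>indicator (cball x0 (s + \<delta>)) x * h x\<bar>"
        by (simp add: abs_mult mult_left_le)
    qed
    show "(\<lambda>x. indicator (cball x0 (s + \<delta>)) x * h x * \<psi> k x) \<in> borel_measurable lebesgue" for k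
      by (rule borel_measurable_times[OF borel_measurable_integrable[OF hi] borel_measurable_lebesgue_continuous[OF c]])
    show "(\<lambda>x. indicator (cball x0 (s + \<delta>)) x * h x * indicator C x) \<in> borel_measurable lebesgue"
      by (rule borel_measurable_times[OF borel_measurable_integrable[OF hi] m])
  qed (use hi lim in \<open>auto intro!: tendsto_intros\<close>)
  moreover have "(LINT x:ball x0 R|lebesgue. h x * \<psi> k x) = 0" for k
    by (rule integral_continuous_test_zero[OF h T c z \<delta>(2)])
  ultimately show ?thesis by (simp add: LIMSEQ_const_iff)
qed (simp add: set_lebesgue_integral_def)

text \<open>The set where h > 0 is exhausted from inside by closed sets up to arbitrarily small
  measure; a positive function with zero integral over such a set forces it to be null.\<close>

lemma AE_nonpos_of_closed_integrals_zero:
  fixes h :: "'a::euclidean_space \<Rightarrow> real"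
  assumes h: "set_integrable lebesgue (cball x0 s) h"
    and C: "\<And>C. closed C \<Longrightarrow> C \<subseteq> cball x0 s \<Longrightarrow> (LINT x:C|lebesgue. h x) = 0"
  shows "AE x in lebesgue. x \<in> cball x0 s \<longrightarrow> h x \<le> 0"
proof -
  define P where "P = {x \<in> cball x0 s. h x > 0}"
  have hi: "integrable lebesgue (\<lambda>x. indicator (cball x0 s) x * h x)"
    using h by (simp add: set_integrable_def)
  have "P = {x \<in> space lebesgue. indicator (cball x0 s) x * h x > 0}"
    by (auto simp: P_def indicator_def)
  also have "\<dots> \<in> sets lebesgue"
    using borel_measurable_integrable[OF hi] by measurable
  finally have P: "P \<in> sets lebesgue" .
  have "emeasure lebesgue P \<le> ennreal e" if e: "e > 0" for e
  proof -
    obtain C where C': "closed C" "C \<subseteq> P" "P - C \<in> lmeasurable" "emeasure lebesgue (P - C) < ennreal e"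
      using sets_lebesgue_inner_closed[OF P e] by metis
    have Cs: "C \<in> sets lebesgue" using C'(1) by simp
    have ci: "integrable lebesgue (\<lambda>x. indicator C x * (indicator (cball x0 s) x * h x))"
      using integrable_mult_indicator[OF Cs hi] by simp
    have "(LINT x|lebesgue. indicator C x * (indicator (cball x0 s) x * h x)) = (LINT x:C|lebesgue. h x)"
      unfolding set_lebesgue_integral_def using C'(2) by (intro Bochner_Integration.integral_cong) (auto simp: P_def indicator_def)
    also have "\<dots> = 0" using C'(1,2) by (intro C) (auto simp: P_def)
    finally have "AE x in lebesgue. indicator C x * (indicator (cball x0 s) x * h x) = 0"
    proof (subst integral_nonneg_eq_0_iff_AE[OF ci, symmetric])
      show "AE x in lebesgue. 0 \<le> indicator C x * (indicator (cball x0 s) x * h x)"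
        using C'(2) by (intro AE_I2) (auto simp: P_def indicator_def)
    qed
    then have "AE x in lebesgue. x \<notin> C"
      by (rule eventually_mono) (use C'(2) in \<open>auto simp: P_def indicator_def split: if_splits\<close>)
    then have "C \<in> null_sets lebesgue" using Cs by (simp add: AE_iff_null_sets)
    then have "emeasure lebesgue P = emeasure lebesgue (P - C)"
      using emeasure_Diff_null_set P by metis
    with C'(4) show ?thesis by simp
  qed
  then have "emeasure lebesgue P = 0"
    by (metis ennreal_0 ennreal_le_epsilon add_0 le_zero_eq)
  then have "P \<in> null_sets lebesgue" using P by auto
  then have "AE x in lebesgue. x \<notin> P" using P by (simp add: AE_iff_null_sets)
  then show ?thesis by (rule eventually_mono) (auto simp: P_def not_less)
qed

text \<open>The one-sided result is applied to h and to -h; countably many closed balls exhaust the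
  open ball, so the exceptional sets still unite to a null set.\<close>

lemma fundamental_lemma:
  fixes h :: "'a::euclidean_space \<Rightarrow> real"
  assumes h: "\<And>s. s < R \<Longrightarrow> set_integrable lebesgue (cball x0 s) h"
    and T: "\<And>\<phi>. test_function (ball x0 R) \<phi> \<Longrightarrow> (LINT x:ball x0 R|lebesgue. h x * \<phi> x) = 0"
  shows "AE x in lebesgue. x \<in> ball x0 R \<longrightarrow> h x = 0"
proof -
  have *: "AE x in lebesgue. x \<in> cball x0 s \<longrightarrow> h x = 0" if s: "s < R" for s
  proof -
    have Z: "(LINT x:C|lebesgue. h x) = 0" if "closed C" "C \<subseteq> cball x0 s" for C
      by (rule integral_closed_zero[OF h T that s])
    have "AE x in lebesgue. x \<in> cball x0 s \<longrightarrow> h x \<le> 0"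
      by (rule AE_nonpos_of_closed_integrals_zero[OF h[OF s] Z])
    moreover have "AE x in lebesgue. x \<in> cball x0 s \<longrightarrow> - h x \<le> 0"
    proof (rule AE_nonpos_of_closed_integrals_zero)
      show "set_integrable lebesgue (cball x0 s) (\<lambda>x. - h x)"
        using h[OF s] by (simp add: set_integrable_def)
      show "(LINT x:C|lebesgue. - h x) = 0" if "closed C" "C \<subseteq> cball x0 s" for C
        using Z[OF that] by (simp add: set_lebesgue_integral_def)
    qed
    ultimately show ?thesis by eventually_elim auto
  qed
  have "AE x in lebesgue. \<forall>k::nat. x \<in> cball x0 (R - 1 / real (Suc k)) \<longrightarrow> h x = 0"
    by (subst AE_all_countable) (intro allI *, simp)
  then show ?thesis
  proof (rule eventually_mono, intro impI)
    fix x assume x: "\<forall>k::nat. x \<in> cball x0 (R - 1 / real (Suc k)) \<longrightarrow> h x = 0" "x \<in> ball x0 R"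
    then have "0 < R - dist x0 x" by simp
    then obtain k where "1 / real (Suc k) < R - dist x0 x"
      using reals_Archimedean[of "R - dist x0 x"] unfolding inverse_eq_divide by blast
    then show "h x = 0" using x(1)[rule_format, of k] by simp
  qed
qed

section \<open>The weak gradient of a \<open>C\<^sup>1\<close> function\<close>

lemma set_integrable_lebesgue_continuous_compact:
  fixes f :: "'a::euclidean_space \<Rightarrow> real"
  assumes "compact S" "continuous_on S f"
  shows "set_integrable lebesgue S f"
proof -
  have "integrable lborel (\<lambda>x. indicator S x *\<^sub>R f x)"
    using assms by (rule borel_integrable_compact)
  then show ?thesis
    unfolding set_integrable_def
    by (subst integrable_completion) (auto dest: borel_measurable_integrable)
qed

lemma set_integrable_ball_support:
  fixes f :: "'a::euclidean_space \<Rightarrow> real"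
  assumes "continuous_on (cball x0 s) f" "\<And>x. x \<notin> cball x0 s \<Longrightarrow> f x = 0" "s < R"
  shows "set_integrable lebesgue (ball x0 R) f"
proof -
  have "(\<lambda>x. indicator (ball x0 R) x *\<^sub>R f x) = (\<lambda>x. indicator (cball x0 s) x *\<^sub>R f x)"
    using assms(2,3) by (force simp: indicator_def fun_eq_iff)
  then show ?thesis
    using set_integrable_lebesgue_continuous_compact[OF compact_cball assms(1)]
    by (simp add: set_integrable_def)
qed

lemma C1_Holder_locD:
  fixes u :: "'a::euclidean_space \<Rightarrow> real"
  assumes u: "C1_Holder_loc \<Omega> u" and "open \<Omega>"
  shows "\<And>x. x \<in> \<Omega> \<Longrightarrow> GDERIV u x :> grad u x" "continuous_on \<Omega> (grad u)"
proof -
  show "GDERIV u x :> grad u x" if "x \<in> \<Omega>" for x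
    using gderiv_grad(1)[of u x] u that by (auto simp: C1_Holder_loc_def)
  let ?H = "\<lambda>\<alpha> K. \<exists>C. \<forall>x\<in>K. \<forall>y\<in>K. norm (grad u x - grad u y) \<le> C * dist x y powr \<alpha>"
  from u have "\<exists>\<alpha>. 0 < \<alpha> \<and> \<alpha> < 1 \<and> (\<forall>K. compact K \<and> K \<subseteq> \<Omega> \<longrightarrow> ?H \<alpha> K)"
    unfolding C1_Holder_loc_def by (rule conjunct2)
  then obtain \<alpha> where "0 < \<alpha> \<and> \<alpha> < 1 \<and> (\<forall>K. compact K \<and> K \<subseteq> \<Omega> \<longrightarrow> ?H \<alpha> K)" by (rule exE)
  then have \<alpha>: "0 < \<alpha>" and H: "\<And>K. compact K \<Longrightarrow> K \<subseteq> \<Omega> \<Longrightarrow> ?H \<alpha> K" by simp_all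
  show "continuous_on \<Omega> (grad u)"
  proof (intro continuous_at_imp_continuous_on ballI)
    fix x assume "x \<in> \<Omega>"
    then obtain e where e: "e > 0" "cball x e \<subseteq> \<Omega>" using \<open>open \<Omega>\<close> unfolding open_contains_cball by blast
    from H[OF compact_cball e(2)] obtain C where
      C': "\<forall>x'\<in>cball x e. \<forall>y\<in>cball x e. norm (grad u x' - grad u y) \<le> C * dist x' y powr \<alpha>"
      by (rule exE)
    have C: "norm (grad u y - grad u x) \<le> C * dist y x powr \<alpha>" if "y \<in> cball x e" for y
      using C'[rule_format, OF that, of x] e(1) by simp
    have "((\<lambda>y. grad u y - grad u x) \<longlongrightarrow> 0) (at x)"
    proof (rule Lim_null_comparison)
      show "eventually (\<lambda>y. norm (grad u y - grad u x) \<le> C * dist y x powr \<alpha>) (at x)"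
        using e(1) C by (auto simp: eventually_at dist_commute intro!: exI[of _ e])
      have "((\<lambda>y. dist y x) \<longlongrightarrow> 0) (at x)"
        by (auto intro!: tendsto_eq_intros)
      then have "((\<lambda>y. dist y x powr \<alpha>) \<longlongrightarrow> 0) (at x)"
        using \<alpha> by (intro tendsto_zero_powrI[where b=\<alpha>]) (auto intro!: always_eventually)
      from tendsto_mult_right_zero[OF this] show "((\<lambda>y. C * dist y x powr \<alpha>) \<longlongrightarrow> 0) (at x)" .
    qed
    then show "isCont (grad u) x" unfolding isCont_def by (rule LIM_zero_cancel)
  qed
qed

lemma ball_continuous_bounded:
  fixes f :: "'a::euclidean_space \<Rightarrow> 'b::real_normed_vector"
  assumes "continuous_on (ball x0 R) f" "s < R"
  obtains M where "M > 0" "\<And>x. x \<in> cball x0 s \<Longrightarrow> norm (f x) \<le> M"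
proof -
  have "cball x0 s \<subseteq> ball x0 R" using assms(2) by auto
  then have "compact (f ` cball x0 s)"
    by (intro compact_continuous_image continuous_on_subset[OF assms(1)]) auto
  then obtain M where "M > 0" "\<And>y. y \<in> f ` cball x0 s \<Longrightarrow> norm y \<le> M"
    using compact_imp_bounded[of "f ` cball x0 s"] unfolding bounded_pos by blast
  then show ?thesis by (intro that[of M]) simp_all
qed

text \<open>The elementary bound t \<le> 1 + t^p for t \<ge> 0 turns p-integrability on a compact
  set into integrability.\<close>

lemma set_integrable_Lp_component:
  fixes g :: "'a::euclidean_space \<Rightarrow> 'a"
  assumes g: "Lp_loc p \<Omega> g" and p: "1 < p" and K: "compact K" "K \<subseteq> \<Omega>" and i: "i \<in> Basis"
  shows "set_integrable lebesgue K (\<lambda>x. g x \<bullet> i)"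
proof -
  have gi: "integrable lebesgue (\<lambda>x. indicator K x *\<^sub>R norm (g x) powr p)"
    using g K by (auto simp: Lp_loc_def set_integrable_def)
  have "integrable lebesgue (\<lambda>x. indicator K x *\<^sub>R (1::real))"
    using set_integrable_lebesgue_continuous_compact[OF K(1), of "\<lambda>_. 1"] by (simp add: set_integrable_def)
  from Bochner_Integration.integrable_add[OF this gi]
  have b: "integrable lebesgue (\<lambda>x. indicator K x *\<^sub>R (1::real) + indicator K x *\<^sub>R norm (g x) powr p)" .
  have gm: "(\<lambda>x. indicator \<Omega> x *\<^sub>R g x) \<in> borel_measurable lebesgue"
    using g by (simp add: Lp_loc_def set_borel_measurable_def)
  have Km: "(indicator K :: 'a \<Rightarrow> real) \<in> borel_measurable lebesgue"
    using K by (intro measurable_completion borel_measurable_indicator) (simp add: borel_compact)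
  have "(\<lambda>x. indicator K x * ((indicator \<Omega> x *\<^sub>R g x) \<bullet> i)) \<in> borel_measurable lebesgue"
    using gm Km by (intro borel_measurable_times borel_measurable_inner) auto
  also have "(\<lambda>x. indicator K x * ((indicator \<Omega> x *\<^sub>R g x) \<bullet> i)) = (\<lambda>x. indicator K x *\<^sub>R (g x \<bullet> i))"
    using K by (auto simp: fun_eq_iff indicator_def)
  finally have m: "(\<lambda>x. indicator K x *\<^sub>R (g x \<bullet> i)) \<in> borel_measurable lebesgue" .
  show ?thesis
    unfolding set_integrable_def
  proof (rule Bochner_Integration.integrable_bound[OF b m], rule AE_I2)
    fix x
    have "\<bar>g x \<bullet> i\<bar> \<le> norm (g x)" using i by (rule Basis_le_norm)
    also have "\<dots> \<le> 1 + norm (g x) powr p"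
    proof (cases "norm (g x) \<le> 1")
      case False
      then have "norm (g x) powr 1 \<le> norm (g x) powr p" using p by (intro powr_mono) auto
      then show ?thesis using False by simp
    qed (use powr_ge_zero[of "norm (g x)" p] in linarith)
    finally show "norm (indicator K x *\<^sub>R (g x \<bullet> i))
        \<le> norm (indicator K x *\<^sub>R (1::real) + indicator K x *\<^sub>R norm (g x) powr p)"
      by (auto simp: indicator_def)
  qed
qed

lemma test_function_grad:
  fixes x0 :: "'a::euclidean_space"
  assumes "test_function (ball x0 R) \<phi>"
  shows "\<And>x. GDERIV \<phi> x :> grad \<phi> x" "continuous_on UNIV (grad \<phi>)" "continuous_on UNIV \<phi>"
proof -
  have C: "Ck_on k UNIV \<phi>" for k using assms unfolding test_function_def smooth_on_def by blast
  show "\<And>x. GDERIV \<phi> x :> grad \<phi> x" "continuous_on UNIV (grad \<phi>)"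
    using Ck_on_1_grad[OF C] by auto
  show "continuous_on UNIV \<phi>" using C[of 0] by simp
qed

lemma grad_zero_outside:
  fixes \<phi> :: "'a::euclidean_space \<Rightarrow> real"
  assumes "\<And>x. x \<notin> cball x0 s \<Longrightarrow> \<phi> x = 0" "x \<notin> cball x0 s"
  shows "GDERIV \<phi> x :> 0"
proof (rule gderiv_local_eq[OF GDERIV_const])
  show "open (- cball x0 s)" by auto
  show "x \<in> - cball x0 s" using assms(2) by auto
  show "\<And>y. y \<in> - cball x0 s \<Longrightarrow> 0 = \<phi> y" using assms(1) by auto
qed

text \<open>The product of u and \<phi>, extended by zero, is differentiable everywhere because
  \<phi> vanishes near the boundary of the ball; the integral of its gradient is zero.\<close>

lemma integration_by_parts_test:
  fixes u :: "'a::euclidean_space \<Rightarrow> real"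
  assumes u: "\<And>x. x \<in> ball x0 R \<Longrightarrow> GDERIV u x :> grad u x" "continuous_on (ball x0 R) (grad u)"
    and \<phi>: "test_function (ball x0 R) \<phi>"
  shows "(LINT x:ball x0 R|lebesgue. u x * (grad \<phi> x \<bullet> i)) = - (LINT x:ball x0 R|lebesgue. (grad u x \<bullet> i) * \<phi> x)"
proof -
  obtain s where s: "s < R" "\<And>x. x \<notin> cball x0 s \<Longrightarrow> \<phi> x = 0"
    using test_function_ballD[OF \<phi>] by blast
  have sub: "cball x0 s \<subseteq> ball x0 R" using s(1) by auto
  have g0: "grad \<phi> x = 0" if "x \<notin> cball x0 s" for x
    using grad_zero_outside[OF s(2) that] by (rule grad_eqI)
  note t = test_function_grad[OF \<phi>]
  have uc: "continuous_on (ball x0 R) u" using u(1) by (rule gderiv_continuous)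
  define G where "G x = (if x \<in> ball x0 R then u x *\<^sub>R grad \<phi> x + \<phi> x *\<^sub>R grad u x else 0)" for x
  have "continuous_on (ball x0 R) (\<lambda>x. u x *\<^sub>R grad \<phi> x + \<phi> x *\<^sub>R grad u x)"
    by (intro continuous_intros uc u continuous_on_subset[OF t(2)] continuous_on_subset[OF t(3)]) auto
  then have Gc: "continuous_on (ball x0 R) G" by (rule continuous_on_eq) (simp add: G_def)
  obtain M where M: "M > 0" "\<And>x. x \<in> cball x0 s \<Longrightarrow> norm (G x) \<le> M"
    using ball_continuous_bounded[OF Gc s(1)] by blast
  have Gz: "G x = 0" if "x \<notin> cball x0 s" for x using s(2) g0 that by (simp add: G_def)
  have "(LINT x|lborel. G x \<bullet> i) = 0"
  proof (rule integral_gradient_zero[where w="\<lambda>x. u x * \<phi> x" and K=M and s=s and ?x0.0=x0])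
    show "norm (G x) \<le> M" for x using M Gz[of x] by (cases "x \<in> cball x0 s") auto
    show z: "x \<notin> cball x0 s \<Longrightarrow> u x * \<phi> x = 0" for x using s(2) by simp
    show "GDERIV (\<lambda>x. u x * \<phi> x) x :> G x" for x
    proof (cases "x \<in> ball x0 R")
      case True
      from GDERIV_mult[OF u(1)[OF True] t(1)] show ?thesis using True by (simp add: G_def)
    next
      case False
      then have "x \<notin> cball x0 s" using sub by blast
      from grad_zero_outside[OF z this] False show ?thesis by (simp add: G_def)
    qed
  qed
  moreover have "(\<lambda>x. G x \<bullet> i) \<in> borel_measurable lborel"
  proof -
    have "(\<lambda>x. indicator (ball x0 R) x *\<^sub>R (G x \<bullet> i)) \<in> borel_measurable borel"
      by (intro borel_measurable_continuous_on_indicator continuous_intros Gc) auto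
    also have "(\<lambda>x. indicator (ball x0 R) x *\<^sub>R (G x \<bullet> i)) = (\<lambda>x. G x \<bullet> i)"
      by (auto simp: fun_eq_iff G_def indicator_def)
    finally show ?thesis by simp
  qed
  ultimately have "0 = (LINT x|lebesgue. G x \<bullet> i)" by (simp add: integral_completion)
  also have "\<dots> = (LINT x:ball x0 R|lebesgue. u x * (grad \<phi> x \<bullet> i) + (grad u x \<bullet> i) * \<phi> x)"
    unfolding set_lebesgue_integral_def
    by (intro Bochner_Integration.integral_cong) (auto simp: G_def indicator_def inner_add_left)
  also have "\<dots> = (LINT x:ball x0 R|lebesgue. u x * (grad \<phi> x \<bullet> i)) + (LINT x:ball x0 R|lebesgue. (grad u x \<bullet> i) * \<phi> x)"
  proof (rule set_integral_add)
    show "set_integrable lebesgue (ball x0 R) (\<lambda>x. u x * (grad \<phi> x \<bullet> i))"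
      by (rule set_integrable_ball_support[of x0 s])
         (auto intro!: continuous_intros continuous_on_subset[OF uc sub] continuous_on_subset[OF t(2)] simp: g0 s(1))
    show "set_integrable lebesgue (ball x0 R) (\<lambda>x. (grad u x \<bullet> i) * \<phi> x)"
      by (rule set_integrable_ball_support[of x0 s])
         (auto intro!: continuous_intros continuous_on_subset[OF u(2) sub] continuous_on_subset[OF t(3)] simp: s)
  qed
  finally show ?thesis by simp
qed

text \<open>Both fields satisfy the same integration by parts formula, so each component of their
  difference annihilates all test functions.\<close>

lemma weak_gradient_eq_grad:
  fixes u :: "'a::euclidean_space \<Rightarrow> real"
  assumes u: "\<And>x. x \<in> ball x0 R \<Longrightarrow> GDERIV u x :> grad u x" "continuous_on (ball x0 R) (grad u)"
    and g: "Lp_loc p (ball x0 R) g" "weak_gradient (ball x0 R) u g" and p: "1 < p"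
  shows "AE x in lebesgue. x \<in> ball x0 R \<longrightarrow> g x = grad u x"
proof -
  have "AE x in lebesgue. x \<in> ball x0 R \<longrightarrow> (g x \<bullet> i - grad u x \<bullet> i) = 0" if i: "i \<in> Basis" for i
  proof (rule fundamental_lemma)
    have gi: "set_integrable lebesgue (cball x0 s) (\<lambda>x. g x \<bullet> i)" if "s < R" for s
      using that by (intro set_integrable_Lp_component[OF g(1) p _ _ i]) auto
    have ui: "set_integrable lebesgue (cball x0 s) (\<lambda>x. grad u x \<bullet> i)" if "s < R" for s
      using that by (intro set_integrable_lebesgue_continuous_compact continuous_intros continuous_on_subset[OF u(2)]) auto
    show "set_integrable lebesgue (cball x0 s) (\<lambda>x. g x \<bullet> i - grad u x \<bullet> i)" if "s < R" for s
      by (intro set_integral_diff gi ui that)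
    fix \<phi> assume \<phi>: "test_function (ball x0 R) \<phi>"
    obtain s where s: "s < R" "\<And>x. x \<notin> cball x0 s \<Longrightarrow> \<phi> x = 0"
      using test_function_ballD[OF \<phi>] by blast
    note t = test_function_grad[OF \<phi>]
    obtain M where M: "\<And>x. norm (\<phi> x) \<le> M"
      using bounded_continuous_compact_support[OF t(3) s(2)] by blast
    have mult: "set_integrable lebesgue (ball x0 R) (\<lambda>x. h x * \<phi> x)"
      if h: "set_integrable lebesgue (cball x0 s) h" for h
    proof -
      have hi: "integrable lebesgue (\<lambda>x. indicator (cball x0 s) x * h x)"
        using h by (simp add: set_integrable_def)
      have "integrable lebesgue (\<lambda>x. indicator (cball x0 s) x * h x * \<phi> x)"
      proof (rule Bochner_Integration.integrable_bound[OF integrable_mult_right[OF hi, of M]])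
        show "(\<lambda>x. indicator (cball x0 s) x * h x * \<phi> x) \<in> borel_measurable lebesgue"
          by (rule borel_measurable_times[OF borel_measurable_integrable[OF hi] borel_measurable_lebesgue_continuous[OF t(3)]])
        show "AE x in lebesgue. norm (indicator (cball x0 s) x * h x * \<phi> x) \<le> norm (M * (indicator (cball x0 s) x * h x))"
        proof (rule AE_I2)
          fix x
          have "norm (\<phi> x) \<le> \<bar>M\<bar>" using M[of x] by simp
          then show "norm (indicator (cball x0 s) x * h x * \<phi> x) \<le> norm (M * (indicator (cball x0 s) x * h x))"
            by (simp add: abs_mult mult.commute[of _ "\<bar>\<phi> x\<bar>"] mult_right_mono)
        qed
      qed
      also have "(\<lambda>x. indicator (cball x0 s) x * h x * \<phi> x) = (\<lambda>x. indicator (ball x0 R) x *\<^sub>R (h x * \<phi> x))"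
        using s by (force simp: fun_eq_iff indicator_def)
      finally show ?thesis by (simp add: set_integrable_def)
    qed
    have "(LINT x:ball x0 R|lebesgue. (g x \<bullet> i - grad u x \<bullet> i) * \<phi> x)
       = (LINT x:ball x0 R|lebesgue. (g x \<bullet> i) * \<phi> x) - (LINT x:ball x0 R|lebesgue. (grad u x \<bullet> i) * \<phi> x)"
      using set_integral_diff(2)[OF mult[OF gi[OF s(1)]] mult[OF ui[OF s(1)]]]
      by (simp add: left_diff_distrib)
    also have "\<dots> = 0"
      using g(2) \<phi> i integration_by_parts_test[OF u \<phi>, of i] unfolding weak_gradient_def by simp
    finally show "(LINT x:ball x0 R|lebesgue. (g x \<bullet> i - grad u x \<bullet> i) * \<phi> x) = 0" .
  qed
  then have "AE x in lebesgue. \<forall>i\<in>Basis. x \<in> ball x0 R \<longrightarrow> (g x \<bullet> i - grad u x \<bullet> i) = 0"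
    by (subst AE_ball_countable) (auto intro: countable_finite)
  then show ?thesis
  proof (rule eventually_mono, intro impI)
    fix x assume "\<forall>i\<in>Basis. x \<in> ball x0 R \<longrightarrow> (g x \<bullet> i - grad u x \<bullet> i) = 0" "x \<in> ball x0 R"
    then show "g x = grad u x" by (auto intro: euclidean_eqI[of "g x"])
  qed
qed

section \<open>The weak equation with Lipschitz test functions\<close>

definition pflux :: "real \<Rightarrow> ('a::euclidean_space \<Rightarrow> real) \<Rightarrow> 'a \<Rightarrow> 'a" where
  "pflux p u x = weightA p u x *\<^sub>R grad u x"

text \<open>For p < 2 the weight blows up near critical points, but the flux does not: p - 1 > 0.
  This bound dominates every integral over the full ball in which the flux occurs.\<close>

lemma norm_pflux: "norm (pflux p u x) = norm (grad u x) powr (p - 1)"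
proof (cases "grad u x = 0")
  case False
  then have "norm (grad u x) powr (p - 2) * norm (grad u x) powr 1 = norm (grad u x) powr (p - 1)"
    by (subst powr_add[symmetric]) simp
  with False show ?thesis by (simp add: pflux_def weightA_def)
qed (simp add: pflux_def)

lemma pflux_grad: "pflux p u x \<bullet> grad u x = norm (grad u x) powr p"
proof (cases "grad u x = 0")
  case False
  then have "norm (grad u x) powr (p - 2) * norm (grad u x) powr 2 = norm (grad u x) powr p"
    by (subst powr_add[symmetric]) simp
  with False show ?thesis by (simp add: pflux_def weightA_def dot_square_norm)
qed (simp add: pflux_def)

lemma p_harmonic_onD:
  fixes u :: "'a::euclidean_space \<Rightarrow> real"
  assumes "p_harmonic_on p \<Omega> u"
  shows "\<And>x. x \<in> \<Omega> \<Longrightarrow> GDERIV u x :> grad u x" "continuous_on \<Omega> (grad u)" "continuous_on \<Omega> u"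
proof -
  have "C1_Holder_loc \<Omega> u" "open \<Omega>" using assms by (auto simp: p_harmonic_on_def)
  from C1_Holder_locD[OF this] show "\<And>x. x \<in> \<Omega> \<Longrightarrow> GDERIV u x :> grad u x" "continuous_on \<Omega> (grad u)"
    by blast+
  then show "continuous_on \<Omega> u" by (intro gderiv_continuous)
qed

text \<open>The weight can be discontinuous at critical points, so measurability is obtained by
  composing the cut-off gradient with Borel functions.\<close>

lemma pflux_measurable:
  fixes u :: "'a::euclidean_space \<Rightarrow> real"
  assumes "continuous_on S (grad u)" "S \<in> sets borel"
  shows "(\<lambda>x. indicator S x *\<^sub>R pflux p u x) \<in> borel_measurable borel"
proof -
  have "(\<lambda>x. indicator S x *\<^sub>R grad u x) \<in> borel_measurable borel" (is "?G \<in> _")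
    using assms by (intro borel_measurable_continuous_on_indicator)
  then have "(\<lambda>x. norm (?G x) powr (p - 2) *\<^sub>R ?G x) \<in> borel_measurable borel"
    by measurable
  also have "(\<lambda>x. norm (?G x) powr (p - 2) *\<^sub>R ?G x) = (\<lambda>x. indicator S x *\<^sub>R pflux p u x)"
    by (auto simp: fun_eq_iff pflux_def weightA_def indicator_def)
  finally show ?thesis .
qed

lemma weak_equation_test:
  fixes u :: "'a::euclidean_space \<Rightarrow> real"
  assumes u: "p_harmonic_on p (ball x0 R) u" and p: "1 < p" and \<phi>: "test_function (ball x0 R) \<phi>"
  shows "(LINT x:ball x0 R|lebesgue. pflux p u x \<bullet> grad \<phi> x) = 0"
proof -
  obtain g where g: "W1p_loc_with p (ball x0 R) u g" and
    eq: "(LINT x:ball x0 R|lebesgue. norm (g x) powr (p - 2) * (g x \<bullet> grad \<phi> x)) = 0"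
    using u \<phi> unfolding p_harmonic_on_def weakly_p_harmonic_on_def by metis
  note D = p_harmonic_onD[OF u]
  have ae: "AE x in lebesgue. x \<in> ball x0 R \<longrightarrow> g x = grad u x"
    using g by (intro weak_gradient_eq_grad[OF D(1,2) _ _ p]) (auto simp: W1p_loc_with_def)
  have gm: "(\<lambda>x. indicator (ball x0 R) x *\<^sub>R g x) \<in> borel_measurable lebesgue" (is "?g \<in> _")
    using g by (simp add: W1p_loc_with_def Lp_loc_def set_borel_measurable_def)
  have tm: "grad \<phi> \<in> borel_measurable lebesgue"
    using test_function_grad(2)[OF \<phi>] by (intro measurable_completion) (simp add: borel_measurable_continuous_onI)
  have "(LINT x:ball x0 R|lebesgue. pflux p u x \<bullet> grad \<phi> x)
      = (LINT x:ball x0 R|lebesgue. norm (g x) powr (p - 2) * (g x \<bullet> grad \<phi> x))"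
    unfolding set_lebesgue_integral_def
  proof (rule integral_cong_AE)
    have "(\<lambda>x. (indicator (ball x0 R) x *\<^sub>R pflux p u x) \<bullet> grad \<phi> x) \<in> borel_measurable lebesgue"
      using pflux_measurable[OF D(2)] tm
      by (intro borel_measurable_inner) (auto intro: measurable_completion)
    then show "(\<lambda>x. indicator (ball x0 R) x *\<^sub>R (pflux p u x \<bullet> grad \<phi> x)) \<in> borel_measurable lebesgue"
      by simp
    have "(\<lambda>x. norm (?g x) powr (p - 2) * (?g x \<bullet> grad \<phi> x)) \<in> borel_measurable lebesgue"
      using gm tm by measurable
    also have "(\<lambda>x. norm (?g x) powr (p - 2) * (?g x \<bullet> grad \<phi> x)) =
        (\<lambda>x. indicator (ball x0 R) x *\<^sub>R (norm (g x) powr (p - 2) * (g x \<bullet> grad \<phi> x)))"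
      by (auto simp: fun_eq_iff indicator_def)
    finally show "(\<lambda>x. indicator (ball x0 R) x *\<^sub>R (norm (g x) powr (p - 2) * (g x \<bullet> grad \<phi> x)))
        \<in> borel_measurable lebesgue" .
    show "AE x in lebesgue. indicator (ball x0 R) x *\<^sub>R (pflux p u x \<bullet> grad \<phi> x) =
        indicator (ball x0 R) x *\<^sub>R (norm (g x) powr (p - 2) * (g x \<bullet> grad \<phi> x))"
      using ae by (rule eventually_mono) (auto simp: pflux_def weightA_def indicator_def)
  qed
  with eq show ?thesis by simp
qed

text \<open>Converse of \<open>gderiv_bound\<close> at a point. Moving in the direction w = D - c
  itself, the difference quotient tends to |w|^2 while its bound is K |w|.\<close>

lemma gderiv_norm_le:
  fixes f :: "'a::euclidean_space \<Rightarrow> real"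
  assumes f: "GDERIV f x :> D" and e: "eventually (\<lambda>y. \<bar>f y - f x - c \<bullet> (y - x)\<bar> \<le> K * norm (y - x)) (at x)"
    and K: "K \<ge> 0"
  shows "norm (D - c) \<le> K"
proof (cases "D = c")
  case False
  define w where "w = D - c"
  have w: "norm w > 0" using False by (simp add: w_def)
  have "((\<lambda>t. x + t *\<^sub>R w) has_derivative (\<lambda>t. t *\<^sub>R w)) (at 0)"
    by (auto intro!: derivative_eq_intros)
  from has_derivative_compose[OF this, of f "\<lambda>h. h \<bullet> D"] f
  have "((\<lambda>t. f (x + t *\<^sub>R w)) has_derivative (\<lambda>t. t *\<^sub>R w \<bullet> D)) (at 0)" by (simp add: gderiv_def)
  then have "((\<lambda>t. f (x + t *\<^sub>R w)) has_real_derivative w \<bullet> D) (at 0)"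
    unfolding has_field_derivative_def by (rule has_derivative_eq_rhs) (simp add: fun_eq_iff)
  then have l: "((\<lambda>t. (f (x + t *\<^sub>R w) - f x) / t - c \<bullet> w) \<longlongrightarrow> w \<bullet> D - c \<bullet> w) (at_right 0)"
    unfolding DERIV_def by (intro tendsto_diff tendsto_const) (auto intro: tendsto_mono[OF at_le])
  have "filterlim (\<lambda>t. x + t *\<^sub>R w) (at x) (at_right 0)"
    unfolding filterlim_at using w
    by (auto intro!: tendsto_eq_intros eventually_at_right_less simp: eventually_at_filter)
  then have "eventually (\<lambda>t. \<bar>f (x + t *\<^sub>R w) - f x - c \<bullet> (t *\<^sub>R w)\<bar> \<le> K * norm (t *\<^sub>R w)) (at_right 0)"
    using e unfolding filterlim_iff by fastforce
  then have "eventually (\<lambda>t. (f (x + t *\<^sub>R w) - f x) / t - c \<bullet> w \<le> K * norm w) (at_right 0)"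
    using eventually_at_right_less[of "0::real"]
  proof eventually_elim
    case (elim t)
    then have "f (x + t *\<^sub>R w) - f x - t * (c \<bullet> w) \<le> t * (K * norm w)" by (simp add: algebra_simps)
    then show ?case using elim by (simp add: field_simps)
  qed
  from tendsto_upperbound[OF l this] have "w \<bullet> D - c \<bullet> w \<le> K * norm w" by simp
  then have "norm w * norm w \<le> K * norm w"
    by (simp add: w_def inner_diff_right inner_diff_left inner_commute dot_square_norm[symmetric] power2_eq_square[symmetric])
  then show ?thesis using w by (simp add: w_def)
qed (use K in simp)

text \<open>At such points the gradients of mollifications of \<open>f\<close> converge to \<open>D\<close>; for a merely
  Lipschitz \<open>f\<close>, differentiability at \<open>x\<close> alone does not say how \<open>f\<close> varies between nearby points.\<close>

definition strict_gradient :: "('a::euclidean_space \<Rightarrow> real) \<Rightarrow> 'a \<Rightarrow> 'a \<Rightarrow> bool" where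
  "strict_gradient f x D \<longleftrightarrow> (\<forall>\<delta>>0. \<exists>\<rho>>0. \<forall>y\<in>ball x \<rho>. \<forall>z\<in>ball x \<rho>. \<bar>f y - f z - D \<bullet> (y - z)\<bar> \<le> \<delta> * norm (y - z))"

text \<open>Mollified gradients are bounded by K and converge to G x at each point of strict
  differentiability, hence almost everywhere; the flux is bounded on \<open>cball x0 s'\<close>, so
  the equation passes to the limit.\<close>

lemma weak_equation_lipschitz:
  fixes u :: "'a::euclidean_space \<Rightarrow> real"
  assumes u: "p_harmonic_on p (ball x0 R) u" and p: "1 < p"
    and lip: "\<And>x y. \<bar>\<psi> x - \<psi> y\<bar> \<le> K * norm (x - y)"
    and supp: "\<And>x. x \<notin> cball x0 s \<Longrightarrow> \<psi> x = 0" and s: "s < R"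
    and G: "AE x in lebesgue. strict_gradient \<psi> x (G x)" and K: "K \<ge> 0"
  shows "(LINT x:ball x0 R|lebesgue. pflux p u x \<bullet> G x) = 0"
proof (cases "(\<lambda>x. indicator (ball x0 R) x *\<^sub>R (pflux p u x \<bullet> G x)) \<in> borel_measurable lebesgue")
  \<comment> \<open>G is controlled only almost everywhere. If the integrand is not measurable, its
    Bochner integral is 0 by default, so the claim holds in this case too.\<close>
  case False
  then show ?thesis
    unfolding set_lebesgue_integral_def
    by (intro not_integrable_integral_eq) (auto dest: borel_measurable_integrable)
next
  case True
  have "K-lipschitz_on UNIV \<psi>"
    using lip K by (intro lipschitz_onI) (auto simp: dist_norm)
  then have cont: "continuous_on UNIV \<psi>" by (rule lipschitz_on_continuous_on)
  define s' where "s' = (s + R) / 2"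
  have s': "s < s'" "s' < R" using s by (auto simp: s'_def)
  note D = p_harmonic_onD[OF u]
  obtain \<phi> \<epsilon> where \<phi>: "\<And>k::nat. test_function (ball x0 R) (\<phi> k)"
    "\<And>k. \<epsilon> k > 0" "\<epsilon> \<longlonglongrightarrow> 0"
    "\<And>k x. x \<notin> cball x0 s' \<Longrightarrow> \<phi> k x = 0"
    "\<And>k x y c B. (\<And>z. z \<in> cball 0 (\<epsilon> k) \<Longrightarrow> \<bar>\<psi> (x - z) - \<psi> (y - z) - c\<bar> \<le> B) \<Longrightarrow>
       \<bar>\<phi> k x - \<phi> k y - c\<bar> \<le> B"
    using mollify_sequence[OF cont supp s'] by metis
  note t = test_function_grad[OF \<phi>(1)]
  have gK: "norm (grad (\<phi> k) x) \<le> K" for k x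
  proof -
    have "norm (grad (\<phi> k) x - 0) \<le> K"
    proof (rule gderiv_norm_le[OF t(1) always_eventually K], rule allI)
      fix y
      have "\<bar>\<phi> k y - \<phi> k x - 0\<bar> \<le> K * norm (y - x)"
        using lip[of "y - z" "x - z" for z] by (intro \<phi>(5)) simp
      then show "\<bar>\<phi> k y - \<phi> k x - 0 \<bullet> (y - x)\<bar> \<le> K * norm (y - x)" by simp
    qed
    then show ?thesis by simp
  qed
  have g0: "grad (\<phi> k) x = 0" if "x \<notin> cball x0 s'" for k x
    using grad_zero_outside[OF \<phi>(4) that] by (rule grad_eqI)
  have lim: "(\<lambda>k. grad (\<phi> k) x) \<longlonglongrightarrow> G x" if sg: "strict_gradient \<psi> x (G x)" for x
  proof (rule LIMSEQ_I)
    fix e :: real assume "e > 0"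
    then obtain \<rho> where \<rho>: "\<rho> > 0"
      "\<And>y z. y \<in> ball x \<rho> \<Longrightarrow> z \<in> ball x \<rho> \<Longrightarrow> \<bar>\<psi> y - \<psi> z - G x \<bullet> (y - z)\<bar> \<le> e/2 * norm (y - z)"
      using sg unfolding strict_gradient_def by (metis half_gt_zero)
    \<comment> \<open>Half the radius: the shift z and the increment y - x together must not leave
      \<open>ball x \<rho>\<close>.\<close>
    have "eventually (\<lambda>k. \<epsilon> k < \<rho>/2) sequentially" using \<phi>(3) \<rho>(1) by (intro order_tendstoD(2)) auto
    then obtain N where N: "\<And>k. k \<ge> N \<Longrightarrow> \<epsilon> k < \<rho>/2" by (auto simp: eventually_sequentially)
    have "norm (grad (\<phi> k) x - G x) < e" if k: "k \<ge> N" for k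
    proof -
      have "eventually (\<lambda>y. dist y x < \<rho>/2) (at x)"
        using \<rho>(1) by (auto simp: eventually_at intro!: exI[of _ "\<rho>/2"])
      then have "eventually (\<lambda>y. \<bar>\<phi> k y - \<phi> k x - G x \<bullet> (y - x)\<bar> \<le> e/2 * norm (y - x)) (at x)"
      proof (rule eventually_mono)
        fix y assume y: "dist y x < \<rho>/2"
        show "\<bar>\<phi> k y - \<phi> k x - G x \<bullet> (y - x)\<bar> \<le> e/2 * norm (y - x)"
        proof (rule \<phi>(5))
          fix z :: 'a assume "z \<in> cball 0 (\<epsilon> k)"
          then have z: "norm z < \<rho>/2" using N[OF k] by (simp add: dist_norm)
          have "norm (y - x - z) < \<rho>"
            using norm_triangle_ineq4[of "y - x" z] y z by (simp add: dist_norm)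
          then have "y - z \<in> ball x \<rho>" "x - z \<in> ball x \<rho>"
            using z \<rho>(1) by (auto simp: dist_norm norm_minus_commute algebra_simps)
          from \<rho>(2)[OF this] show "\<bar>\<psi> (y - z) - \<psi> (x - z) - G x \<bullet> (y - x)\<bar> \<le> e/2 * norm (y - x)" by simp
        qed
      qed
      from gderiv_norm_le[OF t(1) this] \<open>e > 0\<close> have "norm (grad (\<phi> k) x - G x) \<le> e/2" by simp
      with \<open>e > 0\<close> show ?thesis by simp
    qed
    then show "\<exists>N. \<forall>k\<ge>N. norm (grad (\<phi> k) x - G x) < e" by blast
  qed
  obtain M where M: "M > 0" "\<And>x. x \<in> cball x0 s' \<Longrightarrow> norm (grad u x) \<le> M"
    using ball_continuous_bounded[OF D(2) s'(2)] by blast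
  have "(\<lambda>k. LINT x:ball x0 R|lebesgue. pflux p u x \<bullet> grad (\<phi> k) x) \<longlonglongrightarrow>
      (LINT x:ball x0 R|lebesgue. pflux p u x \<bullet> G x)"
    unfolding set_lebesgue_integral_def
  proof (rule integral_dominated_convergence[where w="\<lambda>x. indicator (cball x0 s') x *\<^sub>R (M powr (p - 1) * K)"])
    show "(\<lambda>x. indicator (ball x0 R) x *\<^sub>R (pflux p u x \<bullet> G x)) \<in> borel_measurable lebesgue" by fact
    show "(\<lambda>x. indicator (ball x0 R) x *\<^sub>R (pflux p u x \<bullet> grad (\<phi> k) x)) \<in> borel_measurable lebesgue" for k
    proof -
      have "(\<lambda>x. (indicator (ball x0 R) x *\<^sub>R pflux p u x) \<bullet> grad (\<phi> k) x) \<in> borel_measurable lebesgue"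
        using pflux_measurable[OF D(2)] borel_measurable_continuous_onI[OF t(2)]
        by (intro borel_measurable_inner) (auto intro: measurable_completion)
      then show ?thesis by simp
    qed
    show "integrable lebesgue (\<lambda>x. indicator (cball x0 s') x *\<^sub>R (M powr (p - 1) * K))"
      using set_integrable_lebesgue_continuous_compact[OF compact_cball continuous_on_const]
      unfolding set_integrable_def .
    show "AE x in lebesgue. norm (indicator (ball x0 R) x *\<^sub>R (pflux p u x \<bullet> grad (\<phi> k) x))
        \<le> indicator (cball x0 s') x *\<^sub>R (M powr (p - 1) * K)" for k
    proof (rule AE_I2)
      fix x
      show "norm (indicator (ball x0 R) x *\<^sub>R (pflux p u x \<bullet> grad (\<phi> k) x))
        \<le> indicator (cball x0 s') x *\<^sub>R (M powr (p - 1) * K)"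
      proof (cases "x \<in> cball x0 s'")
        case True
        have "\<bar>pflux p u x \<bullet> grad (\<phi> k) x\<bar> \<le> norm (pflux p u x) * norm (grad (\<phi> k) x)"
          by (rule Cauchy_Schwarz_ineq2)
        also have "\<dots> \<le> M powr (p - 1) * K"
          unfolding norm_pflux using M(2)[OF True] p by (intro mult_mono gK powr_mono2) auto
        finally show ?thesis using True s' by (auto simp: indicator_def)
      qed (simp add: g0)
    qed
    show "AE x in lebesgue. (\<lambda>k. indicator (ball x0 R) x *\<^sub>R (pflux p u x \<bullet> grad (\<phi> k) x)) \<longlonglongrightarrow>
        indicator (ball x0 R) x *\<^sub>R (pflux p u x \<bullet> G x)"
      using G by (rule eventually_mono) (intro tendsto_intros lim)
  qed
  then show ?thesis by (simp add: weak_equation_test[OF u p \<phi>(1)] LIMSEQ_const_iff)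
qed

section \<open>Integrals over spheres\<close>

lemma set_integrable_bounded_continuous:
  fixes g :: "'a::euclidean_space \<Rightarrow> real"
  assumes "S \<in> sets borel" "bounded S" "continuous_on S g" "\<And>x. x \<in> S \<Longrightarrow> \<bar>g x\<bar> \<le> M"
  shows "set_integrable lborel S g"
  unfolding set_integrable_def
proof (rule integrableI_bounded_set[where A=S and B=M])
  show "(\<lambda>x. indicator S x *\<^sub>R g x) \<in> borel_measurable lborel"
    using borel_measurable_continuous_on_indicator[OF assms(1,3)] by simp
  show "emeasure lborel S < \<infinity>" using assms(2) by (rule emeasure_bounded_finite)
  show "AE x in lborel. x \<in> S \<longrightarrow> norm (indicator S x *\<^sub>R g x) \<le> M" using assms(4) by auto
qed (use assms in auto)

text \<open>The projection inside \<open>sphere_measure\<close>, with the radius as a parameter. It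
  writes integrals over all spheres about x0 as integrals over one fixed domain, so that the radius
  enters only through a power and the integrand.\<close>

definition sphere_point :: "'a::euclidean_space \<Rightarrow> real \<Rightarrow> 'a \<Rightarrow> 'a" where
  "sphere_point x0 s x = x0 + (s / norm x) *\<^sub>R x"

definition punctured_ball :: "'a::euclidean_space set" where
  "punctured_ball = ball 0 1 - {0}"

lemma punctured_ball: "punctured_ball \<in> sets borel" "bounded punctured_ball"
  by (auto simp: punctured_ball_def intro: bounded_subset[OF bounded_ball])

lemma dist_sphere_point: "x \<in> punctured_ball \<Longrightarrow> s \<ge> 0 \<Longrightarrow> dist x0 (sphere_point x0 s x) = s"
  by (auto simp: sphere_point_def dist_norm punctured_ball_def)

lemma sphere_point_continuous: "continuous_on punctured_ball (sphere_point x0 s)"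
  unfolding sphere_point_def by (auto intro!: continuous_intros simp: punctured_ball_def)

lemma sphere_bounded_continuous:
  fixes f :: "'a::euclidean_space \<Rightarrow> real"
  assumes "continuous_on (sphere x0 s) f"
  obtains M where "M \<ge> 0" "\<And>y. y \<in> sphere x0 s \<Longrightarrow> \<bar>f y\<bar> \<le> M"
proof -
  have "compact (f ` sphere x0 s)" using assms by (intro compact_continuous_image) auto
  then obtain M where "M > 0" "\<And>y. y \<in> f ` sphere x0 s \<Longrightarrow> norm y \<le> M"
    using compact_imp_bounded[of "f ` sphere x0 s"] unfolding bounded_pos by blast
  then show ?thesis by (intro that[of M]) simp_all
qed

lemma set_integrable_sphere_point:
  fixes f :: "'a::euclidean_space \<Rightarrow> real"
  assumes f: "continuous_on (sphere x0 s) f" and s: "s \<ge> 0"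
  shows "set_integrable lborel punctured_ball (\<lambda>x. f (sphere_point x0 s x))"
proof -
  obtain M where M: "\<And>y. y \<in> sphere x0 s \<Longrightarrow> \<bar>f y\<bar> \<le> M"
    using sphere_bounded_continuous[OF f] by blast
  have im: "sphere_point x0 s ` punctured_ball \<subseteq> sphere x0 s"
    using dist_sphere_point[OF _ s] by auto
  show ?thesis
    by (rule set_integrable_bounded_continuous[OF punctured_ball continuous_on_compose2[OF f sphere_point_continuous im], of M])
       (use M im in blast)
qed

lemma sphere_measurable_continuous:
  fixes f :: "'a::euclidean_space \<Rightarrow> real"
  assumes f: "continuous_on (sphere x0 r) f"
  shows "f \<in> borel_measurable (sphere_measure x0 r)"
proof -
  have "f \<in> borel_measurable (restrict_space borel (sphere x0 r))"
    using f by (rule borel_measurable_continuous_on_restrict)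
  also have "borel_measurable (restrict_space borel (sphere x0 r)) = borel_measurable (sphere_measure x0 r)"
    by (rule measurable_cong_sets) (auto simp: sphere_measure_def)
  finally show ?thesis .
qed

lemma scale_measure_density: "scale_measure c M = density M (\<lambda>_. c)"
  by (rule measure_eqI) (auto simp: emeasure_density_const)

lemma integral_sphere_measure:
  fixes f :: "'a::euclidean_space \<Rightarrow> real"
  assumes f: "continuous_on (sphere x0 r) f" and r: "r > 0"
  shows "(LINT y|sphere_measure x0 r. f y)
     = real DIM('a) * r ^ (DIM('a) - 1) * (LINT x:punctured_ball|lborel. f (sphere_point x0 r x))"
proof -
  have fm: "f \<in> borel_measurable (restrict_space borel (sphere x0 r))"
    using f by (rule borel_measurable_continuous_on_restrict)
  let ?D = "distr (restrict_space lborel (ball 0 1 - {0})) (restrict_space borel (sphere x0 r)) (\<lambda>x. x0 + (r / norm x) *\<^sub>R x)"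
  let ?c = "real DIM('a) * r ^ (DIM('a) - 1)"
  have "(LINT y|sphere_measure x0 r. f y) = (LINT y|density ?D (\<lambda>_. ennreal ?c). f y)"
    unfolding sphere_measure_def scale_measure_density ..
  also have "\<dots> = (LINT y|?D. ?c *\<^sub>R f y)"
    using fm r by (subst integral_density) auto
  also have "\<dots> = ?c * (LINT y|?D. f y)" by simp
  also have "(LINT y|?D. f y) = (LINT x|restrict_space lborel (ball 0 1 - {0}). f (sphere_point x0 r x))"
    unfolding sphere_point_def by (rule integral_distr[OF measurable_sphere_proj[OF r] fm])
  also have "\<dots> = (LINT x:punctured_ball|lborel. f (sphere_point x0 r x))"
    unfolding set_lebesgue_integral_def punctured_ball_def by (rule integral_restrict_space) simp
  finally show ?thesis .
qed

lemma integrable_sphere_measure: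
  fixes f :: "'a::euclidean_space \<Rightarrow> real"
  assumes f: "continuous_on (sphere x0 r) f" and r: "r > 0"
  shows "integrable (sphere_measure x0 r) f"
proof -
  obtain M where M: "\<And>y. y \<in> sphere x0 r \<Longrightarrow> \<bar>f y\<bar> \<le> M"
    using sphere_bounded_continuous[OF f] by blast
  have sp: "space (sphere_measure x0 r) = sphere x0 r"
    by (simp add: sphere_measure_def space_scale_measure space_restrict_space)
  show ?thesis
  proof (rule integrableI_bounded_set[where A="sphere x0 r" and B=M])
    show "sphere x0 r \<in> sets (sphere_measure x0 r)" using sets.top[of "sphere_measure x0 r"] sp by simp
    have "emeasure lborel {x \<in> ball 0 1 - {0}. x0 + (r / norm x) *\<^sub>R x \<in> sphere x0 r} < \<infinity>"
      by (intro emeasure_bounded_finite bounded_subset[OF bounded_ball[of 0 1]]) auto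
    then show "emeasure (sphere_measure x0 r) (sphere x0 r) < \<infinity>"
      by (subst emeasure_sphere_measure[OF r]) (auto simp: ennreal_mult_less_top borel_closed)
    show "AE x in sphere_measure x0 r. x \<in> sphere x0 r \<longrightarrow> norm (f x) \<le> M" using M by auto
    show "f \<in> borel_measurable (sphere_measure x0 r)" by (rule sphere_measurable_continuous[OF f])
    show "AE x in sphere_measure x0 r. x \<notin> sphere x0 r \<longrightarrow> f x = 0" using sp by (intro AE_I2) simp
  qed
qed

text \<open>An extension constant along rays is invariant under dilations about x0, so only the
  volume factor s^n remains. The centre is removed because division by zero would send it to x0, off
  the sphere.\<close>

lemma integral_radial_extension:
  fixes f :: "'a::euclidean_space \<Rightarrow> real"
  assumes f: "continuous_on (sphere x0 r) f" and r: "r > 0" and s: "s > 0"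
  shows "set_integrable lborel (ball x0 s - {x0}) (\<lambda>x. f (sphere_point x0 r (x - x0)))"
    "(LINT x:ball x0 s - {x0}|lborel. f (sphere_point x0 r (x - x0)))
      = s ^ DIM('a) * (LINT x:punctured_ball|lborel. f (sphere_point x0 r x))"
proof -
  let ?S = "ball x0 s - {x0}"
  obtain M where M: "\<And>y. y \<in> sphere x0 r \<Longrightarrow> \<bar>f y\<bar> \<le> M"
    using sphere_bounded_continuous[OF f] by blast
  have im: "(\<lambda>x. sphere_point x0 r (x - x0)) ` ?S \<subseteq> sphere x0 r"
    using r by (auto simp: sphere_point_def dist_norm split: if_splits)
  have c: "continuous_on ?S (\<lambda>x. sphere_point x0 r (x - x0))"
    unfolding sphere_point_def by (auto intro!: continuous_intros)
  have S: "?S \<in> sets borel" "bounded ?S" by (auto intro: bounded_subset[OF bounded_ball])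
  show i: "set_integrable lborel ?S (\<lambda>x. f (sphere_point x0 r (x - x0)))"
    by (rule set_integrable_bounded_continuous[OF S continuous_on_compose2[OF f c im], of M])
       (use M im in blast)
  have m: "(\<lambda>x. indicator ?S x *\<^sub>R f (sphere_point x0 r (x - x0))) \<in> borel_measurable borel"
    using i by (auto simp: set_integrable_def dest: borel_measurable_integrable)
  have "(LINT x:?S|lborel. f (sphere_point x0 r (x - x0)))
     = s ^ DIM('a) * (LINT x|lborel. indicator ?S (x0 + s *\<^sub>R x) *\<^sub>R f (sphere_point x0 r (s *\<^sub>R x)))"
    unfolding set_lebesgue_integral_def using lborel_integral_affine[OF m, of s x0] s by simp
  also have "(\<lambda>x. indicator ?S (x0 + s *\<^sub>R x) *\<^sub>R f (sphere_point x0 r (s *\<^sub>R x)))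
     = (\<lambda>x. indicator punctured_ball x *\<^sub>R f (sphere_point x0 r x))"
    using s by (auto simp: fun_eq_iff indicator_def punctured_ball_def sphere_point_def dist_norm)
  finally show "(LINT x:?S|lborel. f (sphere_point x0 r (x - x0)))
      = s ^ DIM('a) * (LINT x:punctured_ball|lborel. f (sphere_point x0 r x))"
    unfolding set_lebesgue_integral_def .
qed

text \<open>Increments of E are small relative to increments of V, and those are O(|s - r|). Taking
  for V a volume or a linear function turns integral error estimates into derivatives.\<close>

lemma DERIV_zero_of_dominated:
  fixes E V :: "real \<Rightarrow> real"
  assumes V: "(V has_real_derivative V') (at r)"
    and E: "\<And>\<epsilon>. \<epsilon> > 0 \<Longrightarrow> eventually (\<lambda>s. \<bar>E s - E r\<bar> \<le> \<epsilon> * \<bar>V s - V r\<bar>) (at r)"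
  shows "(E has_real_derivative 0) (at r)"
  unfolding has_field_derivative_iff
proof (rule tendstoI)
  fix e :: real assume "e > 0"
  \<comment> \<open>Near r the difference quotients of V stay below |V'| + 1 in absolute
    value.\<close>
  define \<epsilon> where "\<epsilon> = e / (\<bar>V'\<bar> + 1)"
  have \<epsilon>: "\<epsilon> > 0" using \<open>e > 0\<close> by (simp add: \<epsilon>_def add_nonneg_pos)
  have "((\<lambda>s. \<bar>(V s - V r) / (s - r)\<bar>) \<longlongrightarrow> \<bar>V'\<bar>) (at r)"
    using V unfolding has_field_derivative_iff by (intro tendsto_intros)
  then have "eventually (\<lambda>s. \<bar>(V s - V r) / (s - r)\<bar> < \<bar>V'\<bar> + 1) (at r)"
    by (rule order_tendstoD) simp
  then show "eventually (\<lambda>s. dist ((E s - E r) / (s - r)) 0 < e) (at r)"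
    using E[OF \<epsilon>]
  proof eventually_elim
    case (elim s)
    have "\<bar>(E s - E r) / (s - r)\<bar> \<le> \<epsilon> * \<bar>(V s - V r) / (s - r)\<bar>"
      using divide_right_mono[OF elim(2), of "\<bar>s - r\<bar>"] by (simp add: abs_divide)
    also have "\<dots> < \<epsilon> * (\<bar>V'\<bar> + 1)" using mult_strict_left_mono[OF elim(1) \<epsilon>] by simp
    also have "\<dots> = e" by (simp add: \<epsilon>_def add_nonneg_pos less_imp_neq[symmetric])
    finally show ?case by simp
  qed
qed

lemma annulus_compact: "compact {x. a \<le> dist x0 x \<and> dist x0 x \<le> (b::real)}"
  for x0 :: "'a::euclidean_space"
proof -
  have "{x. a \<le> dist x0 x \<and> dist x0 x \<le> b} = cball x0 b - ball x0 a" by auto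
  then show ?thesis by (simp add: compact_diff)
qed

lemma annulus_uniform:
  fixes f :: "'a::euclidean_space \<Rightarrow> 'b::real_normed_vector"
  assumes f: "continuous_on {x. a < dist x0 x \<and> dist x0 x < b} f" and r: "a < r" "r < b" and e: "\<epsilon> > 0"
  obtains d where "d > 0" "a < r - d" "r + d < b"
    "\<And>x y. \<bar>dist x0 x - r\<bar> < d \<Longrightarrow> \<bar>dist x0 y - r\<bar> < d \<Longrightarrow> dist x y < d \<Longrightarrow> norm (f x - f y) \<le> \<epsilon>"
proof -
  define d0 where "d0 = min (r - a) (b - r) / 2"
  have d0: "d0 > 0" "a < r - d0" "r + d0 < b" using r by (auto simp: d0_def min_def field_simps)
  let ?K = "{x. r - d0 \<le> dist x0 x \<and> dist x0 x \<le> r + d0}"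
  have "?K \<subseteq> {x. a < dist x0 x \<and> dist x0 x < b}" using d0 by auto
  then have "uniformly_continuous_on ?K f"
    by (intro compact_uniformly_continuous annulus_compact continuous_on_subset[OF f])
  then obtain d1 where d1: "d1 > 0" "\<And>x y. x \<in> ?K \<Longrightarrow> y \<in> ?K \<Longrightarrow> dist y x < d1 \<Longrightarrow> dist (f y) (f x) < \<epsilon>"
    by (rule uniformly_continuous_onE[OF _ e]) blast
  show ?thesis
  proof (rule that[of "min d0 d1"])
    fix x y assume "\<bar>dist x0 x - r\<bar> < min d0 d1" "\<bar>dist x0 y - r\<bar> < min d0 d1" "dist x y < min d0 d1"
    then have "dist (f x) (f y) < \<epsilon>" by (intro d1(2)) auto
    then show "norm (f x - f y) \<le> \<epsilon>" by (simp add: dist_norm)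
  qed (use d0 d1 in auto)
qed

text \<open>Near \<open>\<partial>B\<^sub>r\<close>, \<open>f\<close> is compared with the radially constant extension \<open>F\<close> of its restriction to the
  sphere, whose integrals over balls are known by homogeneity; no polar coordinates are needed.\<close>

lemma ball_integral_derivative:
  fixes f :: "'a::euclidean_space \<Rightarrow> real"
  assumes fi: "set_integrable lborel (ball x0 b) f"
    and f: "continuous_on {x. a < dist x0 x \<and> dist x0 x < b} f"
    and r: "0 \<le> a" "a < r" "r < b"
  shows "((\<lambda>s. LINT x:ball x0 s|lborel. f x) has_real_derivative (LINT y|sphere_measure x0 r. f y)) (at r)"
proof -
  have r0: "r > 0" using r by simp
  define F where "F x = f (sphere_point x0 r (x - x0))" for x
  define I where "I s = (LINT x:ball x0 s - {x0}|lborel. F x)" for s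
  \<comment> \<open>The volume of the ball serves as comparison function; it is the radial extension
    of the constant 1 and thus has the same explicit form as \<open>I\<close>.\<close>
  define V where "V s = (LINT x:ball x0 s - {x0}|lborel. (1::real))" for s
  define \<Phi> where "\<Phi> s = (LINT x:ball x0 s|lborel. f x)" for s
  define c0 where "c0 = (LINT x:punctured_ball|lborel. f (sphere_point x0 r x))"
  define c1 where "c1 = (LINT x:(punctured_ball::'a set)|lborel. (1::real))"
  have fs: "continuous_on (sphere x0 r) f"
    by (rule continuous_on_subset[OF f]) (use r in auto)
  have FI: "set_integrable lborel (ball x0 s - {x0}) F" "I s = s ^ DIM('a) * c0" if "s > 0" for s
    using integral_radial_extension[OF fs r0 that] by (simp_all add: F_def[abs_def] I_def c0_def)
  have VI: "set_integrable lborel (ball x0 s - {x0}) (\<lambda>_. 1::real)" "V s = s ^ DIM('a) * c1" if "s > 0" for s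
    using integral_radial_extension[of x0 r "\<lambda>_. 1" s] r0 that by (simp_all add: V_def c1_def)
  have pow: "((\<lambda>s. s ^ DIM('a) * c) has_real_derivative (real DIM('a) * r ^ (DIM('a) - 1) * c)) (at r)" for c
    by (auto intro!: derivative_eq_intros)
  have Ider: "(I has_real_derivative (LINT y|sphere_measure x0 r. f y)) (at r)"
    unfolding integral_sphere_measure[OF fs r0] c0_def[symmetric]
    by (rule has_field_derivative_transform_within_open[OF pow[of c0], of "{0<..}"]) (use r0 FI in auto)
  have Vder: "(V has_real_derivative (real DIM('a) * r ^ (DIM('a) - 1) * c1)) (at r)"
    by (rule has_field_derivative_transform_within_open[OF pow[of c1], of "{0<..}"]) (use r0 VI in auto)
  have Eder: "((\<lambda>s. \<Phi> s - I s) has_real_derivative 0) (at r)"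
  proof (rule DERIV_zero_of_dominated[OF Vder])
    fix \<epsilon> :: real assume \<epsilon>: "\<epsilon> > 0"
    obtain d where d: "d > 0" "a < r - d" "r + d < b"
      "\<And>x y. \<bar>dist x0 x - r\<bar> < d \<Longrightarrow> \<bar>dist x0 y - r\<bar> < d \<Longrightarrow> dist x y < d \<Longrightarrow> norm (f x - f y) \<le> \<epsilon>"
      using annulus_uniform[OF f r(2,3) \<epsilon>] by blast
    have near: "\<bar>f x - F x\<bar> \<le> \<epsilon>" if x: "\<bar>dist x0 x - r\<bar> < d" for x
    proof -
      have nz: "norm (x - x0) > 0" using x d r by (auto simp: dist_norm)
      then have 1: "dist x0 (sphere_point x0 r (x - x0)) = r"
        using r0 by (simp add: sphere_point_def dist_norm)
      have "x - sphere_point x0 r (x - x0) = (1 - r / norm (x - x0)) *\<^sub>R (x - x0)"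
        by (simp add: sphere_point_def algebra_simps)
      then have "dist x (sphere_point x0 r (x - x0)) = \<bar>1 - r / norm (x - x0)\<bar> * norm (x - x0)"
        by (simp add: dist_norm)
      also have "\<dots> = \<bar>(1 - r / norm (x - x0)) * norm (x - x0)\<bar>" by (simp add: abs_mult)
      also have "\<dots> = \<bar>dist x0 x - r\<bar>"
        using nz by (simp add: left_diff_distrib dist_norm norm_minus_commute)
      finally show ?thesis
        unfolding F_def real_norm_def[symmetric] using x 1 d(1) by (intro d(4)) auto
    qed
    \<comment> \<open>On a thin shell f and F differ by at most \<epsilon>, so the error over the
      shell is at most \<epsilon> times its volume. Ordered radii cover the approach to r from both
      sides.\<close>
    have step: "\<bar>(\<Phi> s2 - I s2) - (\<Phi> s1 - I s1)\<bar> \<le> \<epsilon> * (V s2 - V s1)"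
      if s: "\<bar>s1 - r\<bar> < d" "\<bar>s2 - r\<bar> < d" "s1 \<le> s2" for s1 s2
    proof -
      have s0: "0 < s1" "0 < s2" "s2 < b" using s d r by auto
      let ?D = "ball x0 s2 - ball x0 s1"
      have Dm: "?D \<in> sets lborel" by auto
      have fD: "set_integrable lborel ?D f" "set_integrable lborel (ball x0 s1) f"
        using s0 s(3) by (auto intro!: set_integrable_subset[OF fi])
      have FD: "set_integrable lborel ?D F"
        using s0 by (auto intro!: set_integrable_subset[OF FI(1)[OF s0(2)]])
      have VD: "set_integrable lborel ?D (\<lambda>_. 1::real)"
        using s0 by (auto intro!: set_integrable_subset[OF VI(1)[OF s0(2)]])
      have b1: "ball x0 s2 = ball x0 s1 \<union> ?D" using s(3) by auto
      have b2: "ball x0 s2 - {x0} = (ball x0 s1 - {x0}) \<union> ?D" using s(3) s0 by auto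
      have 1: "\<Phi> s2 = \<Phi> s1 + (LINT x:?D|lborel. f x)"
        unfolding \<Phi>_def by (subst b1, rule set_integral_Un) (use fD in auto)
      have 2: "I s2 = I s1 + (LINT x:?D|lborel. F x)"
        unfolding I_def by (subst b2, rule set_integral_Un) (use FD FI(1)[OF s0(1)] in auto)
      have 3: "V s2 = V s1 + (LINT x:?D|lborel. 1)"
        unfolding V_def by (subst b2, rule set_integral_Un) (use VD VI(1)[OF s0(1)] in auto)
      have "\<bar>(LINT x:?D|lborel. f x) - (LINT x:?D|lborel. F x)\<bar> = \<bar>LINT x:?D|lborel. f x - F x\<bar>"
        using set_integral_diff(2)[OF fD(1) FD] by simp
      also have "\<dots> \<le> (LINT x:?D|lborel. \<bar>f x - F x\<bar>)"
        using set_integral_norm_bound[of lborel ?D "\<lambda>x. f x - F x"] set_integral_diff(1)[OF fD(1) FD] by simp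
      also have "\<dots> \<le> (LINT x:?D|lborel. \<epsilon> * 1)"
      proof (rule set_integral_mono)
        show "set_integrable lborel ?D (\<lambda>x. \<bar>f x - F x\<bar>)"
          using set_integrable_abs[OF set_integral_diff(1)[OF fD(1) FD]] by simp
        show "set_integrable lborel ?D (\<lambda>x. \<epsilon> * 1)" using VD by (rule set_integrable_mult_right)
        fix x assume "x \<in> ?D"
        then show "\<bar>f x - F x\<bar> \<le> \<epsilon> * 1" using near[of x] s by auto
      qed
      also have "\<dots> = \<epsilon> * (LINT x:?D|lborel. 1)" by (rule set_integral_mult_right)
      finally show ?thesis using 1 2 3 by simp
    qed
    have "eventually (\<lambda>s. \<bar>s - r\<bar> < d) (at r)"
      using d(1) by (auto simp: eventually_at dist_real_def intro!: exI[of _ d])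
    then show "eventually (\<lambda>s. \<bar>(\<Phi> s - I s) - (\<Phi> r - I r)\<bar> \<le> \<epsilon> * \<bar>V s - V r\<bar>) (at r)"
    proof (rule eventually_mono)
      fix s assume s: "\<bar>s - r\<bar> < d"
      have le: "\<epsilon> * t \<le> \<epsilon> * \<bar>t\<bar>" for t using \<epsilon> by simp
      show "\<bar>(\<Phi> s - I s) - (\<Phi> r - I r)\<bar> \<le> \<epsilon> * \<bar>V s - V r\<bar>"
      proof (cases "r \<le> s")
        case True
        then show ?thesis using step[of r s] s d(1) le[of "V s - V r"] by simp
      next
        case False
        then show ?thesis using step[of s r] s d(1) le[of "V r - V s"]
          by (simp add: abs_minus_commute)
      qed
    qed
  qed
  from DERIV_add[OF Eder Ider] show ?thesis by (simp add: \<Phi>_def)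
qed

text \<open>The weight stays frozen on the sphere of radius r while q moves along rays. This is the
  shape of the boundary term produced by a dilation; with weight 1 it also differentiates H. Along
  each ray q changes by its normal derivative times s - r, up to \<epsilon> |s - r| uniformly in the
  ray.\<close>

lemma sphere_average_derivative:
  fixes q w :: "'a::euclidean_space \<Rightarrow> real"
  assumes q: "\<And>x. a < dist x0 x \<Longrightarrow> dist x0 x < b \<Longrightarrow> GDERIV q x :> Dq x"
    and Dq: "continuous_on {x. a < dist x0 x \<and> dist x0 x < b} Dq"
    and w: "continuous_on (sphere x0 r) w"
    and r: "0 \<le> a" "a < r" "r < b"
  shows "((\<lambda>s. LINT x:punctured_ball|lborel. w (sphere_point x0 r x) * q (sphere_point x0 s x)) has_real_derivative
     (LINT x:punctured_ball|lborel. w (sphere_point x0 r x) *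
        (Dq (sphere_point x0 r x) \<bullet> sphere_normal x0 (sphere_point x0 r x)))) (at r)"
proof -
  have r0: "r > 0" using r by simp
  let ?A = "{x. a < dist x0 x \<and> dist x0 x < b}"
  have qc: "continuous_on ?A q" using q by (intro gderiv_continuous) auto
  obtain W where W: "W \<ge> 0" "\<And>y. y \<in> sphere x0 r \<Longrightarrow> \<bar>w y\<bar> \<le> W"
    using sphere_bounded_continuous[OF w] by blast
  let ?P = "punctured_ball :: 'a set"
  let ?sp = "sphere_point x0"
  define S where "S s = (LINT x:?P|lborel. w (?sp r x) * q (?sp s x))" for s
  define h where "h y = w y * (Dq y \<bullet> sphere_normal x0 y)" for y
  define L where "L = (LINT x:?P|lborel. h (?sp r x))"
  define c1 where "c1 = (LINT x:?P|lborel. (1::real))"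
  have one: "set_integrable lborel ?P (\<lambda>_. 1::real)"
    using set_integrable_sphere_point[of x0 r "\<lambda>_. 1"] r0 by simp
  have c1: "c1 \<ge> 0" unfolding c1_def set_lebesgue_integral_def by (rule Bochner_Integration.integral_nonneg) simp
  have hc: "continuous_on (sphere x0 r) h"
    unfolding h_def sphere_normal_def using r r0
    by (intro continuous_intros w continuous_on_subset[OF Dq]) (auto simp: dist_norm)
  have hi: "set_integrable lborel ?P (\<lambda>x. h (?sp r x))"
    using set_integrable_sphere_point[OF hc] r0 by simp
  have si: "set_integrable lborel ?P (\<lambda>x. w (?sp r x) * q (?sp s x))" if s: "a < s" "s < b" for s
  proof -
    have s0: "s > 0" using s r by simp
    \<comment> \<open>Pulling w back by the dilation expresses the two-radius integrand as a
      function on the single sphere of radius s.\<close>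
    let ?g = "\<lambda>y. w (x0 + (r / s) *\<^sub>R (y - x0)) * q y"
    have "continuous_on (sphere x0 s) ?g"
    proof (intro continuous_intros continuous_on_compose2[OF w] continuous_on_subset[OF qc])
      show "(\<lambda>y. x0 + (r / s) *\<^sub>R (y - x0)) ` sphere x0 s \<subseteq> sphere x0 r"
        using s0 r0 by (auto simp: dist_norm norm_minus_commute)
    qed (use s in auto)
    from set_integrable_sphere_point[OF this] s0
    have "set_integrable lborel ?P (\<lambda>x. ?g (?sp s x))" by simp
    also have "(\<lambda>x. ?g (?sp s x)) = (\<lambda>x. w (?sp r x) * q (?sp s x))"
      using s0 by (simp add: sphere_point_def fun_eq_iff)
    finally show ?thesis .
  qed
  have "((\<lambda>s. S s - (s - r) * L) has_real_derivative 0) (at r)"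
  proof (rule DERIV_zero_of_dominated)
    \<comment> \<open>Linear comparison function: the pointwise error is at most W \<epsilon> |s -
      r|, and c1 is the measure of the domain of integration.\<close>
    show "((\<lambda>s. (W + 1) * (c1 + 1) * s) has_real_derivative (W + 1) * (c1 + 1)) (at r)"
      by (auto intro!: derivative_eq_intros)
    fix \<epsilon> :: real assume \<epsilon>: "\<epsilon> > 0"
    obtain d where d: "d > 0" "a < r - d" "r + d < b"
      "\<And>x y. \<bar>dist x0 x - r\<bar> < d \<Longrightarrow> \<bar>dist x0 y - r\<bar> < d \<Longrightarrow> dist x y < d \<Longrightarrow> norm (Dq x - Dq y) \<le> \<epsilon>"
      using annulus_uniform[OF Dq r(2,3) \<epsilon>] by blast
    have "eventually (\<lambda>s. \<bar>s - r\<bar> < d) (at r)"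
      using d(1) by (auto simp: eventually_at dist_real_def intro!: exI[of _ d])
    then show "eventually (\<lambda>s. \<bar>S s - (s - r) * L - (S r - (r - r) * L)\<bar> \<le>
        \<epsilon> * \<bar>(W + 1) * (c1 + 1) * s - (W + 1) * (c1 + 1) * r\<bar>) (at r)"
    proof (rule eventually_mono)
      fix s assume s: "\<bar>s - r\<bar> < d"
      have sb: "a < s" "s < b" using s d by auto
      have pt: "\<bar>w (?sp r x) * q (?sp s x) - w (?sp r x) * q (?sp r x) - (s - r) * h (?sp r x)\<bar>
          \<le> W * (\<epsilon> * \<bar>s - r\<bar>) * 1" if x: "x \<in> ?P" for x
      proof -
        define \<omega> where "\<omega> = (1 / norm x) *\<^sub>R x"
        have \<omega>: "norm \<omega> = 1" using x by (simp add: \<omega>_def punctured_ball_def)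
        have sp: "?sp t x = x0 + t *\<^sub>R \<omega>" for t by (simp add: sphere_point_def \<omega>_def)
        have nrm: "sphere_normal x0 (?sp r x) = \<omega>"
          using r0 \<omega> by (simp add: sp sphere_normal_def)
        \<comment> \<open>The segment joining the two sphere points lies on one ray and never leaves
          the annulus in which \<open>Dq\<close> is controlled.\<close>
        have seg: "\<exists>t. z = x0 + t *\<^sub>R \<omega> \<and> \<bar>t - r\<bar> < d \<and> dist x0 z = t"
          if zs: "z \<in> closed_segment (?sp s x) (?sp r x)" for z
        proof -
          obtain v where v: "0 \<le> v" "v \<le> 1" "z = (1 - v) *\<^sub>R ?sp s x + v *\<^sub>R ?sp r x"
            using zs unfolding in_segment by blast
          define t where "t = (1 - v) * s + v * r"
          have z: "z = x0 + t *\<^sub>R \<omega>" by (simp add: v sp t_def algebra_simps)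
          have "\<bar>t - r\<bar> = (1 - v) * \<bar>s - r\<bar>"
          proof -
            have "t - r = (1 - v) * (s - r)" by (simp add: t_def algebra_simps)
            then show ?thesis using v by (simp add: abs_mult)
          qed
          also have "\<dots> \<le> 1 * \<bar>s - r\<bar>" using v by (intro mult_right_mono) auto
          finally have "\<bar>t - r\<bar> < d" using s by simp
          moreover from this have "t > 0" using d r by auto
          ultimately show ?thesis using z \<omega> by (auto simp: dist_norm intro!: exI[of _ t])
        qed
        have "\<bar>q (?sp s x) - q (?sp r x) - Dq (?sp r x) \<bullet> (?sp s x - ?sp r x)\<bar> \<le> \<epsilon> * norm (?sp s x - ?sp r x)"
        proof (rule gderiv_bound[where D=Dq and S="closed_segment (?sp s x) (?sp r x)"])
          fix z assume "z \<in> closed_segment (?sp s x) (?sp r x)"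
          from seg[OF this] obtain t where t: "z = x0 + t *\<^sub>R \<omega>" "\<bar>t - r\<bar> < d" "dist x0 z = t" by blast
          show "GDERIV q z :> Dq z" using t d by (intro q) auto
          have "z - ?sp r x = (t - r) *\<^sub>R \<omega>" by (simp add: t sp algebra_simps)
          then have "dist z (?sp r x) < d" using t(2) \<omega> by (simp add: dist_norm)
          moreover have "dist x0 (?sp r x) = r" using \<omega> r0 by (simp add: sp dist_norm)
          ultimately show "norm (Dq z - Dq (?sp r x)) \<le> \<epsilon>" using t d(1) by (intro d(4)) auto
        qed auto
        moreover have "?sp s x - ?sp r x = (s - r) *\<^sub>R \<omega>" by (simp add: sp algebra_simps)
        ultimately have 1: "\<bar>q (?sp s x) - q (?sp r x) - (s - r) * (Dq (?sp r x) \<bullet> \<omega>)\<bar> \<le> \<epsilon> * \<bar>s - r\<bar>"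
          using \<omega> by simp
        have 2: "\<bar>w (?sp r x)\<bar> \<le> W" using dist_sphere_point[OF x, of r x0] r0 by (intro W(2)) simp
        have "w (?sp r x) * q (?sp s x) - w (?sp r x) * q (?sp r x) - (s - r) * h (?sp r x)
          = w (?sp r x) * (q (?sp s x) - q (?sp r x) - (s - r) * (Dq (?sp r x) \<bullet> \<omega>))"
          by (simp add: h_def nrm algebra_simps)
        then show ?thesis using mult_mono[OF 2 1 W(1)] by (simp add: abs_mult)
      qed
      note i = set_integral_diff(1)[OF set_integral_diff(1)[OF si[OF sb] si[OF r(2,3)]] set_integrable_mult_right[OF hi, of "s - r"]]
      have "S s - S r - (s - r) * L =
        (LINT x:?P|lborel. w (?sp r x) * q (?sp s x) - w (?sp r x) * q (?sp r x) - (s - r) * h (?sp r x))"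
        unfolding S_def L_def
        by (subst set_integral_diff(2)[OF set_integral_diff(1)[OF si[OF sb] si[OF r(2,3)]] set_integrable_mult_right[OF hi]],
            subst set_integral_diff(2)[OF si[OF sb] si[OF r(2,3)]], subst set_integral_mult_right) simp
      then have "\<bar>S s - S r - (s - r) * L\<bar> \<le>
          (LINT x:?P|lborel. \<bar>w (?sp r x) * q (?sp s x) - w (?sp r x) * q (?sp r x) - (s - r) * h (?sp r x)\<bar>)"
        using set_integral_norm_bound[OF i] by simp
      also have "\<dots> \<le> (LINT x:?P|lborel. W * (\<epsilon> * \<bar>s - r\<bar>) * 1)"
        by (rule set_integral_mono[OF _ _ pt]) (use set_integrable_abs[OF i] set_integrable_mult_right[OF one] in auto)
      also have "\<dots> = W * (\<epsilon> * \<bar>s - r\<bar>) * c1" unfolding c1_def by (rule set_integral_mult_right)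
      also have "\<dots> = \<epsilon> * (W * c1 * \<bar>s - r\<bar>)" by simp
      also have "\<dots> \<le> \<epsilon> * ((W + 1) * (c1 + 1) * \<bar>s - r\<bar>)"
        using W(1) c1 \<epsilon> by (intro mult_left_mono mult_right_mono mult_mono) auto
      also have "(W + 1) * (c1 + 1) * \<bar>s - r\<bar> = \<bar>(W + 1) * (c1 + 1) * s - (W + 1) * (c1 + 1) * r\<bar>"
        using W(1) c1 by (simp add: abs_mult flip: right_diff_distrib)
      finally show "\<bar>S s - (s - r) * L - (S r - (r - r) * L)\<bar> \<le>
        \<epsilon> * \<bar>(W + 1) * (c1 + 1) * s - (W + 1) * (c1 + 1) * r\<bar>" by simp
    qed
  qed
  moreover have "((\<lambda>s. (s - r) * L) has_real_derivative L) (at r)"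
    by (auto intro!: derivative_eq_intros)
  ultimately have "((\<lambda>s. S s - (s - r) * L + (s - r) * L) has_real_derivative 0 + L) (at r)"
    by (rule DERIV_add)
  then show ?thesis by (simp add: S_def L_def h_def)
qed

section \<open>The flux identity\<close>

text \<open>Near x the gradient differs from D x by at most \<delta>, so \<open>gderiv_bound\<close>
  with \<open>c = D x\<close> applies on a small ball.\<close>

lemma strict_gradient_C1:
  fixes f :: "'a::euclidean_space \<Rightarrow> real"
  assumes U: "open U" "x \<in> U" and f: "\<And>y. y \<in> U \<Longrightarrow> GDERIV f y :> D y" and D: "continuous_on U D"
  shows "strict_gradient f x (D x)"
  unfolding strict_gradient_def
proof (intro allI impI)
  fix \<delta> :: real assume \<delta>: "\<delta> > 0"
  have "isCont D x" using D U by (simp add: continuous_on_eq_continuous_at)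
  then obtain d where d: "d > 0" "\<And>y. dist y x < d \<Longrightarrow> dist (D y) (D x) < \<delta>"
    using \<delta> unfolding continuous_at_eps_delta by blast
  obtain e where e: "e > 0" "ball x e \<subseteq> U" using U open_contains_ball by blast
  let ?\<rho> = "min d e"
  have "\<bar>f y - f z - D x \<bullet> (y - z)\<bar> \<le> \<delta> * norm (y - z)" if "y \<in> ball x ?\<rho>" "z \<in> ball x ?\<rho>" for y z
  proof (rule gderiv_bound[OF convex_ball _ _ that])
    fix w assume w: "w \<in> ball x ?\<rho>"
    then show "GDERIV f w :> D w" using e(2) by (intro f) auto
    show "norm (D w - D x) \<le> \<delta>"
      using w d(2)[of w] by (simp add: dist_norm norm_minus_commute)
  qed
  then show "\<exists>\<rho>>0. \<forall>y\<in>ball x \<rho>. \<forall>z\<in>ball x \<rho>. \<bar>f y - f z - D x \<bullet> (y - z)\<bar> \<le> \<delta> * norm (y - z)"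
    using d(1) e(1) by (intro exI[of _ ?\<rho>]) simp
qed

lemma AE_not_on_sphere: "AE x in lebesgue. dist x0 x \<noteq> (\<rho>::real)" for x0 :: "'a::euclidean_space"
proof -
  have "sphere x0 \<rho> \<in> null_sets lebesgue"
    using negligible_sphere by (simp add: negligible_iff_null_sets)
  then have "AE x in lebesgue. x \<notin> sphere x0 \<rho>" by (rule AE_not_in)
  then show ?thesis by (rule eventually_mono) simp
qed

lemma set_integral_lebesgue_eq_lborel:
  fixes f :: "'a::euclidean_space \<Rightarrow> real"
  assumes "set_integrable lborel S f"
  shows "(LINT x:S|lebesgue. f x) = (LINT x:S|lborel. f x)"
  unfolding set_lebesgue_integral_def
  by (rule integral_completion) (use assms in \<open>auto simp: set_integrable_def dest: borel_measurable_integrable\<close>)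

lemma pflux_continuous:
  fixes u :: "'a::euclidean_space \<Rightarrow> real"
  assumes "continuous_on S (grad u)" "\<And>x. x \<in> S \<Longrightarrow> grad u x \<noteq> 0"
  shows "continuous_on S (weightA p u)" "continuous_on S (pflux p u)"
proof -
  show 1: "continuous_on S (weightA p u)"
    unfolding weightA_def using assms by (intro continuous_intros) auto
  then show "continuous_on S (pflux p u)"
    unfolding pflux_def using assms by (intro continuous_intros)
qed

lemma set_integrable_pflux_inner:
  fixes u :: "'a::euclidean_space \<Rightarrow> real"
  assumes u: "p_harmonic_on p (ball x0 R) u" and p: "1 < p"
    and k: "continuous_on (ball x0 b) k" and b: "s < b" "b \<le> R"
  shows "set_integrable lborel (ball x0 s) (\<lambda>x. pflux p u x \<bullet> k x)"
proof -
  note D = p_harmonic_onD[OF u]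
  have s: "s < R" using b by simp
  obtain M where M: "M > 0" "\<And>x. x \<in> cball x0 s \<Longrightarrow> norm (grad u x) \<le> M"
    using ball_continuous_bounded[OF D(2) s] by blast
  obtain L where L: "L > 0" "\<And>x. x \<in> cball x0 s \<Longrightarrow> norm (k x) \<le> L"
    using ball_continuous_bounded[OF k b(1)] by blast
  show ?thesis
    unfolding set_integrable_def
  proof (rule integrableI_bounded_set[where A="ball x0 s" and B="M powr (p - 1) * L"])
    have "(\<lambda>x. indicator (ball x0 s) x *\<^sub>R pflux p u x) \<in> borel_measurable borel"
      by (rule pflux_measurable[OF continuous_on_subset[OF D(2)]]) (use s in auto)
    moreover have "(\<lambda>x. indicator (ball x0 s) x *\<^sub>R k x) \<in> borel_measurable borel"
      by (rule borel_measurable_continuous_on_indicator[OF _ continuous_on_subset[OF k]]) (use b in auto)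
    ultimately have "(\<lambda>x. (indicator (ball x0 s) x *\<^sub>R pflux p u x) \<bullet> (indicator (ball x0 s) x *\<^sub>R k x)) \<in> borel_measurable borel"
      by (rule borel_measurable_inner)
    also have "(\<lambda>x. (indicator (ball x0 s) x *\<^sub>R pflux p u x) \<bullet> (indicator (ball x0 s) x *\<^sub>R k x))
       = (\<lambda>x. indicator (ball x0 s) x *\<^sub>R (pflux p u x \<bullet> k x))"
      by (auto simp: fun_eq_iff indicator_def)
    finally show "(\<lambda>x. indicator (ball x0 s) x *\<^sub>R (pflux p u x \<bullet> k x)) \<in> borel_measurable lborel" by simp
    show "emeasure lborel (ball x0 s) < \<infinity>" by (rule emeasure_lborel_ball_finite)
    show "AE x in lborel. x \<in> ball x0 s \<longrightarrow> norm (indicator (ball x0 s) x *\<^sub>R (pflux p u x \<bullet> k x)) \<le> M powr (p - 1) * L"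
    proof (intro AE_I2 impI)
      fix x assume x: "x \<in> ball x0 s"
      have "\<bar>pflux p u x \<bullet> k x\<bar> \<le> norm (pflux p u x) * norm (k x)" by (rule Cauchy_Schwarz_ineq2)
      also have "\<dots> \<le> M powr (p - 1) * L"
        unfolding norm_pflux using M(2)[of x] L(2)[of x] x p by (intro mult_mono powr_mono2) auto
      finally show "norm (indicator (ball x0 s) x *\<^sub>R (pflux p u x \<bullet> k x)) \<le> M powr (p - 1) * L"
        using x by simp
    qed
  qed auto
qed

text \<open>The weak equation is tested with the Lipschitz function \<open>max 0 (\<rho>\<^sup>2 - |x - x\<^sub>0|\<^sup>2) \<psi>(x)\<close>;
  differentiating the result in \<open>\<rho>\<close> produces the boundary term of the flux identity.\<close>

lemma weighted_flux_equation:
  fixes u :: "'a::euclidean_space \<Rightarrow> real"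
  assumes u: "p_harmonic_on p (ball x0 R) u" and p: "1 < p"
    and \<psi>: "\<And>x. x \<in> ball x0 b \<Longrightarrow> GDERIV \<psi> x :> g x" and g: "continuous_on (ball x0 b) g"
    and \<rho>: "0 < \<rho>" "\<rho> < b" "b \<le> R"
  shows "(LINT x:ball x0 \<rho>|lborel. pflux p u x \<bullet> ((\<rho>\<^sup>2 - (norm (x - x0))\<^sup>2) *\<^sub>R g x - (2 * \<psi> x) *\<^sub>R (x - x0))) = 0"
proof -
  have \<psi>c: "continuous_on (ball x0 b) \<psi>" using \<psi> by (rule gderiv_continuous)
  have sub: "cball x0 \<rho> \<subseteq> ball x0 b" using \<rho> by auto
  obtain M where M: "M > 0" "\<And>x. x \<in> cball x0 \<rho> \<Longrightarrow> norm (\<psi> x) \<le> M"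
    using ball_continuous_bounded[OF \<psi>c \<rho>(2)] by blast
  obtain L where L: "L > 0" "\<And>x. x \<in> cball x0 \<rho> \<Longrightarrow> norm (g x) \<le> L"
    using ball_continuous_bounded[OF g \<rho>(2)] by blast
  define \<eta> where "\<eta> x = \<rho>\<^sup>2 - (norm (x - x0))\<^sup>2" for x
  define \<Psi> where "\<Psi> x = (if x \<in> ball x0 \<rho> then \<eta> x * \<psi> x else 0)" for x
  define k where "k x = \<eta> x *\<^sub>R g x - (2 * \<psi> x) *\<^sub>R (x - x0)" for x
  define G where "G x = (if x \<in> ball x0 \<rho> then k x else 0)" for x
  \<comment> \<open>The product rule bounds the gradient of \<eta> \<psi>: \<eta> is at most
    \<rho>^2, and the gradient of \<eta> has length at most 2 \<rho>.\<close>
  define K where "K = \<rho>\<^sup>2 * L + 2 * M * \<rho>"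
  have K: "K \<ge> 0" using M L \<rho> by (simp add: K_def)
  have \<eta>der: "GDERIV \<eta> x :> - (2 *\<^sub>R (x - x0))" for x
    unfolding \<eta>_def gderiv_def power2_norm_eq_inner
    by (auto intro!: derivative_eq_intros simp: inner_commute algebra_simps)
  have pder: "GDERIV (\<lambda>x. \<eta> x * \<psi> x) x :> k x" if "x \<in> ball x0 b" for x
    using GDERIV_mult[OF \<eta>der \<psi>[OF that]] by (rule GDERIV_subst) (simp add: k_def)
  have kc: "continuous_on (ball x0 b) k"
    unfolding k_def \<eta>_def by (intro continuous_intros g \<psi>c)
  have kK: "norm (k x) \<le> K" if x: "x \<in> cball x0 \<rho>" for x
  proof -
    have nx: "norm (x - x0) \<le> \<rho>" using x by (simp add: dist_norm norm_minus_commute)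
    then have "(norm (x - x0))\<^sup>2 \<le> \<rho>\<^sup>2" by (intro power_mono) auto
    then have "\<bar>\<eta> x\<bar> \<le> \<rho>\<^sup>2" by (simp add: \<eta>_def)
    then have "\<bar>\<eta> x\<bar> * norm (g x) + 2 * norm (\<psi> x) * norm (x - x0) \<le> K"
      unfolding K_def using M(2)[OF x] L(2)[OF x] nx M(1) by (intro add_mono mult_mono) auto
    moreover have "norm (k x) \<le> \<bar>\<eta> x\<bar> * norm (g x) + 2 * norm (\<psi> x) * norm (x - x0)"
      unfolding k_def using norm_triangle_ineq4[of "\<eta> x *\<^sub>R g x" "(2 * \<psi> x) *\<^sub>R (x - x0)"] by simp
    ultimately show ?thesis by simp
  qed
  \<comment> \<open>Across the sphere there is no gradient to use. Instead \<eta> vanishes linearly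
    at the boundary: \<rho>^2 - |y - x0|^2 \<le> 2 \<rho> (\<rho> - |y - x0|) \<le> 2 \<rho> |y -
    z|.\<close>
  have out: "\<bar>\<eta> y * \<psi> y\<bar> \<le> K * norm (y - z)" if y: "y \<in> ball x0 \<rho>" and z: "z \<notin> ball x0 \<rho>" for y z
  proof -
    have ny: "norm (y - x0) < \<rho>" using y by (simp add: dist_norm norm_minus_commute)
    have nz: "norm (z - x0) \<ge> \<rho>" using z by (simp add: dist_norm norm_minus_commute)
    have "\<eta> y = (\<rho> + norm (y - x0)) * (\<rho> - norm (y - x0))" by (simp add: \<eta>_def power2_eq_square algebra_simps)
    also have "\<bar>\<dots>\<bar> \<le> (2 * \<rho>) * norm (y - z)"
      using ny nz norm_triangle_ineq2[of "z - x0" "y - x0"] \<rho>(1)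
      unfolding abs_mult by (intro mult_mono) (auto simp: norm_minus_commute)
    finally have "\<bar>\<eta> y\<bar> \<le> 2 * \<rho> * norm (y - z)" .
    then have "\<bar>\<eta> y\<bar> * \<bar>\<psi> y\<bar> \<le> (2 * \<rho> * norm (y - z)) * M"
      using M(2)[of y] ny M(1) y \<rho>(1) by (intro mult_mono) auto
    also have "\<dots> \<le> K * norm (y - z)" using L \<rho> by (simp add: K_def algebra_simps)
    finally show ?thesis by (simp add: abs_mult)
  qed
  have lip: "\<bar>\<Psi> y - \<Psi> z\<bar> \<le> K * norm (y - z)" for y z
  proof -
    consider "y \<in> ball x0 \<rho>" "z \<in> ball x0 \<rho>" | "y \<in> ball x0 \<rho>" "z \<notin> ball x0 \<rho>"
      | "y \<notin> ball x0 \<rho>" "z \<in> ball x0 \<rho>" | "y \<notin> ball x0 \<rho>" "z \<notin> ball x0 \<rho>" by blast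
    then show ?thesis
    proof cases
      case 1
      have "\<bar>\<eta> y * \<psi> y - \<eta> z * \<psi> z - 0 \<bullet> (y - z)\<bar> \<le> K * norm (y - z)"
        by (rule gderiv_bound[OF convex_ball[of x0 \<rho>] pder _ 1]) (use \<rho> kK in auto)
      then show ?thesis using 1 by (simp add: \<Psi>_def)
    next
      case 2
      then show ?thesis using out[OF 2] by (simp add: \<Psi>_def)
    next
      case 3
      then show ?thesis using out[OF 3(2,1)] by (simp add: \<Psi>_def norm_minus_commute)
    next
      case 4
      then show ?thesis using K by (simp add: \<Psi>_def)
    qed
  qed
  have "(LINT x:ball x0 R|lebesgue. pflux p u x \<bullet> G x) = 0"
  proof (rule weak_equation_lipschitz[OF u p lip _ _ _ K, where s=\<rho>])
    show "\<Psi> x = 0" if "x \<notin> cball x0 \<rho>" for x using that by (auto simp: \<Psi>_def)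
    show "\<rho> < R" using \<rho> by simp
    \<comment> \<open>The only kink of \<Psi> is on the sphere of radius \<rho>, a null set; on
      either side \<Psi> is C^1.\<close>
    show "AE x in lebesgue. strict_gradient \<Psi> x (G x)"
      using AE_not_on_sphere[of x0 \<rho>]
    proof (rule eventually_mono)
      fix x assume "dist x0 x \<noteq> \<rho>"
      then consider "x \<in> ball x0 \<rho>" | "x \<in> - cball x0 \<rho>" by force
      then show "strict_gradient \<Psi> x (G x)"
      proof cases
        case 1
        show ?thesis
        proof (rule strict_gradient_C1[OF open_ball 1])
          show "GDERIV \<Psi> y :> G y" if y: "y \<in> ball x0 \<rho>" for y
          proof -
            have "GDERIV (\<lambda>x. \<eta> x * \<psi> x) y :> k y" using y \<rho> by (intro pder) auto
            then have "GDERIV \<Psi> y :> k y"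
              by (rule gderiv_local_eq[OF _ open_ball y]) (simp add: \<Psi>_def)
            then show ?thesis using y by (simp add: G_def)
          qed
          show "continuous_on (ball x0 \<rho>) G"
          proof (rule continuous_on_eq)
            show "continuous_on (ball x0 \<rho>) k"
              using \<rho> by (intro continuous_on_subset[OF kc]) auto
          qed (simp add: G_def)
        qed
      next
        case 2
        show ?thesis
        proof (rule strict_gradient_C1[OF _ 2])
          show "open (- cball x0 \<rho>)" by auto
          show "GDERIV \<Psi> y :> G y" if y: "y \<in> - cball x0 \<rho>" for y
          proof -
            have "GDERIV \<Psi> y :> 0"
              by (rule gderiv_local_eq[OF GDERIV_const[of 0] _ y]) (auto simp: \<Psi>_def)
            then show ?thesis using y by (simp add: G_def)
          qed
          show "continuous_on (- cball x0 \<rho>) G"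
            by (rule continuous_on_eq[of _ "\<lambda>_. 0"]) (auto simp: G_def)
        qed
      qed
    qed
  qed
  also have "(LINT x:ball x0 R|lebesgue. pflux p u x \<bullet> G x) = (LINT x:ball x0 \<rho>|lebesgue. pflux p u x \<bullet> k x)"
    unfolding set_lebesgue_integral_def using \<rho>
    by (intro Bochner_Integration.integral_cong) (auto simp: G_def indicator_def)
  also have "\<dots> = (LINT x:ball x0 \<rho>|lborel. pflux p u x \<bullet> k x)"
    by (rule set_integral_lebesgue_eq_lborel[OF set_integrable_pflux_inner[OF u p kc \<rho>(2,3)]])
  finally show ?thesis by (simp add: k_def \<eta>_def)
qed

text \<open>The weighted equation is differentiated in its radius at r. Differentiating s^2 gives
  the volume term 2 r \<integral> A Du \<bullet> D\<psi>; the two boundary terms carrying D\<psi>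
  cancel since |y - x0| = r there; the remaining boundary term carries y - x0, which is r times the
  normal.\<close>

lemma flux_identity:
  fixes u :: "'a::euclidean_space \<Rightarrow> real"
  assumes u: "p_harmonic_on p (ball x0 R) u" and p: "1 < p"
    and nz: "\<And>x. a < dist x0 x \<Longrightarrow> dist x0 x < b \<Longrightarrow> grad u x \<noteq> 0"
    and r: "0 \<le> a" "a < r" "r < b" "b \<le> R"
    and \<psi>: "\<And>x. x \<in> ball x0 b \<Longrightarrow> GDERIV \<psi> x :> g x" and g: "continuous_on (ball x0 b) g"
  shows "(LINT x:ball x0 r|lborel. pflux p u x \<bullet> g x)
    = (LINT y|sphere_measure x0 r. (pflux p u y \<bullet> sphere_normal x0 y) * \<psi> y)"
proof -
  have r0: "r > 0" using r by simp
  note D = p_harmonic_onD[OF u]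
  have \<psi>c: "continuous_on (ball x0 b) \<psi>" using \<psi> by (rule gderiv_continuous)
  define c where "c = (r + b) / 2"
  have c: "r < c" "c < b" using r by (auto simp: c_def)
  let ?A = "{x. a < dist x0 x \<and> dist x0 x < c}"
  have Ab: "?A \<subseteq> ball x0 b" using c by auto
  have Vc: "continuous_on ?A (pflux p u)"
    using c r by (intro pflux_continuous continuous_on_subset[OF D(2)] nz) auto
  \<comment> \<open>The integrand of the weighted equation depends on its radius. Separating the
    powers of the radius leaves ball integrals of three fixed functions, each differentiable at
    r.\<close>
  define k1 where "k1 = g"
  define k2 where "k2 x = (norm (x - x0))\<^sup>2 *\<^sub>R g x" for x
  define k3 where "k3 x = \<psi> x *\<^sub>R (x - x0)" for x
  have kc: "continuous_on (ball x0 b) k1" "continuous_on (ball x0 b) k2" "continuous_on (ball x0 b) k3"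
    unfolding k1_def k2_def k3_def by (intro continuous_intros g \<psi>c)+
  define \<Phi> where "\<Phi> k s = (LINT x:ball x0 s|lborel. pflux p u x \<bullet> k x)" for k s
  have int: "set_integrable lborel (ball x0 s) (\<lambda>x. pflux p u x \<bullet> k x)"
    if "continuous_on (ball x0 b) k" "s < b" for k s
    by (rule set_integrable_pflux_inner[OF u p that r(4)])
  have der: "(\<Phi> k has_real_derivative (LINT y|sphere_measure x0 r. pflux p u y \<bullet> k y)) (at r)"
    if k: "continuous_on (ball x0 b) k" for k
    unfolding \<Phi>_def[abs_def]
    by (rule ball_integral_derivative[OF int[OF k c(2)] _ r(1,2) c(1)])
       (intro continuous_intros Vc continuous_on_subset[OF k Ab])
  have eq: "s\<^sup>2 * \<Phi> k1 s - \<Phi> k2 s = 2 * \<Phi> k3 s" if s: "0 < s" "s < b" for s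
  proof -
    have "0 = (LINT x:ball x0 s|lborel. s\<^sup>2 * (pflux p u x \<bullet> k1 x) - (pflux p u x \<bullet> k2 x) - 2 * (pflux p u x \<bullet> k3 x))"
      using weighted_flux_equation[OF u p \<psi> g s r(4)]
      by (simp add: k1_def k2_def k3_def inner_diff_right left_diff_distrib algebra_simps)
    also have "\<dots> = s\<^sup>2 * \<Phi> k1 s - \<Phi> k2 s - 2 * \<Phi> k3 s"
      unfolding \<Phi>_def using int[OF kc(1) s(2)] int[OF kc(2) s(2)] int[OF kc(3) s(2)]
      by (simp add: set_integral_diff set_integrable_mult_right)
    finally show ?thesis by simp
  qed
  let ?S = "\<lambda>k. LINT y|sphere_measure x0 r. pflux p u y \<bullet> k y"
  have "((\<lambda>s. s\<^sup>2 * \<Phi> k1 s - \<Phi> k2 s) has_real_derivative (2 * r * \<Phi> k1 r + r\<^sup>2 * ?S k1 - ?S k2)) (at r)"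
    using der[OF kc(1)] der[OF kc(2)] by (auto intro!: derivative_eq_intros)
  moreover have "((\<lambda>s. s\<^sup>2 * \<Phi> k1 s - \<Phi> k2 s) has_real_derivative (2 * ?S k3)) (at r)"
  proof (rule has_field_derivative_transform_within_open[where S="{0<..<b}"])
    show "((\<lambda>s. 2 * \<Phi> k3 s) has_real_derivative (2 * ?S k3)) (at r)"
      using der[OF kc(3)] by (auto intro!: derivative_eq_intros)
  qed (use r0 r eq in auto)
  ultimately have "2 * r * \<Phi> k1 r + r\<^sup>2 * ?S k1 - ?S k2 = 2 * ?S k3" by (rule DERIV_unique)
  moreover have sp: "space (sphere_measure x0 r) = sphere x0 r"
    by (simp add: sphere_measure_def space_scale_measure space_restrict_space)
  \<comment> \<open>On the sphere |y - x0|^2 is the constant r^2: this is the cancellation of the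
    terms with D\<psi>.\<close>
  have "?S k2 = (LINT y|sphere_measure x0 r. r\<^sup>2 * (pflux p u y \<bullet> k1 y))"
    by (rule Bochner_Integration.integral_cong) (auto simp: sp k1_def k2_def dist_norm norm_minus_commute)
  moreover have "?S k3 = (LINT y|sphere_measure x0 r. r * ((pflux p u y \<bullet> sphere_normal x0 y) * \<psi> y))"
  proof (rule Bochner_Integration.integral_cong)
    fix y assume "y \<in> space (sphere_measure x0 r)"
    then have "norm (y - x0) = r" by (simp add: sp dist_norm norm_minus_commute)
    then show "pflux p u y \<bullet> k3 y = r * ((pflux p u y \<bullet> sphere_normal x0 y) * \<psi> y)"
      using r0 by (simp add: k3_def sphere_normal_def)
  qed simp
  ultimately have "r * \<Phi> k1 r = r * (LINT y|sphere_measure x0 r. (pflux p u y \<bullet> sphere_normal x0 y) * \<psi> y)"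
    by simp
  then show ?thesis using r0 by (simp add: \<Phi>_def k1_def)
qed

section \<open>The Rellich--Pohozaev identity\<close>

text \<open>Convexity of |.|^p in tangent form, obtained from Cauchy-Schwarz and Young's inequality
  with conjugate exponent p/(p - 1). For \<open>Y = 0\<close> the convention
  \<open>0 powr a = 0\<close> makes the right side vanish.\<close>

lemma norm_powr_tangent:
  fixes X Y :: "'a::real_inner"
  assumes p: "1 < p"
  shows "norm X powr p \<ge> norm Y powr p + p * (norm Y powr (p - 2) * (Y \<bullet> (X - Y)))"
proof (cases "Y = 0")
  case False
  define q where "q = p / (p - 1)"
  have q: "q > 1" "1 / p + 1 / q = 1" using p by (simp_all add: q_def field_simps)
  have Y: "norm Y > 0" using False by simp
  have 1: "norm Y powr (p - 2) * (Y \<bullet> Y) = norm Y powr p"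
  proof -
    have "norm Y powr (p - 2) * norm Y powr 2 = norm Y powr p"
      using Y by (subst powr_add[symmetric]) simp
    then show ?thesis using Y by (simp add: dot_square_norm)
  qed
  have "norm Y powr (p - 2) * (Y \<bullet> X) \<le> norm Y powr (p - 2) * (norm Y * norm X)"
    by (intro mult_left_mono norm_cauchy_schwarz) simp
  also have "\<dots> = norm X * norm Y powr (p - 1)"
  proof -
    have "norm Y powr (p - 2) * norm Y powr 1 = norm Y powr (p - 1)"
      using Y by (subst powr_add[symmetric]) simp
    then show ?thesis using Y by (simp add: mult.commute mult.left_commute)
  qed
  also have "\<dots> \<le> norm X powr p / p + (norm Y powr (p - 1)) powr q / q"
    by (rule Youngs_inequality[OF p q]) auto
  also have "(norm Y powr (p - 1)) powr q = norm Y powr p"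
    using p by (simp add: powr_powr q_def)
  finally have "p * (norm Y powr (p - 2) * (Y \<bullet> X)) \<le> p * (norm X powr p / p + norm Y powr p / q)"
    using p by (intro mult_left_mono) auto
  also have "\<dots> = norm X powr p + (p - 1) * norm Y powr p"
    using p by (simp add: q_def field_simps)
  finally show ?thesis using 1 by (simp add: inner_diff_right right_diff_distrib left_diff_distrib)
qed simp

text \<open>The weight is the power (p - 2)/2 of |Du|^2. The latter is a sum of squares of C^1
  partial derivatives and positive on S, so no differentiation of the norm itself occurs.\<close>

lemma weightA_gderiv:
  fixes u :: "'a::euclidean_space \<Rightarrow> real"
  assumes S: "open S" and u: "Ck_on (Suc (Suc 0)) S u" and nz: "\<And>x. x \<in> S \<Longrightarrow> grad u x \<noteq> 0"
  shows "\<And>x. x \<in> S \<Longrightarrow> GDERIV (weightA p u) x :> grad (weightA p u) x"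
    "continuous_on S (grad (weightA p u))"
proof -
  let ?d = "\<lambda>i x. frechet_derivative u (at x) i"
  have d: "Ck_on (Suc 0) S (?d i)" for i using u by simp
  have dg: "GDERIV (?d i) x :> grad (?d i) x" if "x \<in> S" for i x
    by (rule Ck_on_1_grad(1)[OF d that])
  have dc: "continuous_on S (grad (?d i))" for i by (rule Ck_on_1_grad(2)[OF d])
  have dcont: "continuous_on S (?d i)" for i using dg by (rule gderiv_continuous)
  define N where "N x = (\<Sum>i\<in>Basis. (?d i x)\<^sup>2)" for x
  define gN where "gN x = (\<Sum>i\<in>Basis. (2 * ?d i x) *\<^sub>R grad (?d i) x)" for x
  have Neq: "N x = (norm (grad u x))\<^sup>2" if "x \<in> S" for x
  proof -
    have "u differentiable (at x)" using u that by simp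
    then show ?thesis
      unfolding N_def power2_norm_eq_inner
      by (subst euclidean_inner) (simp add: gderiv_grad(2) power2_eq_square inner_commute)
  qed
  have Npos: "N x > 0" if "x \<in> S" for x using Neq[OF that] nz[OF that] by simp
  have Nder: "GDERIV N x :> gN x" if x: "x \<in> S" for x
  proof -
    have "((\<lambda>x. \<Sum>i\<in>Basis. (?d i x)\<^sup>2) has_derivative (\<lambda>h. \<Sum>i\<in>Basis. 2 * ?d i x * (h \<bullet> grad (?d i) x))) (at x)"
    proof (rule has_derivative_sum)
      fix i :: 'a
      have "((\<lambda>x. (?d i x)\<^sup>2) has_derivative (\<lambda>h. of_nat 2 * (h \<bullet> grad (?d i) x) * ?d i x ^ (2 - 1))) (at x)"
        using dg[OF x, of i] unfolding gderiv_def by (rule has_derivative_power)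
      then show "((\<lambda>x. (?d i x)\<^sup>2) has_derivative (\<lambda>h. 2 * ?d i x * (h \<bullet> grad (?d i) x))) (at x)"
        by (rule has_derivative_eq_rhs) (simp add: fun_eq_iff)
    qed
    then show ?thesis unfolding gderiv_def N_def[abs_def] gN_def
      by (rule has_derivative_eq_rhs) (simp add: fun_eq_iff inner_sum_right)
  qed
  define gA where "gA x = ((p - 2) / 2 * N x powr ((p - 2) / 2 - 1)) *\<^sub>R gN x" for x
  have Ader: "GDERIV (weightA p u) x :> gA x" if x: "x \<in> S" for x
  proof (rule gderiv_local_eq[OF _ S x])
    have "((\<lambda>t. t powr ((p - 2) / 2)) has_real_derivative ((p - 2) / 2 * N x powr ((p - 2) / 2 - 1))) (at (N x))"
      using Npos[OF x] by (rule has_real_derivative_powr)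
    then show "GDERIV (\<lambda>x. N x powr ((p - 2) / 2)) x :> gA x"
      unfolding gA_def by (rule GDERIV_DERIV_compose[OF Nder[OF x]])
    fix y assume y: "y \<in> S"
    have "N y = norm (grad u y) powr 2" using nz[OF y] by (simp add: Neq[OF y])
    then show "N y powr ((p - 2) / 2) = weightA p u y"
      unfolding weightA_def by (simp only: powr_powr) (simp add: diff_divide_distrib)
  qed
  show "GDERIV (weightA p u) x :> grad (weightA p u) x" if "x \<in> S" for x
    unfolding grad_eqI[OF Ader[OF that]] by (rule Ader[OF that])
  have Nnz: "N x \<noteq> 0" if "x \<in> S" for x using Npos[OF that] by simp
  have Ncont: "continuous_on S N" using Nder by (rule gderiv_continuous)
  have "continuous_on S gA"
    unfolding gA_def gN_def
    by (intro continuous_intros dcont dc Ncont ballI Nnz)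
  then show "continuous_on S (grad (weightA p u))"
    by (rule continuous_on_eq) (rule grad_eqI[OF Ader, symmetric])
qed

section \<open>Radial derivatives of D and H\<close>

lemma freqD_eq:
  fixes u :: "'a::euclidean_space \<Rightarrow> real"
  assumes u: "p_harmonic_on p (ball x0 R) u" and p: "1 < p" and s: "s < R"
  shows "freqD p u x0 s = (LINT x:ball x0 s|lborel. norm (grad u x) powr p)"
    "set_integrable lborel (ball x0 s) (\<lambda>x. norm (grad u x) powr p)"
proof -
  show "set_integrable lborel (ball x0 s) (\<lambda>x. norm (grad u x) powr p)"
    using set_integrable_pflux_inner[OF u p p_harmonic_onD(2)[OF u] s order_refl] by (simp add: pflux_grad)
  then show "freqD p u x0 s = (LINT x:ball x0 s|lborel. norm (grad u x) powr p)"
    unfolding freqD_def by (rule set_integral_lebesgue_eq_lborel)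
qed

text \<open>The integrand is |Dw|^p for the dilated function w. In the exponent p - n, the p comes
  from the factor l in Dw and the -n from the change of variables.\<close>

lemma freqD_scaling:
  fixes u :: "'a::euclidean_space \<Rightarrow> real"
  assumes u: "p_harmonic_on p (ball x0 R) u" and p: "1 < p" and r: "0 < r" and l: "0 < l" "l * r < R"
  shows "set_integrable lborel (ball x0 r) (\<lambda>x. norm (l *\<^sub>R grad u (x0 + l *\<^sub>R (x - x0))) powr p)"
    "(LINT x:ball x0 r|lborel. norm (l *\<^sub>R grad u (x0 + l *\<^sub>R (x - x0))) powr p)
      = l powr (p - real DIM('a)) * freqD p u x0 (l * r)"
proof -
  let ?f = "\<lambda>x. norm (grad u x) powr p"
  note D = freqD_eq[OF u p l(2)]
  let ?F = "\<lambda>x. indicator (ball x0 (l * r)) x *\<^sub>R ?f x"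
  have Fm: "?F \<in> borel_measurable borel"
    using D(2) by (auto simp: set_integrable_def dest: borel_measurable_integrable)
  have l0: "l \<noteq> 0" using l by simp
  have ind: "?F ((x0 - l *\<^sub>R x0) + l *\<^sub>R x) = indicator (ball x0 r) x *\<^sub>R ?f (x0 + l *\<^sub>R (x - x0))" for x
  proof -
    have "dist x0 ((x0 - l *\<^sub>R x0) + l *\<^sub>R x) = norm (l *\<^sub>R (x0 - x))"
      by (simp add: dist_norm algebra_simps)
    also have "\<dots> = l * dist x0 x" using l by (simp add: dist_norm)
    finally have "(x0 - l *\<^sub>R x0) + l *\<^sub>R x \<in> ball x0 (l * r) \<longleftrightarrow> x \<in> ball x0 r" using l by simp
    then show ?thesis by (simp add: indicator_def algebra_simps)
  qed
  have hl: "norm (l *\<^sub>R grad u y) powr p = l powr p * ?f y" for y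
    using l by (simp add: powr_mult)
  have "freqD p u x0 (l * r) = l ^ DIM('a) * (LINT x:ball x0 r|lborel. ?f (x0 + l *\<^sub>R (x - x0)))"
    unfolding D(1) set_lebesgue_integral_def
    using lborel_integral_affine[OF Fm l0, of "x0 - l *\<^sub>R x0"] l by (simp only: ind abs_of_pos)
  moreover have "l powr (p - real DIM('a)) * l ^ DIM('a) = l powr p"
    using l by (simp add: powr_realpow[symmetric] powr_add[symmetric])
  ultimately show "(LINT x:ball x0 r|lborel. norm (l *\<^sub>R grad u (x0 + l *\<^sub>R (x - x0))) powr p)
      = l powr (p - real DIM('a)) * freqD p u x0 (l * r)"
    unfolding hl set_integral_mult_right by (simp add: mult.assoc[symmetric])
  have "continuous_on (cball x0 r) (\<lambda>x. norm (l *\<^sub>R grad u (x0 + l *\<^sub>R (x - x0))) powr p)"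
  proof (intro continuous_on_powr' continuous_intros continuous_on_compose2[OF p_harmonic_onD(2)[OF u]] ballI)
    show "(\<lambda>x. x0 + l *\<^sub>R (x - x0)) ` cball x0 r \<subseteq> ball x0 R"
    proof clarify
      fix x assume "x \<in> cball x0 r"
      then have "l * norm (x - x0) \<le> l * r" using l by (simp add: dist_norm norm_minus_commute)
      from this l(2) have "l * norm (x - x0) < R" by (rule order.strict_trans1)
      then show "x0 + l *\<^sub>R (x - x0) \<in> ball x0 R" using l by (simp add: dist_norm)
    qed
  qed (use p in auto)
  then have "set_integrable lborel (cball x0 r) (\<lambda>x. norm (l *\<^sub>R grad u (x0 + l *\<^sub>R (x - x0))) powr p)"
    unfolding set_integrable_def by (intro borel_integrable_compact) auto
  then show "set_integrable lborel (ball x0 r) (\<lambda>x. norm (l *\<^sub>R grad u (x0 + l *\<^sub>R (x - x0))) powr p)"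
    by (rule set_integrable_subset) auto
qed

lemma sphere_subset_annulus: "a < r \<Longrightarrow> r < b \<Longrightarrow> sphere x0 r \<subseteq> {x. a < dist x0 x \<and> dist x0 x < b}"
  by auto

lemma sphere_normal_continuous: "r > 0 \<Longrightarrow> continuous_on (sphere x0 r) (sphere_normal x0)"
  unfolding sphere_normal_def by (auto intro!: continuous_intros simp: dist_norm)

text \<open>Differentiability of D at r, with derivative \<integral> |Du|^p over the sphere, comes
  from continuity of Du near the sphere. The convexity inequality is then what evaluates this
  integral.\<close>

lemma freqD_derivative:
  fixes u :: "'a::euclidean_space \<Rightarrow> real"
  assumes u: "p_harmonic_on p (ball x0 R) u" and p: "1 < p"
    and nz: "\<And>x. a < dist x0 x \<Longrightarrow> dist x0 x < b \<Longrightarrow> grad u x \<noteq> 0"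
    and r: "0 \<le> a" "a < r" "r < b" "b \<le> R"
  shows "(freqD p u x0 has_real_derivative
        (real DIM('a) - p) / r * freqD p u x0 r + p * freqG p u x0 r) (at r)"
proof -
  have r0: "r > 0" using r by simp
  note D = p_harmonic_onD[OF u]
  let ?n = "real DIM('a)"
  let ?A = "{x. a < dist x0 x \<and> dist x0 x < b}"
  have AR: "?A \<subseteq> ball x0 R" using r by auto
  have gc: "continuous_on ?A (grad u)" and uc: "continuous_on ?A u"
    using continuous_on_subset[OF D(2) AR] continuous_on_subset[OF D(3) AR] by auto
  note SA = sphere_subset_annulus[OF r(2,3), of x0]
  have Vc: "continuous_on (sphere x0 r) (pflux p u)"
    using SA nz by (intro pflux_continuous continuous_on_subset[OF gc]) auto
  define w where "w y = pflux p u y \<bullet> sphere_normal x0 y" for y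
  have wc: "continuous_on (sphere x0 r) w"
    unfolding w_def by (intro continuous_intros Vc sphere_normal_continuous r0)
  let ?P = "punctured_ball :: 'a set"
  let ?sp = "sphere_point x0"
  define S where "S s = (LINT x:?P|lborel. w (?sp r x) * u (?sp s x))" for s
  let ?c = "?n * r ^ (DIM('a) - 1)"
  define B where "B s = ?c * (S s - S r)" for s
  \<comment> \<open>The gap in the convexity inequality, written in s = \<lambda> r; it is
    nonnegative near r and zero at r.\<close>
  define Q where "Q s = (s / r) powr (p - ?n) * freqD p u x0 s - freqD p u x0 r - p * B s" for s
  define d where "d = (LINT y|sphere_measure x0 r. norm (grad u y) powr p)"
  define c where "c = (r + b) / 2"
  have c: "r < c" "c < b" using r by (auto simp: c_def)
  have Dd: "(freqD p u x0 has_real_derivative d) (at r)"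
  proof (rule has_field_derivative_transform_within_open[where S="{..<R}"])
    show "((\<lambda>s. LINT x:ball x0 s|lborel. norm (grad u x) powr p) has_real_derivative d) (at r)"
      unfolding d_def
    proof (rule ball_integral_derivative[OF _ _ r(1,2) c(1)])
      show "set_integrable lborel (ball x0 c) (\<lambda>x. norm (grad u x) powr p)"
        using c r by (intro freqD_eq(2)[OF u p]) simp
      show "continuous_on {x. a < dist x0 x \<and> dist x0 x < c} (\<lambda>x. norm (grad u x) powr p)"
        using c nz by (intro continuous_intros continuous_on_subset[OF gc]) auto
    qed
    show "(LINT x:ball x0 s|lborel. norm (grad u x) powr p) = freqD p u x0 s" if "s \<in> {..<R}" for s
      using freqD_eq(1)[OF u p, of s] that by simp
  qed (use r in auto)
  have Sd: "(B has_real_derivative freqG p u x0 r) (at r)"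
  proof -
    have "(S has_real_derivative (LINT x:?P|lborel. w (?sp r x) * (grad u (?sp r x) \<bullet> sphere_normal x0 (?sp r x)))) (at r)"
      unfolding S_def[abs_def] using AR
      by (intro sphere_average_derivative[OF D(1) gc wc r(1-3)]) auto
    then have "(B has_real_derivative ?c * (LINT x:?P|lborel. w (?sp r x) * (grad u (?sp r x) \<bullet> sphere_normal x0 (?sp r x)))) (at r)"
      unfolding B_def[abs_def] by (auto intro!: derivative_eq_intros)
    also have "?c * (LINT x:?P|lborel. w (?sp r x) * (grad u (?sp r x) \<bullet> sphere_normal x0 (?sp r x)))
        = (LINT y|sphere_measure x0 r. w y * (grad u y \<bullet> sphere_normal x0 y))"
      by (rule integral_sphere_measure[symmetric, OF _ r0])
         (intro continuous_intros wc continuous_on_subset[OF gc SA] sphere_normal_continuous r0)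
    also have "\<dots> = freqG p u x0 r"
      unfolding freqG_def w_def normal_deriv_def pflux_def by (simp add: power2_eq_square mult.assoc)
    finally show ?thesis .
  qed
  have Q0: "Q s \<ge> 0" if s: "a < s" "s < b" for s
  proof -
    have s0: "s > 0" using s r by simp
    define l where "l = s / r"
    have l: "l > 0" "l * r = s" using s0 r0 by (auto simp: l_def)
    \<comment> \<open>Both the ball of radius b' and its dilation by l must stay inside the ball of
      radius b, while b' must exceed r. The latter holds because s < b.\<close>
    define b' where "b' = min b (b / l)"
    have b': "r < b'" "b' \<le> R" "b' \<le> b" "l * b' \<le> b"
    proof -
      show "r < b'" using r s l by (simp add: b'_def pos_less_divide_eq mult.commute)
      have "b' \<le> b / l" by (simp add: b'_def)
      then show "l * b' \<le> b" using l by (simp add: pos_le_divide_eq mult.commute)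
    qed (use r in \<open>auto simp: b'_def\<close>)
    define T where "T x = x0 + l *\<^sub>R (x - x0)" for x
    have Tb: "T x \<in> ball x0 R" if x: "x \<in> ball x0 b'" for x
    proof -
      have "norm (x - x0) < b'" using x by (simp add: dist_norm norm_minus_commute)
      then have "l * norm (x - x0) < l * b'" using l by simp
      also have "\<dots> \<le> R" using b'(4) r(4) by simp
      finally show ?thesis using l by (simp add: T_def dist_norm)
    qed
    have Tc: "continuous_on X T" for X unfolding T_def by (intro continuous_intros)
    define \<psi> where "\<psi> x = u (T x) - u x" for x
    define g where "g x = l *\<^sub>R grad u (T x) - grad u x" for x
    have \<psi>d: "GDERIV \<psi> x :> g x" if x: "x \<in> ball x0 b'" for x
    proof -
      have "(T has_derivative (\<lambda>h. l *\<^sub>R h)) (at x)"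
        unfolding T_def by (auto intro!: derivative_eq_intros)
      from has_derivative_compose[OF this D(1)[OF Tb[OF x], unfolded gderiv_def]]
      have "GDERIV (\<lambda>x. u (T x)) x :> l *\<^sub>R grad u (T x)" by (simp add: gderiv_def)
      moreover have "GDERIV u x :> grad u x" using x b' by (intro D(1)) auto
      ultimately show ?thesis unfolding \<psi>_def[abs_def] g_def by (rule GDERIV_diff)
    qed
    have gcont: "continuous_on (ball x0 b') g"
      unfolding g_def using Tb b'
      by (intro continuous_intros continuous_on_compose2[OF D(2) Tc] continuous_on_subset[OF D(2)]) auto
    have Tsp: "T (?sp r x) = ?sp s x" for x using r0 by (simp add: T_def sphere_point_def l_def)
    have Sb': "sphere x0 r \<subseteq> ball x0 b'" using b' by auto
    have "(LINT x:ball x0 r|lborel. pflux p u x \<bullet> g x) = (LINT y|sphere_measure x0 r. w y * \<psi> y)"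
      unfolding w_def using b' by (intro flux_identity[OF u p _ r(1,2) b'(1,2) \<psi>d gcont] nz) auto
    also have "\<dots> = ?c * (LINT x:?P|lborel. w (?sp r x) * \<psi> (?sp r x))"
      by (intro integral_sphere_measure[OF _ r0] continuous_intros wc continuous_on_subset[OF gderiv_continuous[OF \<psi>d] Sb'])
    also have "(LINT x:?P|lborel. w (?sp r x) * \<psi> (?sp r x)) = S s - S r"
    proof -
      have c1: "continuous_on (sphere x0 r) (\<lambda>y. w y * u (T y))"
        using Tb Sb' by (intro continuous_intros wc continuous_on_compose2[OF D(3) Tc]) auto
      have c2: "continuous_on (sphere x0 r) (\<lambda>y. w y * u y)"
        by (intro continuous_intros wc continuous_on_subset[OF uc SA])
      show ?thesis
        using set_integral_diff(2)[OF set_integrable_sphere_point[OF c1] set_integrable_sphere_point[OF c2]] r0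
        by (simp add: S_def \<psi>_def Tsp right_diff_distrib)
    qed
    finally have flux: "(LINT x:ball x0 r|lborel. pflux p u x \<bullet> g x) = B s" by (simp add: B_def)
    have rR: "r < R" and lR: "l * r < R" using r s l by auto
    have iV: "set_integrable lborel (ball x0 r) (\<lambda>x. pflux p u x \<bullet> g x)"
      by (rule set_integrable_pflux_inner[OF u p gcont b'(1,2)])
    note iD = freqD_eq[OF u p rR]
    note iT = freqD_scaling[OF u p r0 l(1) lR]
    have "freqD p u x0 r + p * B s = (LINT x:ball x0 r|lborel. norm (grad u x) powr p + p * (pflux p u x \<bullet> g x))"
      using set_integral_add(2)[OF iD(2) set_integrable_mult_right[OF iV, of p]]
      by (simp add: iD(1) flux)
    also have "\<dots> \<le> (LINT x:ball x0 r|lborel. norm (l *\<^sub>R grad u (x0 + l *\<^sub>R (x - x0))) powr p)"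
    proof (rule set_integral_mono)
      show "set_integrable lborel (ball x0 r) (\<lambda>x. norm (grad u x) powr p + p * (pflux p u x \<bullet> g x))"
        by (intro set_integral_add(1) iD(2) set_integrable_mult_right iV)
      show "norm (grad u x) powr p + p * (pflux p u x \<bullet> g x)
          \<le> norm (l *\<^sub>R grad u (x0 + l *\<^sub>R (x - x0))) powr p" for x
        using norm_powr_tangent[OF p, of "grad u x" "l *\<^sub>R grad u (x0 + l *\<^sub>R (x - x0))"]
        by (simp add: pflux_def weightA_def g_def T_def)
    qed (rule iT(1))
    also have "\<dots> = l powr (p - ?n) * freqD p u x0 s" using iT(2) l by simp
    finally show ?thesis by (simp add: Q_def l_def)
  qed
  have Qr: "Q r = 0" using r0 by (simp add: Q_def B_def)
  have "(Q has_real_derivative ((p - ?n) / r * freqD p u x0 r + d - p * freqG p u x0 r)) (at r)"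
  proof -
    have "((\<lambda>s. s / r) has_real_derivative 1 / r) (at r)" using r0 by (auto intro!: derivative_eq_intros)
    from DERIV_chain2[OF has_real_derivative_powr[of "r / r" "p - ?n"] this]
    have "((\<lambda>s. (s / r) powr (p - ?n)) has_real_derivative (p - ?n) / r) (at r)" using r0 by simp
    from DERIV_diff[OF DERIV_diff[OF DERIV_mult[OF this Dd] DERIV_const] DERIV_cmult[OF Sd]] show ?thesis
      unfolding Q_def[abs_def] by (rule DERIV_cong) (use r0 in simp)
  qed
  \<comment> \<open>Q is differentiable and has a local minimum at r, so its derivative is zero;
    this is an equality obtained from a one-sided inequality.\<close>
  then have "(p - ?n) / r * freqD p u x0 r + d - p * freqG p u x0 r = 0"
  proof (rule DERIV_local_min)
    show "0 < min (r - a) (b - r)" using r by simp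
    show "\<forall>y. \<bar>r - y\<bar> < min (r - a) (b - r) \<longrightarrow> Q r \<le> Q y" using Q0 Qr by auto
  qed
  then have "d = (?n - p) / r * freqD p u x0 r + p * freqG p u x0 r"
    by (simp add: diff_divide_distrib algebra_simps)
  with Dd show ?thesis by simp
qed

text \<open>Energy as a boundary integral. It serves twice: it identifies one of the terms of H',
  and it evaluates the cross term of the square in the final formula.\<close>

lemma freqD_eq_sphere:
  fixes u :: "'a::euclidean_space \<Rightarrow> real"
  assumes u: "p_harmonic_on p (ball x0 R) u" and p: "1 < p"
    and nz: "\<And>x. a < dist x0 x \<Longrightarrow> dist x0 x < b \<Longrightarrow> grad u x \<noteq> 0"
    and r: "0 \<le> a" "a < r" "r < b" "b \<le> R"
  shows "freqD p u x0 r = (LINT y|sphere_measure x0 r. weightA p u y * normal_deriv x0 u y * (u y - u x0))"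
proof -
  note D = p_harmonic_onD[OF u]
  have br: "ball x0 b \<subseteq> ball x0 R" using r by auto
  have "(LINT x:ball x0 r|lborel. pflux p u x \<bullet> grad u x)
    = (LINT y|sphere_measure x0 r. (pflux p u y \<bullet> sphere_normal x0 y) * (u y - u x0))"
  proof (rule flux_identity[OF u p nz r])
    show "GDERIV (\<lambda>x. u x - u x0) x :> grad u x" if "x \<in> ball x0 b" for x
      using GDERIV_diff[OF D(1) GDERIV_const, of x "u x0"] that br by auto
    show "continuous_on (ball x0 b) (grad u)" by (rule continuous_on_subset[OF D(2) br])
  qed
  moreover have "freqD p u x0 r = (LINT x:ball x0 r|lborel. norm (grad u x) powr p)"
    using r by (intro freqD_eq[OF u p]) simp
  ultimately show ?thesis
    unfolding pflux_grad by (simp add: pflux_def normal_deriv_def)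
qed

text \<open>H(s) is n s^(n-1) times an average over a fixed domain. The power contributes (n - 1)/r
  H. The gradient of A v^2 splits into 2 A v Du, whose normal part integrates to 2 D, and v^2 DA,
  which gives K.\<close>

lemma freqH_derivative:
  fixes u :: "'a::euclidean_space \<Rightarrow> real"
  assumes u: "p_harmonic_on p (ball x0 R) u" and p: "1 < p"
    and sm: "Ck_on (Suc (Suc 0)) {x. a < dist x0 x \<and> dist x0 x < b} u"
    and nz: "\<And>x. a < dist x0 x \<Longrightarrow> dist x0 x < b \<Longrightarrow> grad u x \<noteq> 0"
    and r: "0 \<le> a" "a < r" "r < b" "b \<le> R"
  shows "(freqH p u x0 has_real_derivative
        (real DIM('a) - 1) / r * freqH p u x0 r + 2 * freqD p u x0 r + freqK p u x0 r) (at r)"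
proof -
  have r0: "r > 0" using r by simp
  note D = p_harmonic_onD[OF u]
  let ?n = "real DIM('a)"
  let ?A = "{x. a < dist x0 x \<and> dist x0 x < b}"
  have AR: "?A \<subseteq> ball x0 R" using r by auto
  have gc: "continuous_on ?A (grad u)" and uc: "continuous_on ?A u"
    using continuous_on_subset[OF D(2) AR] continuous_on_subset[OF D(3) AR] by auto
  have oA: "open ?A" by (intro open_Collect_conj open_Collect_less continuous_intros)
  have Ad: "GDERIV (weightA p u) x :> grad (weightA p u) x" if "x \<in> ?A" for x
    by (rule weightA_gderiv(1)[OF oA sm]) (use nz that in auto)
  have Ac: "continuous_on ?A (grad (weightA p u))"
    by (rule weightA_gderiv(2)[OF oA sm]) (use nz in auto)
  have Wc: "continuous_on ?A (weightA p u)" using Ad by (rule gderiv_continuous)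
  define q where "q x = weightA p u x * (u x - u x0)\<^sup>2" for x
  define q1 where "q1 x = (2 * weightA p u x * (u x - u x0)) *\<^sub>R grad u x" for x
  define q2 where "q2 x = (u x - u x0)\<^sup>2 *\<^sub>R grad (weightA p u) x" for x
  have qd: "GDERIV q x :> q1 x + q2 x" if x: "x \<in> ?A" for x
  proof -
    have "GDERIV (\<lambda>x. u x - u x0) x :> grad u x - 0"
      using x AR by (intro GDERIV_diff D(1) GDERIV_const) auto
    from GDERIV_mult[OF Ad[OF x] GDERIV_mult[OF this this]]
    show ?thesis
      unfolding q_def[abs_def] power2_eq_square
      by (rule GDERIV_subst) (simp add: q1_def q2_def power2_eq_square mult_ac flip: scaleR_2)
  qed
  have q12c: "continuous_on ?A q1" "continuous_on ?A q2"
    unfolding q1_def q2_def by (intro continuous_intros Wc uc gc Ac)+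
  have qc: "continuous_on ?A q" using qd by (rule gderiv_continuous)
  let ?P = "punctured_ball :: 'a set"
  let ?sp = "sphere_point x0"
  define S where "S s = (LINT x:?P|lborel. 1 * q (?sp s x))" for s
  let ?m = "DIM('a) - 1"
  have HS: "freqH p u x0 s = ?n * s ^ ?m * S s" if s: "s \<in> {a<..<b}" for s
  proof -
    have "freqH p u x0 s = (LINT y|sphere_measure x0 s. q y)" by (simp add: freqH_def q_def)
    also have "\<dots> = ?n * s ^ ?m * (LINT x:?P|lborel. q (?sp s x))"
      using s r by (intro integral_sphere_measure continuous_on_subset[OF qc sphere_subset_annulus]) auto
    finally show ?thesis by (simp add: S_def)
  qed
  let ?\<nu> = "sphere_normal x0"
  note SA = sphere_subset_annulus[OF r(2,3), of x0]
  define S' where "S' = (LINT x:?P|lborel. 1 * ((q1 (?sp r x) + q2 (?sp r x)) \<bullet> ?\<nu> (?sp r x)))"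
  have "(S has_real_derivative S') (at r)"
    unfolding S_def[abs_def] S'_def
    by (intro sphere_average_derivative[where Dq="\<lambda>x. q1 x + q2 x", OF qd _ _ r(1-3)] continuous_intros q12c) auto
  then have "((\<lambda>s. ?n * s ^ ?m * S s) has_real_derivative
      ?n * (real ?m * r ^ (?m - 1)) * S r + ?n * r ^ ?m * S') (at r)"
    by (auto intro!: derivative_eq_intros)
  then have "(freqH p u x0 has_real_derivative ?n * (real ?m * r ^ (?m - 1)) * S r + ?n * r ^ ?m * S') (at r)"
    by (rule has_field_derivative_transform_within_open[of _ _ _ "{a<..<b}"]) (use r HS in auto)
  moreover have "?n * (real ?m * r ^ (?m - 1)) * S r = (?n - 1) / r * freqH p u x0 r"
  proof -
    \<comment> \<open>In dimension one the exponent is truncated, but then the factor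
      \<open>real ?m\<close> is 0 on both sides.\<close>
    have "real ?m * r ^ (?m - 1) = real ?m / r * r ^ ?m" using r0 by (cases ?m) auto
    moreover have "real ?m = ?n - 1" using DIM_positive[where 'a='a] by (simp add: of_nat_diff Suc_le_eq)
    ultimately show ?thesis using HS[of r] r by simp
  qed
  moreover have "?n * r ^ ?m * S' = 2 * freqD p u x0 r + freqK p u x0 r"
  proof -
    have c12: "continuous_on (sphere x0 r) (\<lambda>y. q1 y \<bullet> ?\<nu> y)" "continuous_on (sphere x0 r) (\<lambda>y. q2 y \<bullet> ?\<nu> y)"
      by (intro continuous_intros continuous_on_subset[OF q12c(1) SA] continuous_on_subset[OF q12c(2) SA] sphere_normal_continuous r0)+
    have "?n * r ^ ?m * S' = (LINT y|sphere_measure x0 r. q1 y \<bullet> ?\<nu> y + q2 y \<bullet> ?\<nu> y)"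
      unfolding S'_def using continuous_on_add[OF c12]
      by (subst integral_sphere_measure[OF _ r0]) (simp_all add: inner_add_left)
    also have "\<dots> = (LINT y|sphere_measure x0 r. q1 y \<bullet> ?\<nu> y) + (LINT y|sphere_measure x0 r. q2 y \<bullet> ?\<nu> y)"
      by (intro Bochner_Integration.integral_add integrable_sphere_measure c12 r0)
    also have "(LINT y|sphere_measure x0 r. q2 y \<bullet> ?\<nu> y) = freqK p u x0 r"
      by (simp add: q2_def freqK_def normal_deriv_def)
    also have "(LINT y|sphere_measure x0 r. q1 y \<bullet> ?\<nu> y)
        = (LINT y|sphere_measure x0 r. 2 * (weightA p u y * normal_deriv x0 u y * (u y - u x0)))"
      by (simp add: q1_def normal_deriv_def algebra_simps)
    also have "\<dots> = 2 * freqD p u x0 r" using freqD_eq_sphere[OF u p nz r] by simp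
    finally show ?thesis .
  qed
  ultimately show ?thesis by (simp add: add.assoc)
qed

section \<open>The differential identity for the frequency\<close>

theorem proposition5p1:
  fixes u :: "'a::euclidean_space \<Rightarrow> real" and x0 :: 'a and p R r a b :: real
  assumes "1 < p"
    and "DIM('a) \<ge> 3"
    and "p_harmonic_on p (ball x0 R) u"
    and "0 < r" and "r < R"
    and "0 \<le> a" and "a < r" and "r < b" and "b \<le> R"
    and "smooth_on {x. a < dist x0 x \<and> dist x0 x < b} u"
    and "\<And>x. a < dist x0 x \<Longrightarrow> dist x0 x < b \<Longrightarrow> grad u x \<noteq> 0"
  shows
    "(freqD p u x0 has_real_derivative
        (real DIM('a) - p) / r * freqD p u x0 r + p * freqG p u x0 r) (at r)
     \<and> (freqH p u x0 has_real_derivative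
        (real DIM('a) - 1) / r * freqH p u x0 r + 2 * freqD p u x0 r + freqK p u x0 r) (at r)
     \<and> (freqH p u x0 r > 0 \<longrightarrow>
          freqN p u x0 differentiable (at r)
        \<and> deriv (freqN p u x0) r + freqN p u x0 r * freqTheta p u x0 r
            = p * r / freqH p u x0 r *
              (LINT x|sphere_measure x0 r. weightA p u x *
                 (normal_deriv x0 u x - freqN p u x0 r / r * (u x - u x0))\<^sup>2)
        \<and> deriv (freqN p u x0) r + freqN p u x0 r * freqTheta p u x0 r \<ge> 0)"
proof (intro conjI impI)
  note p = assms(1) and u = assms(3) and r0 = assms(4) and r = assms(6-9) and nz = assms(11)
  let ?n = "real DIM('a)"
  let ?A = "{x. a < dist x0 x \<and> dist x0 x < b}"
  have sm: "Ck_on (Suc (Suc 0)) ?A u" using assms(10) unfolding smooth_on_def by blast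
  show D': "(freqD p u x0 has_real_derivative
        (?n - p) / r * freqD p u x0 r + p * freqG p u x0 r) (at r)"
    by (rule freqD_derivative[OF u p nz r])
  show H': "(freqH p u x0 has_real_derivative
        (?n - 1) / r * freqH p u x0 r + 2 * freqD p u x0 r + freqK p u x0 r) (at r)"
    by (rule freqH_derivative[OF u p sm nz r])
  assume H: "freqH p u x0 r > 0"
  define D0 where "D0 = freqD p u x0 r"
  define H0 where "H0 = freqH p u x0 r"
  define G0 where "G0 = freqG p u x0 r"
  define K0 where "K0 = freqK p u x0 r"
  have H0: "H0 > 0" using H by (simp add: H0_def)
  define D1 where "D1 = (?n - p) / r * D0 + p * G0"
  define H1 where "H1 = (?n - 1) / r * H0 + 2 * D0 + K0"
  have "((\<lambda>s. s * freqD p u x0 s / freqH p u x0 s) has_real_derivative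
      ((1 * D0 + r * D1) * H0 - (r * D0) * H1) / (H0 * H0)) (at r)"
    unfolding D0_def H0_def D1_def H1_def G0_def K0_def using H
    by (auto intro!: derivative_eq_intros D' H')
  then have N': "(freqN p u x0 has_real_derivative ((D0 + r * D1) * H0 - r * D0 * H1) / (H0 * H0)) (at r)"
    unfolding freqN_def[abs_def] by simp
  then show "freqN p u x0 differentiable (at r)"
    unfolding has_field_derivative_def differentiable_def by blast
  have N0: "freqN p u x0 r = r * D0 / H0" by (simp add: freqN_def D0_def H0_def)
  let ?A' = "weightA p u" and ?v = "\<lambda>x. u x - u x0" and ?dn = "normal_deriv x0 u"
  let ?M = "sphere_measure x0 r"
  let ?I = "LINT x|?M. ?A' x * (?dn x - freqN p u x0 r / r * ?v x)\<^sup>2"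
  have AR: "?A \<subseteq> ball x0 R" using r by auto
  note SA = sphere_subset_annulus[OF r(2,3), of x0]
  have gc: "continuous_on (sphere x0 r) (grad u)" and uc: "continuous_on (sphere x0 r) u"
    using continuous_on_subset[OF p_harmonic_onD(2)[OF u]] continuous_on_subset[OF p_harmonic_onD(3)[OF u]] SA AR
    by (meson order_trans)+
  have Ac: "continuous_on (sphere x0 r) ?A'"
    using SA nz by (intro pflux_continuous gc) auto
  have dc: "continuous_on (sphere x0 r) ?dn"
    unfolding normal_deriv_def by (intro continuous_intros gc sphere_normal_continuous r0)
  \<comment> \<open>This value D/H minimises the quadratic G - 2 t D + t^2 H, so expanding the
    square leaves G - D^2/H.\<close>
  define t where "t = freqN p u x0 r / r"
  have t: "t = D0 / H0" using r0 by (simp add: t_def N0)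
  have "?I = (LINT x|?M. ?A' x * (?dn x)\<^sup>2 - 2 * t * (?A' x * ?dn x * ?v x) + t\<^sup>2 * (?A' x * (?v x)\<^sup>2))"
    unfolding t_def[symmetric] by (intro Bochner_Integration.integral_cong) (auto simp: power2_eq_square algebra_simps)
  also have "\<dots> = (LINT x|?M. ?A' x * (?dn x)\<^sup>2) - (LINT x|?M. 2 * t * (?A' x * ?dn x * ?v x)) + (LINT x|?M. t\<^sup>2 * (?A' x * (?v x)\<^sup>2))"
    by (subst Bochner_Integration.integral_add Bochner_Integration.integral_diff,
        (intro Bochner_Integration.integrable_diff integrable_sphere_measure continuous_intros Ac dc uc r0)+)+ simp
  also have "\<dots> = G0 - 2 * t * D0 + t\<^sup>2 * H0"
    using freqD_eq_sphere[OF u p nz r] by (simp add: G0_def D0_def H0_def freqG_def freqH_def)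
  also have "\<dots> = G0 - D0\<^sup>2 / H0" using H0 by (simp add: t power2_eq_square field_simps)
  finally have I: "?I = G0 - D0\<^sup>2 / H0" .
  have Th: "freqTheta p u x0 r = K0 / H0 - (p - 2) * (r * D0 / H0 - 1) / r"
    by (simp add: freqTheta_def N0 K0_def H0_def)
  have "deriv (freqN p u x0) r + freqN p u x0 r * freqTheta p u x0 r
     = ((D0 + r * D1) * H0 - r * D0 * H1) / (H0 * H0) + r * D0 / H0 * (K0 / H0 - (p - 2) * (r * D0 / H0 - 1) / r)"
    by (simp add: DERIV_imp_deriv[OF N'] N0 Th)
  \<comment> \<open>The terms in n combine to (2 - p) D/H, which the term +(p - 2) N/r of N \<Theta>
    cancels, as N K/H cancels the K term. The quotient rule gives 2 copies of -r D^2/H^2 and N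
    \<Theta> another p - 2, in total p.\<close>
  also have "\<dots> = p * r / H0 * (G0 - D0\<^sup>2 / H0)"
    using H0 r0 by (simp add: D1_def H1_def power2_eq_square field_simps)
  also have "\<dots> = p * r / freqH p u x0 r * ?I" unfolding I H0_def ..
  finally show eq: "deriv (freqN p u x0) r + freqN p u x0 r * freqTheta p u x0 r = p * r / freqH p u x0 r * ?I" .
  have "?I \<ge> 0" by (intro Bochner_Integration.integral_nonneg) (simp add: weightA_def)
  then show "deriv (freqN p u x0) r + freqN p u x0 r * freqTheta p u x0 r \<ge> 0"
    unfolding eq using p r0 H by (intro mult_nonneg_nonneg divide_nonneg_nonneg) auto
qed

end
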